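(* Let $k$ be a positive integer, let $G$ be an $8k^2$-edge-connected graph, and let $p$ and $q$ be two integer-valued functions on $V(G)$ such that for each vertex $v$, $p(v)\le d_G(v)/2\le q(v)$ and $|q(v)-p(v)|\le k$. Then $G$ has an orientation such that for each vertex $v$, $d^+_G(v)\in\{p(v),q(v)\}$, if and only if there is an integer-valued function $t$ on $V(G)$ such that $t(v)\in\{p(v),q(v)\}$ for each vertex $v$, and $|E(G)|=\sum_{v\in V(G)}t(v)$.
   Context: Graphs are finite and have no loops, but multiple edges are allowed. $d_G(v)$ is the degree of $v$ in $G$ (counting multiple edges), and $d^+_G(v)$ is the out-degree of $v$ in the orientation of $G$ under consideration. A graph $G$ is $\lambda$-edge-connected if for every nonempty proper subset $S$ of $V(G)$ there are at least $\lambda$ edges with exactly one end in $S$. *)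

theory Defs
  imports Complex_Main "Graph_Theory.Digraph"
begin

text \<open>
  Undirected multigraphs with named edges, so that parallel edges are distinct
  elements of \<open>mg_edges\<close> with the same set of ends.
\<close>

record ('v, 'e) mgraph =
  mg_verts :: "'v set"
  mg_edges :: "'e set"
  mg_ends :: "'e \<Rightarrow> 'v set"

text \<open>Requiring exactly two ends excludes loops.\<close>

locale multigraph =
  fixes G :: "('v, 'e) mgraph" (structure)
  assumes finite_verts: "finite (mg_verts G)"
    and finite_edges: "finite (mg_edges G)"
    and ends_in_verts: "e \<in> mg_edges G \<Longrightarrow> mg_ends G e \<subseteq> mg_verts G"
    and two_ends: "e \<in> mg_edges G \<Longrightarrow> card (mg_ends G e) = 2"

definition mg_degree :: "('v, 'e) mgraph \<Rightarrow> 'v \<Rightarrow> nat" where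
  "mg_degree G v = card {e \<in> mg_edges G. v \<in> mg_ends G e}"

definition edge_boundary :: "('v, 'e) mgraph \<Rightarrow> 'v set \<Rightarrow> 'e set" where
  "edge_boundary G S = {e \<in> mg_edges G. card (mg_ends G e \<inter> S) = 1}"

definition edge_connected :: "nat \<Rightarrow> ('v, 'e) mgraph \<Rightarrow> bool" where
  "edge_connected l G \<longleftrightarrow>
     (\<forall>S. S \<noteq> {} \<and> S \<subset> mg_verts G \<longrightarrow> l \<le> card (edge_boundary G S))"

text \<open>
  An orientation is a digraph on the same vertices whose arcs are the edges
  themselves, each directed from one of its two ends to the other; the library's
  \<open>out_degree\<close> therefore counts parallel edges separately.
\<close>

definition is_orientation :: "('v, 'e) mgraph \<Rightarrow> ('v, 'e) pre_digraph \<Rightarrow> bool" where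
  "is_orientation G D \<longleftrightarrow>
     verts D = mg_verts G \<and> arcs D = mg_edges G \<and>
     (\<forall>e \<in> mg_edges G. {tail D e, head D e} = mg_ends G e)"

end

theory Submission
  imports Defs
begin

text \<open>
  Let \<open>d\<close> be the degree function. By Hakimi's theorem an orientation with out-degrees \<open>t\<close> exists as
  soon as \<open>t - d/2\<close> sums to zero over all vertices and to at most half the number of edges
  leaving \<open>S\<close> over every vertex set \<open>S\<close>. So a choice \<open>t \<in> {p, q}\<close> is needed whose deviation from
  \<open>d/2\<close> is small on all sets simultaneously.

  The core is a rounding theorem: if a symmetric edge weight has all cuts at least 6 and a real
  vertex function \<open>a\<close> has integral sum, then there is an integral \<open>y\<close> with \<open>\<bar>y - a\<bar> < 1\<close> such that
  \<open>y - a\<close> is the net outflow of a flow using at most half the weight of each edge. It is proved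
  for instances in which each vertex may also be joined to an outside terminal through which a
  flow has already been fixed, under the condition that each proper set \<open>A\<close> has boundary at least
  \<open>5 + 2 \<parallel>a(A)\<parallel>\<close>, where \<open>\<parallel>x\<parallel>\<close> is the distance from \<open>x\<close> to the integers. Sets attaining equality
  are contracted and solved separately; a vertex with integral \<open>a\<close> is removed by splitting off its
  edges; and in the remaining case \<open>a\<close> is moved continuously, at the expense of edge weight, until
  one of the first two situations occurs.

  The rounding theorem is applied, with weight \<open>6 / (8 k\<^sup>2)\<close> per edge, separately to each class of
  vertices with the same value of \<open>q - p\<close>, after changing \<open>a\<close> at one vertex per class to make the
  sum integral. The resulting \<open>t\<close> has the required deviation with room to spare, which is used to
  correct its total: since any two sets of \<open>k\<close> numbers from \<open>{1..k}\<close> have nonempty subsets with equal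
  sums, \<open>t\<close> can be moved to the right total by switching few vertices between \<open>p\<close> and \<open>q\<close>.
\<close>

section \<open>Distance to the nearest integer\<close>

text \<open>The rounding is asked for as a flow, not as a family of cut inequalities, because flows
  compose: a flow of a contracted graph fixes what crosses into the contracted set, and this is the
  prescribed terminal flow of the instance left inside. A uniform bound 6 would not survive the
  motion of \<open>a\<close>. In 5 + 2 \<parallel>a(A)\<parallel>, which never exceeds 6, moving
  a(A) towards an integer lowers the demand at rate 2, so weight can be given away without harming
  single vertices, whose contraction would gain nothing. A larger set that becomes tight is welcome:
  its boundary is then a terminal weight small enough for the instance inside it. The constants: at
  a cut with d edges, the classes 1, ..., k scaled by \<open>6 / (8 * k^2)\<close> use at most
  \<open>3 * (k + 1) / (8 * k)\<close> of the permitted d/2. The remainder pays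
  \<open>k * (k + 1) / 2\<close> for making the class sums integral and \<open>k * (k - 1)\<close>
  for correcting the total. For k = 1 and d = 8 nothing is left over.\<close>

definition int_dist :: "real \<Rightarrow> real" where
  "int_dist x = \<bar>x - of_int (round x)\<bar>"

lemma int_dist_le: "int_dist x \<le> \<bar>x - of_int m\<bar>"
  unfolding int_dist_def using round_diff_minimal[of x m] by (simp add: abs_minus_commute)

lemma int_dist_le_half: "int_dist x \<le> 1/2"
  unfolding int_dist_def using of_int_round_abs_le[of x] by (simp add: abs_minus_commute)

lemma int_dist_Lipschitz: "int_dist x \<le> int_dist y + \<bar>x - y\<bar>"
  using int_dist_le[of x "round y"] unfolding int_dist_def by linarith

lemma int_dist_nonneg [simp]: "0 \<le> int_dist x"
  by (simp add: int_dist_def)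

lemma int_dist_add_Ints: assumes "m \<in> \<int>" shows "int_dist (x + m) = int_dist x"
proof -
  obtain i where i: "m = of_int i" using assms by (auto elim: Ints_cases)
  have "int_dist (x + m) \<le> int_dist x"
    using int_dist_le[of "x + m" "round x + i"] by (simp add: i int_dist_def)
  moreover have "int_dist x \<le> int_dist (x + m)"
    using int_dist_le[of x "round (x + m) - i"] unfolding int_dist_def i by (simp add: algebra_simps)
  ultimately show ?thesis by simp
qed

lemma int_dist_diff_Ints: "x - y \<in> \<int> \<Longrightarrow> int_dist x = int_dist y"
  using int_dist_add_Ints[of "x - y" y] by simp

lemma int_dist_uminus [simp]: "int_dist (- x) = int_dist x"
proof -
  have "int_dist (- y) \<le> int_dist y" for y
    using int_dist_le[of "- y" "- round y"] unfolding int_dist_def by (simp add: algebra_simps)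
  from this[of x] this[of "- x"] show ?thesis by simp
qed

lemma int_dist_below: assumes "of_int m - 1/2 \<le> x" "x \<le> of_int m" shows "int_dist x = of_int m - x"
proof -
  have "int_dist x \<le> of_int m - x" using int_dist_le[of x m] assms by simp
  moreover have "of_int m - x \<le> int_dist x"
  proof (cases "round x \<ge> m")
    case True
    then have "(of_int m::real) \<le> of_int (round x)" by simp
    then show ?thesis unfolding int_dist_def using assms by linarith
  next
    case False
    then have "(of_int (round x)::real) \<le> of_int m - 1"
      by (metis of_int_1 of_int_diff of_int_le_iff zle_diff1_eq not_le)
    then show ?thesis unfolding int_dist_def using assms by linarith
  qed
  ultimately show ?thesis by simp
qed

lemma int_dist_above: assumes "of_int m \<le> x" "x \<le> of_int m + 1/2" shows "int_dist x = x - of_int m"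
  using int_dist_below[of "- m" "- x"] assms by simp

lemma continuous_on_int_dist: "continuous_on S int_dist"
  unfolding continuous_on_def
proof (intro ballI tendstoI)
  fix x e :: real assume "0 < e"
  have "dist (int_dist x') (int_dist x) < e" if "dist x' x < e" for x'
    using that int_dist_Lipschitz[of x x'] int_dist_Lipschitz[of x' x] by (simp add: dist_real_def)
  then show "\<forall>\<^sub>F x' in at x within S. dist (int_dist x') (int_dist x) < e"
    unfolding eventually_at using \<open>0 < e\<close> by blast
qed

lemma continuous_on_int_dist_comp:
  "continuous_on S f \<Longrightarrow> continuous_on S (\<lambda>x. int_dist (f x))"
  using continuous_on_compose2[OF continuous_on_int_dist[of UNIV]] by blast

text \<open>Intermediate value theorem for the pointwise minimum of \<open>F\<close>. Any zero of
  the minimum will do, since all functions are nonnegative there; it need not be the first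
  one.\<close>

lemma first_zero:
  fixes F :: "(real \<Rightarrow> real) set"
  assumes "finite F" "0 \<le> T"
    and "\<And>f. f \<in> F \<Longrightarrow> continuous_on {0..T} f" and "\<And>f. f \<in> F \<Longrightarrow> 0 \<le> f 0"
  shows "\<exists>\<theta>. 0 \<le> \<theta> \<and> \<theta> \<le> T \<and> (\<forall>f\<in>F. 0 \<le> f \<theta>) \<and> (\<theta> = T \<or> \<theta> < T \<and> (\<exists>f\<in>F. f \<theta> = 0))"
proof (cases "F = {}")
  case True
  then show ?thesis using assms(2) by (intro exI[of _ T]) auto
next
  case False
  have "\<exists>m. continuous_on {0..T} m \<and> (\<forall>x. m x = Min ((\<lambda>f. f x) ` F))"
    using assms(1) False assms(3)
  proof (induction F rule: finite_ne_induct)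
    case (singleton f)
    then show ?case by (intro exI[of _ f]) auto
  next
    case (insert f F)
    then obtain m where m: "continuous_on {0..T} m" "\<forall>x. m x = Min ((\<lambda>f. f x) ` F)" by auto
    have "continuous_on {0..T} (\<lambda>x. min (f x) (m x))"
      using m(1) insert.prems by (intro continuous_on_min) auto
    then show ?case using insert.hyps m(2) by (intro exI[of _ "\<lambda>x. min (f x) (m x)"]) auto
  qed
  then obtain m where m: "continuous_on {0..T} m" "\<And>x. m x = Min ((\<lambda>f. f x) ` F)" by blast
  have m_le: "m x \<le> f x" if "f \<in> F" for f x using that assms(1) by (auto simp: m(2))
  have m_in: "\<exists>f\<in>F. m x = f x" for x
  proof -
    have "Min ((\<lambda>f. f x) ` F) \<in> (\<lambda>f. f x) ` F" using assms(1) False by (intro Min_in) auto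
    then show ?thesis using m(2)[of x] by auto
  qed
  have m0: "0 \<le> m 0" using m_in[of 0] assms(4) by auto
  show ?thesis
  proof (cases "0 \<le> m T")
    case True
    then have "0 \<le> f T" if "f \<in> F" for f using m_le[OF that, of T] by linarith
    then show ?thesis using assms(2) by (intro exI[of _ T]) auto
  next
    case False
    then obtain x where x: "0 \<le> x" "x \<le> T" "m x = 0"
      using IVT2'[of m T 0 0] m0 m(1) assms(2) by auto
    moreover have "x \<noteq> T" using False x by auto
    moreover have "0 \<le> f x" if "f \<in> F" for f using m_le[OF that, of x] x by linarith
    moreover have "\<exists>f\<in>F. f x = 0" using m_in[of x] x by auto
    ultimately show ?thesis by (intro exI[of _ x]) auto
  qed
qed

section \<open>Cuts and routable supplies\<close>

definition cut_weight :: "('v \<Rightarrow> 'v \<Rightarrow> real) \<Rightarrow> 'v set \<Rightarrow> 'v set \<Rightarrow> real" where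
  "cut_weight w A B = (\<Sum>u\<in>A. \<Sum>v\<in>B. w u v)"

text \<open>\<open>z\<close> is the weight of the edges to a vertex outside \<open>V\<close>, so
  this is a cut of the enlarged graph. In particular the boundary of \<open>V\<close> itself is
  \<open>sum z V\<close>.\<close>

definition boundary :: "'v set \<Rightarrow> ('v \<Rightarrow> 'v \<Rightarrow> real) \<Rightarrow> ('v \<Rightarrow> real) \<Rightarrow> 'v set \<Rightarrow> real" where
  "boundary V w z A = cut_weight w A (V - A) + sum z A"

definition weighting :: "('v \<Rightarrow> 'v \<Rightarrow> real) \<Rightarrow> bool" where
  "weighting w \<longleftrightarrow> (\<forall>u v. w u v = w v u \<and> 0 \<le> w u v)"

text \<open>The factor 2 comes from orientations: relative to half the degrees, directing an edge
  moves half a unit from one end to the other.\<close>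

definition routable :: "'v set \<Rightarrow> ('v \<Rightarrow> 'v \<Rightarrow> real) \<Rightarrow> ('v \<Rightarrow> real) \<Rightarrow> bool" where
  "routable V w s \<longleftrightarrow> (\<exists>\<phi>. (\<forall>u\<in>V. \<forall>v\<in>V. \<phi> u v = - \<phi> v u \<and> 2 * \<bar>\<phi> u v\<bar> \<le> w u v) \<and>
     (\<forall>v\<in>V. (\<Sum>u\<in>V. \<phi> v u) = s v))"

definition link :: "'v \<Rightarrow> 'v \<Rightarrow> 'v \<Rightarrow> 'v \<Rightarrow> real" where
  "link x y u v = of_bool (u = x \<and> v = y) + of_bool (u = y \<and> v = x)"

definition arrow :: "'v \<Rightarrow> 'v \<Rightarrow> 'v \<Rightarrow> 'v \<Rightarrow> real" where
  "arrow x y u v = of_bool (u = x \<and> v = y) - of_bool (u = y \<and> v = x)"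

lemma weightingD: "weighting w \<Longrightarrow> w u v = w v u" "weighting w \<Longrightarrow> 0 \<le> w u v"
  by (auto simp: weighting_def)

lemma cut_nonneg: "weighting w \<Longrightarrow> 0 \<le> cut_weight w A B"
  unfolding cut_weight_def by (intro sum_nonneg weightingD(2))

lemma cut_commute:
  assumes "weighting w"
  shows "cut_weight w A B = cut_weight w B A"
proof -
  have "w u v = w v u" for u v using assms by (rule weightingD(1))
  then have "(\<Sum>u\<in>A. \<Sum>v\<in>B. w u v) = (\<Sum>u\<in>A. \<Sum>v\<in>B. w v u)"
    by (intro sum.cong refl)
  then show ?thesis unfolding cut_weight_def by (subst (asm) (2) sum.swap)
qed

lemma cut_add: "cut_weight (\<lambda>u v. f u v + g u v) A B = cut_weight f A B + cut_weight g A B"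
  by (simp add: cut_weight_def sum.distrib)

lemma cut_diff: "cut_weight (\<lambda>u v. f u v - g u v) A B = cut_weight f A B - cut_weight g A B"
  by (simp add: cut_weight_def sum_subtractf)

lemma cut_scale: "cut_weight (\<lambda>u v. c * f u v) A B = c * cut_weight f A B"
  by (simp add: cut_weight_def sum_distrib_left)

lemma cut_Un_left: "finite A \<Longrightarrow> finite B \<Longrightarrow> A \<inter> B = {} \<Longrightarrow> cut_weight w (A \<union> B) C = cut_weight w A C + cut_weight w B C"
  by (simp add: cut_weight_def sum.union_disjoint)

lemma cut_Un_right: "finite A \<Longrightarrow> finite B \<Longrightarrow> A \<inter> B = {} \<Longrightarrow> cut_weight w C (A \<union> B) = cut_weight w C A + cut_weight w C B"
  by (simp add: cut_weight_def sum.union_disjoint sum.distrib)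

lemma cut_link:
  assumes "finite A" "finite B"
  shows "cut_weight (link x y) A B = of_bool (x \<in> A \<and> y \<in> B) + of_bool (y \<in> A \<and> x \<in> B)"
proof -
  have *: "(\<Sum>u\<in>A. \<Sum>v\<in>B. of_bool (u = p \<and> v = q)) = (of_bool (p \<in> A \<and> q \<in> B) :: real)" for p q
  proof -
    have "(\<Sum>v\<in>B. of_bool (u = p \<and> v = q)) = (if u = p then of_bool (q \<in> B) else 0 :: real)" for u
      using assms by (auto simp: sum.delta of_bool_def)
    then show ?thesis using assms by (simp add: sum.delta)
  qed
  show ?thesis by (simp add: cut_weight_def link_def sum.distrib *)
qed

lemma sum_arrow:
  assumes "finite V"
  shows "(\<Sum>u\<in>V. arrow x y v u) = of_bool (v = x \<and> y \<in> V) - of_bool (v = y \<and> x \<in> V)"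
proof -
  have *: "(\<Sum>u\<in>V. of_bool (v = p \<and> u = q)) = (of_bool (v = p \<and> q \<in> V) :: real)" for p q
    using assms by (cases "v = p") (auto simp: of_bool_def sum.delta)
  show ?thesis by (simp add: arrow_def sum_subtractf *)
qed

lemma arrow_antisym: "arrow x y u v = - arrow x y v u"
proof -
  have "(v = x \<and> u = y) = (u = y \<and> v = x)" "(v = y \<and> u = x) = (u = x \<and> v = y)" by blast+
  then show ?thesis unfolding arrow_def by (simp only: minus_diff_eq)
qed

lemma link_commute: "link x y u v = link x y v u"
proof -
  have "(v = x \<and> u = y) = (u = y \<and> v = x)" "(v = y \<and> u = x) = (u = x \<and> v = y)" by blast+
  then show ?thesis unfolding link_def by (simp only: add.commute)
qed

lemma link_nonneg: "0 \<le> link x y u v"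
  unfolding link_def by (intro add_nonneg_nonneg zero_less_eq_of_bool)

lemma abs_arrow_le: "\<bar>arrow x y u v\<bar> \<le> link x y u v"
proof -
  have "\<bar>p - q\<bar> \<le> p + q" if "0 \<le> p" "0 \<le> q" for p q :: real using that by linarith
  then show ?thesis unfolding arrow_def link_def by (meson zero_less_eq_of_bool)
qed

lemma link_arrow_values:
  assumes "x \<noteq> y"
  shows "link x y x y = 1" "link x y y x = 1" "arrow x y x y = 1" "arrow x y y x = - 1"
  using assms by (simp_all add: link_def arrow_def)

lemma link_eq_0: "\<not> (u = x \<and> v = y) \<Longrightarrow> \<not> (u = y \<and> v = x) \<Longrightarrow> link x y u v = 0"
  unfolding link_def by (simp only: of_bool_eq add_0_left)

lemma arrow_eq_0: "\<not> (u = x \<and> v = y) \<Longrightarrow> \<not> (u = y \<and> v = x) \<Longrightarrow> arrow x y u v = 0"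
  unfolding arrow_def by (simp only: of_bool_eq diff_0_right)

lemma double_abs_add_le: "2 * \<bar>a\<bar> \<le> p \<Longrightarrow> 2 * \<bar>b\<bar> \<le> q \<Longrightarrow> 2 * \<bar>a + b\<bar> \<le> p + q" for a b p q :: real
  by (smt (verit))

text \<open>The withheld weight \<epsilon> of the edge xy can carry any amount up to \<epsilon>/2 in
  either direction, which alters the supplies at \<open>x\<close> and \<open>y\<close> only.\<close>

lemma routable_restore_edge:
  assumes "routable V (\<lambda>u v. w u v - \<epsilon> * link x y u v) s'"
    and "finite V" "x \<in> V" "y \<in> V" "2 * \<bar>\<kappa>\<bar> \<le> \<epsilon>"
    and "\<And>v. v \<in> V \<Longrightarrow> s v = s' v + \<kappa> * (of_bool (v = x) - of_bool (v = y))"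
  shows "routable V w s"
proof -
  from assms(1) obtain \<phi> where \<phi>: "\<And>u v. u \<in> V \<Longrightarrow> v \<in> V \<Longrightarrow> \<phi> u v = - \<phi> v u"
    "\<And>u v. u \<in> V \<Longrightarrow> v \<in> V \<Longrightarrow> 2 * \<bar>\<phi> u v\<bar> \<le> w u v - \<epsilon> * link x y u v"
    "\<And>v. v \<in> V \<Longrightarrow> (\<Sum>u\<in>V. \<phi> v u) = s' v"
    unfolding routable_def by blast
  let ?\<psi> = "\<lambda>u v. \<phi> u v + \<kappa> * arrow x y u v"
  show ?thesis
    unfolding routable_def
  proof (intro exI[of _ ?\<psi>] conjI ballI)
    fix u v assume uv: "u \<in> V" "v \<in> V"
    show "?\<psi> u v = - ?\<psi> v u"
      using \<phi>(1)[OF uv] arrow_antisym[of x y u v] by (metis mult_minus_right minus_add_distrib)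
    have "2 * \<bar>\<kappa> * arrow x y u v\<bar> \<le> \<epsilon> * link x y u v"
      using mult_mono[OF assms(5) abs_arrow_le[of x y u v]] order_trans[OF _ assms(5), of 0]
      by (simp add: abs_mult)
    then show "2 * \<bar>?\<psi> u v\<bar> \<le> w u v"
      using double_abs_add_le[OF \<phi>(2)[OF uv]] by fastforce
  next
    fix v assume "v \<in> V"
    have "(\<Sum>u\<in>V. ?\<psi> v u) = (\<Sum>u\<in>V. \<phi> v u) + \<kappa> * (\<Sum>u\<in>V. arrow x y v u)"
      by (simp only: sum.distrib sum_distrib_left)
    then show "(\<Sum>u\<in>V. ?\<psi> v u) = s v"
      using \<phi>(3)[OF \<open>v \<in> V\<close>] assms(6)[OF \<open>v \<in> V\<close>] assms(3,4) sum_arrow[OF assms(2), of x y v] by simp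
  qed
qed

text \<open>Undoes the splitting off of xy and xy' into a new edge yy': whatever the flow sends
  along the new edge is sent along y, x, y' instead, which leaves all supplies unchanged.\<close>

lemma routable_unlift:
  assumes "routable V (\<lambda>u v. w u v - \<epsilon> * link x y u v - \<epsilon> * link x y' u v + \<epsilon> * link y y' u v) s"
    and "finite V" "x \<in> V" "y \<in> V" "y' \<in> V" "distinct [x, y, y']" "0 \<le> \<epsilon>" "weighting w"
  shows "routable V w s"
proof -
  define w1 where "w1 = (\<lambda>u v. w u v - \<epsilon> * link x y u v - \<epsilon> * link x y' u v + \<epsilon> * link y y' u v)"
  from assms(1) obtain \<phi> where \<phi>: "\<And>u v. u \<in> V \<Longrightarrow> v \<in> V \<Longrightarrow> \<phi> u v = - \<phi> v u"
    "\<And>u v. u \<in> V \<Longrightarrow> v \<in> V \<Longrightarrow> 2 * \<bar>\<phi> u v\<bar> \<le> w1 u v"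
    "\<And>v. v \<in> V \<Longrightarrow> (\<Sum>u\<in>V. \<phi> v u) = s v"
    unfolding routable_def w1_def by blast
  define W where "W = w y y' + \<epsilon>"
  have ne: "x \<noteq> y" "x \<noteq> y'" "y \<noteq> y'" using assms(6) by auto
  have W: "w1 y y' = W"
    using ne by (simp add: w1_def W_def link_arrow_values link_eq_0)
  have W0: "0 \<le> w y y'" using assms(8) by (rule weightingD(2))
  \<comment> \<open>The flow from \<open>y\<close> to \<open>y'\<close> is divided in the ratio of
    \<epsilon> to \<open>w y y'\<close>, so that each part respects half of its own weight.\<close>
  define g where "g = (if W = 0 then 0 else \<phi> y y' * (\<epsilon> / W))"
  have f: "2 * \<bar>\<phi> y y'\<bar> \<le> W" using \<phi>(2)[of y y'] assms W by simp
  have g1: "2 * \<bar>g\<bar> \<le> \<epsilon>"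
  proof (cases "W = 0")
    case False
    then have "0 < W" using W0 assms(7) by (simp add: W_def)
    then have "2 * \<bar>g\<bar> = (2 * \<bar>\<phi> y y'\<bar>) * (\<epsilon> / W)" using assms(7) by (simp add: g_def abs_mult)
    also have "\<dots> \<le> W * (\<epsilon> / W)" using f assms(7) \<open>0 < W\<close> by (intro mult_right_mono) auto
    finally show ?thesis using \<open>0 < W\<close> by simp
  qed (use assms(7) in \<open>simp add: g_def\<close>)
  have g2: "2 * \<bar>\<phi> y y' - g\<bar> \<le> w y y'"
  proof (cases "W = 0")
    case False
    then have "0 < W" using W0 assms(7) by (simp add: W_def)
    then have "\<phi> y y' - g = \<phi> y y' * (w y y' / W)"
      using False by (simp add: g_def W_def field_simps)
    then have "2 * \<bar>\<phi> y y' - g\<bar> = (2 * \<bar>\<phi> y y'\<bar>) * (w y y' / W)"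
      using W0 \<open>0 < W\<close> by (simp add: abs_mult)
    also have "\<dots> \<le> W * (w y y' / W)" using f W0 \<open>0 < W\<close> by (intro mult_right_mono) auto
    finally show ?thesis using \<open>0 < W\<close> by simp
  next
    case True
    then show ?thesis using f W0 by (simp add: g_def)
  qed
  let ?\<psi> = "\<lambda>u v. \<phi> u v + g * arrow y x u v + g * arrow x y' u v - g * arrow y y' u v"
  show ?thesis
    unfolding routable_def
  proof (intro exI[of _ ?\<psi>] conjI ballI)
    fix u v assume uv: "u \<in> V" "v \<in> V"
    show "?\<psi> u v = - ?\<psi> v u"
      unfolding \<phi>(1)[OF uv] arrow_antisym[of _ _ u v] by (simp only: mult_minus_right)
    have ar: "2 * \<bar>g * arrow p q u v\<bar> \<le> \<epsilon> * link p q u v" for p q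
      using mult_mono[OF g1 abs_arrow_le[of p q u v]] assms(7) by (simp add: abs_mult)
    have main: "2 * \<bar>\<phi> u v - g * arrow y y' u v\<bar> \<le> w1 u v - \<epsilon> * link y y' u v"
    proof (cases "u = y \<and> v = y'")
      case True
      then show ?thesis using g2 W link_arrow_values[OF ne(3)] by (simp add: W_def)
    next
      case F1: False
      show ?thesis
      proof (cases "u = y' \<and> v = y")
        case True
        have "w1 y' y = W"
          using ne weightingD(1)[OF assms(8), of y' y]
          by (simp add: w1_def W_def link_arrow_values link_eq_0)
        moreover have "\<phi> y' y = - \<phi> y y'" using \<phi>(1) assms by blast
        moreover have "\<bar>g - \<phi> y y'\<bar> = \<bar>\<phi> y y' - g\<bar>" by (rule abs_minus_commute)
        ultimately show ?thesis using g2 True link_arrow_values[OF ne(3)] by (simp add: W_def)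
      next
        case False
        then have "arrow y y' u v = 0" "link y y' u v = 0" using F1 by (auto intro: arrow_eq_0 link_eq_0)
        then show ?thesis using \<phi>(2)[OF uv] by simp
      qed
    qed
    have "link y x u v = link x y u v" unfolding link_def by (simp only: add.commute)
    then show "2 * \<bar>?\<psi> u v\<bar> \<le> w u v"
      using double_abs_add_le[OF double_abs_add_le[OF main ar[of y x]] ar[of x y']]
      by (simp add: w1_def algebra_simps)
  next
    fix v assume "v \<in> V"
    have "(\<Sum>u\<in>V. ?\<psi> v u) = (\<Sum>u\<in>V. \<phi> v u) + g * (\<Sum>u\<in>V. arrow y x v u)
        + g * (\<Sum>u\<in>V. arrow x y' v u) - g * (\<Sum>u\<in>V. arrow y y' v u)"
      by (simp only: sum.distrib sum_subtractf sum_distrib_left)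
    then show "(\<Sum>u\<in>V. ?\<psi> v u) = s v"
      using \<phi>(3)[OF \<open>v \<in> V\<close>] assms(3-5) by (simp add: sum_arrow[OF assms(2)] algebra_simps)
  qed
qed

lemma routable_uminus:
  assumes "routable V w (\<lambda>v. - s v)"
  shows "routable V w s"
proof -
  from assms obtain \<phi> where \<phi>: "\<And>u v. u \<in> V \<Longrightarrow> v \<in> V \<Longrightarrow> \<phi> u v = - \<phi> v u"
    "\<And>u v. u \<in> V \<Longrightarrow> v \<in> V \<Longrightarrow> 2 * \<bar>\<phi> u v\<bar> \<le> w u v"
    "\<And>v. v \<in> V \<Longrightarrow> (\<Sum>u\<in>V. \<phi> v u) = - s v"
    unfolding routable_def by blast
  show ?thesis
    unfolding routable_def
  proof (intro exI[of _ "\<lambda>u v. - \<phi> u v"] conjI ballI)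
    fix u v assume uv: "u \<in> V" "v \<in> V"
    show "- \<phi> u v = - (- \<phi> v u)" using \<phi>(1)[OF uv] by simp
    show "2 * \<bar>- \<phi> u v\<bar> \<le> w u v" using \<phi>(2)[OF uv] by simp
  next
    fix v assume "v \<in> V"
    then show "(\<Sum>u\<in>V. - \<phi> v u) = s v" using \<phi>(3) by (simp add: sum_negf)
  qed
qed

lemma routable_cong:
  "(\<And>v. v \<in> V \<Longrightarrow> s v = s' v) \<Longrightarrow> routable V w s \<Longrightarrow> routable V w s'"
  unfolding routable_def by simp

text \<open>By antisymmetry the flow inside \<open>S\<close> cancels, so the total supply of
  \<open>S\<close> has to leave through the cut.\<close>

lemma routable_cut_bound:
  assumes "routable V w s" "finite V" "S \<subseteq> V"
  shows "2 * \<bar>sum s S\<bar> \<le> cut_weight w S (V - S)"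
proof -
  from assms(1) obtain \<phi> where \<phi>: "\<And>u v. u \<in> V \<Longrightarrow> v \<in> V \<Longrightarrow> \<phi> u v = - \<phi> v u"
    "\<And>u v. u \<in> V \<Longrightarrow> v \<in> V \<Longrightarrow> 2 * \<bar>\<phi> u v\<bar> \<le> w u v"
    "\<And>v. v \<in> V \<Longrightarrow> (\<Sum>u\<in>V. \<phi> v u) = s v"
    unfolding routable_def by blast
  have fin: "finite S" "finite (V - S)" using assms finite_subset by auto
  have "cut_weight \<phi> S S = - cut_weight \<phi> S S"
  proof -
    have "cut_weight \<phi> S S = (\<Sum>u\<in>S. \<Sum>v\<in>S. - \<phi> v u)"
      unfolding cut_weight_def using \<phi>(1) assms(3) by (intro sum.cong) auto
    also have "\<dots> = - cut_weight \<phi> S S" unfolding cut_weight_def by (subst sum.swap) (simp add: sum_negf)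
    finally show ?thesis .
  qed
  then have z: "cut_weight \<phi> S S = 0" by simp
  have "sum s S = (\<Sum>v\<in>S. \<Sum>u\<in>V. \<phi> v u)" using \<phi>(3) assms(3) by (intro sum.cong) auto
  also have "\<dots> = cut_weight \<phi> S (S \<union> (V - S))" using assms(3) by (simp add: cut_weight_def Un_absorb1)
  also have "\<dots> = cut_weight \<phi> S (V - S)" using fin z by (subst cut_Un_right) auto
  finally have eq: "sum s S = cut_weight \<phi> S (V - S)" .
  have "2 * \<bar>cut_weight \<phi> S (V - S)\<bar> \<le> (\<Sum>u\<in>S. \<Sum>v\<in>V - S. 2 * \<bar>\<phi> u v\<bar>)"
  proof -
    have "\<bar>cut_weight \<phi> S (V - S)\<bar> \<le> (\<Sum>u\<in>S. \<Sum>v\<in>V - S. \<bar>\<phi> u v\<bar>)"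
      unfolding cut_weight_def by (rule order_trans[OF sum_abs sum_mono]) (rule sum_abs)
    then show ?thesis by (simp add: sum_distrib_left[symmetric])
  qed
  also have "\<dots> \<le> cut_weight w S (V - S)"
    unfolding cut_weight_def using \<phi>(2) assms(3) by (intro sum_mono) auto
  finally show ?thesis using eq by simp
qed

section \<open>Contracting a vertex set\<close>

text \<open>A representative \<open>s\<close> of \<open>S\<close> serves as the contracted vertex,
  so no new vertex type is needed. The contracted weight may have a loop at \<open>s\<close>; loops
  lie in no cut, and an antisymmetric flow vanishes on them.\<close>

definition fibre :: "'v set \<Rightarrow> 'v \<Rightarrow> 'v \<Rightarrow> 'v set" where
  "fibre S s u = (if u = s then S else {u})"

definition blow_up :: "'v set \<Rightarrow> 'v \<Rightarrow> 'v set \<Rightarrow> 'v set" where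
  "blow_up S s A = (if s \<in> A then A \<union> S else A)"

lemma sum_fibre:
  assumes "finite V" "S \<subseteq> V" "s \<in> S" "A \<subseteq> insert s (V - S)"
  shows "(\<Sum>u\<in>A. sum f (fibre S s u)) = sum f (blow_up S s A)"
proof -
  have fin: "finite A" "finite S" using assms by (auto intro: finite_subset)
  have *: "(\<Sum>u\<in>B. sum f (fibre S s u)) = sum f B" if "s \<notin> B" for B
    using that by (intro sum.cong) (auto simp: fibre_def)
  show ?thesis
  proof (cases "s \<in> A")
    case True
    have eq: "blow_up S s A = S \<union> (A - {s})" using True assms(3) by (auto simp: blow_up_def)
    have "(\<Sum>u\<in>A. sum f (fibre S s u)) = sum f (fibre S s s) + (\<Sum>u\<in>A - {s}. sum f (fibre S s u))"
      using fin True by (simp add: sum.remove)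
    also have "\<dots> = sum f S + sum f (A - {s})" by (simp add: * fibre_def)
    also have "\<dots> = sum f (blow_up S s A)"
      unfolding eq using fin assms(4) by (subst sum.union_disjoint) auto
    finally show ?thesis .
  next
    case False
    then show ?thesis by (simp add: * blow_up_def)
  qed
qed

lemma cut_fibre:
  assumes "finite V" "S \<subseteq> V" "s \<in> S" "A \<subseteq> insert s (V - S)" "B \<subseteq> insert s (V - S)"
  shows "cut_weight (\<lambda>u v. cut_weight w (fibre S s u) (fibre S s v)) A B =
    cut_weight w (blow_up S s A) (blow_up S s B)"
proof -
  have "(\<Sum>v\<in>B. cut_weight w (fibre S s u) (fibre S s v)) =
      (\<Sum>x\<in>fibre S s u. \<Sum>y\<in>blow_up S s B. w x y)" for u
  proof -
    have "(\<Sum>v\<in>B. cut_weight w (fibre S s u) (fibre S s v)) =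
        (\<Sum>x\<in>fibre S s u. \<Sum>v\<in>B. \<Sum>y\<in>fibre S s v. w x y)"
      unfolding cut_weight_def by (rule sum.swap)
    then show ?thesis by (simp only: sum_fibre[OF assms(1-3,5)])
  qed
  then have "cut_weight (\<lambda>u v. cut_weight w (fibre S s u) (fibre S s v)) A B =
      (\<Sum>u\<in>A. \<Sum>x\<in>fibre S s u. \<Sum>y\<in>blow_up S s B. w x y)"
    unfolding cut_weight_def[of "\<lambda>u v. cut_weight w (fibre S s u) (fibre S s v)"] by simp
  also have "\<dots> = cut_weight w (blow_up S s A) (blow_up S s B)"
    unfolding cut_weight_def by (rule sum_fibre[OF assms(1-4)])
  finally show ?thesis .
qed

lemma blow_up_diff:
  assumes "S \<subseteq> V" "s \<in> S" "A \<subseteq> insert s (V - S)"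
  shows "blow_up S s (insert s (V - S) - A) = V - blow_up S s A"
  using assms by (auto simp: blow_up_def)

lemma boundary_fibre:
  assumes "finite V" "S \<subseteq> V" "s \<in> S" "A \<subseteq> insert s (V - S)"
  shows "boundary (insert s (V - S)) (\<lambda>u v. cut_weight w (fibre S s u) (fibre S s v))
      (\<lambda>u. sum z (fibre S s u)) A = boundary V w z (blow_up S s A)"
  unfolding boundary_def
  using assms by (simp add: cut_fibre sum_fibre blow_up_diff)

lemma blow_up_all: "S \<subseteq> V \<Longrightarrow> s \<in> S \<Longrightarrow> blow_up S s (insert s (V - S)) = V"
  by (auto simp: blow_up_def)

lemma blow_up_proper:
  assumes "S \<subseteq> V" "s \<in> S" "A \<noteq> {}" "A \<subset> insert s (V - S)"
  shows "blow_up S s A \<noteq> {}" "blow_up S s A \<subset> V"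
  using assms by (auto simp: blow_up_def)

lemma weighting_fibre:
  "weighting w \<Longrightarrow> weighting (\<lambda>u v. cut_weight w (fibre S s u) (fibre S s v))"
  unfolding weighting_def[of "\<lambda>u v. cut_weight w (fibre S s u) (fibre S s v)"]
  by (intro allI conjI cut_commute cut_nonneg)

text \<open>\<xi> records what each vertex of \<open>S\<close> sends to the outside once the
  contracted flow has been spread over the original edges. The last conclusion ranges over all
  \<open>s''\<close> because the supplies inside \<open>S\<close> are chosen only after \<xi> is
  known.\<close>

lemma routable_expand:
  assumes "finite V" "S \<subseteq> V" "s \<in> S" "weighting w"
    and "routable (insert s (V - S)) (\<lambda>u v. cut_weight w (fibre S s u) (fibre S s v)) s'"
  obtains \<xi> where "\<And>v. v \<in> S \<Longrightarrow> 2 * \<bar>\<xi> v\<bar> \<le> cut_weight w {v} (V - S)" "sum \<xi> S = s' s"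
    "\<forall>s''. (\<forall>v\<in>V - S. s'' v = s' v) \<longrightarrow> routable S w (\<lambda>v. s'' v - \<xi> v) \<longrightarrow> routable V w s''"
proof -
  define V' where "V' = insert s (V - S)"
  define w' where "w' = (\<lambda>u v. cut_weight w (fibre S s u) (fibre S s v))"
  obtain \<phi> where \<phi>: "\<And>u v. u \<in> V' \<Longrightarrow> v \<in> V' \<Longrightarrow> \<phi> u v = - \<phi> v u"
    "\<And>u v. u \<in> V' \<Longrightarrow> v \<in> V' \<Longrightarrow> 2 * \<bar>\<phi> u v\<bar> \<le> w' u v"
    "\<And>v. v \<in> V' \<Longrightarrow> (\<Sum>u\<in>V'. \<phi> v u) = s' v"
    using assms(5)[folded V'_def w'_def] unfolding routable_def by blast
  have fin: "finite S" "finite (V - S)" using assms(1,2) by (auto intro: finite_subset)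
  have sV: "s \<notin> V - S" "s \<in> V'" "V - S \<subseteq> V'" using assms(3) by (auto simp: V'_def)
  note w0 = weightingD(2)[OF assms(4)] and wc = weightingD(1)[OF assms(4)]
  have w's: "w' s u = (\<Sum>v\<in>S. w v u)" if "u \<in> V - S" for u
    using that sV by (auto simp: w'_def cut_weight_def fibre_def)
  have w'u: "w' u v = w u v" if "u \<in> V - S" "v \<in> V - S" for u v
    using that sV by (auto simp: w'_def cut_weight_def fibre_def)
  \<comment> \<open>The flow from \<open>S\<close> to \<open>u\<close> is spread over the edges in
    proportion to their weights. If \<open>w' s u = 0\<close>, the capacity forces
    \<open>\<phi> s u = 0\<close>, so division by zero does no harm.\<close>
  define \<psi> where "\<psi> = (\<lambda>v u. \<phi> s u * (w v u / w' s u))"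
  have w's0: "0 \<le> w' s u" if "u \<in> V - S" for u using that by (simp add: w's sum_nonneg w0)
  have \<psi>_cap: "2 * \<bar>\<psi> v u\<bar> \<le> w v u" if "v \<in> S" "u \<in> V - S" for u v
  proof (cases "w' s u = 0")
    case False
    then have pos: "0 < w' s u" using w's0 that by fastforce
    have "2 * \<bar>\<psi> v u\<bar> = (2 * \<bar>\<phi> s u\<bar>) * (w v u / w' s u)"
      using pos w0[of v u] by (simp add: \<psi>_def abs_mult)
    also have "\<dots> \<le> w' s u * (w v u / w' s u)"
      using \<phi>(2)[of s u] that sV pos w0[of v u] by (intro mult_right_mono) auto
    finally show ?thesis using pos by simp
  qed (use w0 in \<open>simp add: \<psi>_def\<close>)
  have \<psi>_sum: "(\<Sum>v\<in>S. \<psi> v u) = \<phi> s u" if "u \<in> V - S" for u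
  proof (cases "w' s u = 0")
    case True
    then have "\<phi> s u = 0" using \<phi>(2)[of s u] that sV by fastforce
    then show ?thesis by (simp add: \<psi>_def)
  next
    case False
    have "(\<Sum>v\<in>S. \<psi> v u) = \<phi> s u * ((\<Sum>v\<in>S. w v u) / w' s u)"
      by (simp add: \<psi>_def sum_distrib_left sum_divide_distrib)
    then show ?thesis using False w's[OF that] by simp
  qed
  have \<phi>ss: "\<phi> s s = 0" using \<phi>(1)[OF sV(2) sV(2)] by simp
  have split': "(\<Sum>u\<in>V'. g u) = g s + (\<Sum>u\<in>V - S. g u)" for g :: "'a \<Rightarrow> real"
    using fin sV(1) by (simp add: V'_def)
  have split: "(\<Sum>u\<in>V. g u) = (\<Sum>u\<in>S. g u) + (\<Sum>u\<in>V - S. g u)" for g :: "'a \<Rightarrow> real"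
    using sum.subset_diff[OF assms(2,1), of g] by simp
  define \<xi> where "\<xi> = (\<lambda>v. \<Sum>u\<in>V - S. \<psi> v u)"
  show ?thesis
  proof (rule that)
    fix v assume "v \<in> S"
    have "2 * \<bar>\<xi> v\<bar> \<le> (\<Sum>u\<in>V - S. 2 * \<bar>\<psi> v u\<bar>)"
      unfolding \<xi>_def sum_distrib_left[symmetric] using sum_abs[of "\<psi> v" "V - S"] by simp
    also have "\<dots> \<le> (\<Sum>u\<in>V - S. w v u)" using \<psi>_cap \<open>v \<in> S\<close> by (intro sum_mono) auto
    finally show "2 * \<bar>\<xi> v\<bar> \<le> cut_weight w {v} (V - S)" by (simp add: cut_weight_def)
  next
    have "sum \<xi> S = (\<Sum>u\<in>V - S. \<Sum>v\<in>S. \<psi> v u)" unfolding \<xi>_def by (rule sum.swap)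
    also have "\<dots> = (\<Sum>u\<in>V - S. \<phi> s u)" using \<psi>_sum by simp
    also have "\<dots> = s' s" using \<phi>(3)[of s] sV split'[of "\<phi> s"] \<phi>ss by simp
    finally show "sum \<xi> S = s' s" .
  next
    show "\<forall>s''. (\<forall>v\<in>V - S. s'' v = s' v) \<longrightarrow> routable S w (\<lambda>v. s'' v - \<xi> v) \<longrightarrow> routable V w s''"
    proof (intro allI impI)
    fix s'' assume s'': "\<forall>v\<in>V - S. s'' v = s' v" and "routable S w (\<lambda>v. s'' v - \<xi> v)"
    then obtain \<eta> where \<eta>: "\<And>u v. u \<in> S \<Longrightarrow> v \<in> S \<Longrightarrow> \<eta> u v = - \<eta> v u"
      "\<And>u v. u \<in> S \<Longrightarrow> v \<in> S \<Longrightarrow> 2 * \<bar>\<eta> u v\<bar> \<le> w u v"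
      "\<And>v. v \<in> S \<Longrightarrow> (\<Sum>u\<in>S. \<eta> v u) = s'' v - \<xi> v"
      unfolding routable_def by blast
    define \<Phi> where "\<Phi> = (\<lambda>u v. if u \<in> S then (if v \<in> S then \<eta> u v else \<psi> u v)
      else (if v \<in> S then - \<psi> v u else \<phi> u v))"
    show "routable V w s''"
      unfolding routable_def
    proof (intro exI[of _ \<Phi>] conjI ballI)
      fix u v assume uv: "u \<in> V" "v \<in> V"
      show "\<Phi> u v = - \<Phi> v u"
      proof (cases "u \<in> S"; cases "v \<in> S")
        assume "u \<in> S" "v \<in> S"
        then show ?thesis using \<eta>(1)[OF \<open>u \<in> S\<close> \<open>v \<in> S\<close>] unfolding \<Phi>_def by argo
      next
        assume "u \<notin> S" "v \<notin> S"
        then have "\<phi> u v = - \<phi> v u" using uv sV(3) by (intro \<phi>(1)) auto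
        then show ?thesis using \<open>u \<notin> S\<close> \<open>v \<notin> S\<close> unfolding \<Phi>_def by argo
      qed (simp_all add: \<Phi>_def)
      show "2 * \<bar>\<Phi> u v\<bar> \<le> w u v"
      proof (cases "u \<in> S"; cases "v \<in> S")
        assume "u \<in> S" "v \<in> S"
        then show ?thesis using \<eta>(2)[of u v] by (simp add: \<Phi>_def)
      next
        assume "u \<notin> S" "v \<notin> S"
        then have "2 * \<bar>\<phi> u v\<bar> \<le> w u v" using \<phi>(2)[of u v] w'u[of u v] uv sV(3) by auto
        then show ?thesis using \<open>u \<notin> S\<close> \<open>v \<notin> S\<close> by (simp add: \<Phi>_def)
      next
        assume "u \<in> S" "v \<notin> S"
        then show ?thesis using \<psi>_cap[of u v] uv by (simp add: \<Phi>_def)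
      next
        assume "u \<notin> S" "v \<in> S"
        then have "2 * \<bar>\<psi> v u\<bar> \<le> w u v" using \<psi>_cap[of v u] uv wc[of v u] by simp
        then show ?thesis using \<open>u \<notin> S\<close> \<open>v \<in> S\<close> by (simp add: \<Phi>_def)
      qed
    next
      fix v assume v: "v \<in> V"
      show "(\<Sum>u\<in>V. \<Phi> v u) = s'' v"
      proof (cases "v \<in> S")
        case True
        have "(\<Sum>u\<in>V. \<Phi> v u) = (\<Sum>u\<in>S. \<eta> v u) + (\<Sum>u\<in>V - S. \<psi> v u)"
          unfolding split by (intro arg_cong2[where f = "(+)"] sum.cong) (auto simp: \<Phi>_def True)
        then show ?thesis using \<eta>(3)[OF True] by (simp add: \<xi>_def)
      next
        case False
        then have vV: "v \<in> V - S" using v by simp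
        have "(\<Sum>u\<in>V. \<Phi> v u) = (\<Sum>u\<in>S. - \<psi> u v) + (\<Sum>u\<in>V - S. \<phi> v u)"
          unfolding split by (intro arg_cong2[where f = "(+)"] sum.cong) (auto simp: \<Phi>_def False)
        also have "(\<Sum>u\<in>S. - \<psi> u v) = - \<phi> s v" using \<psi>_sum[OF vV] by (simp add: sum_negf)
        also have "\<dots> = \<phi> v s" using \<phi>(1)[of v s] sV vV by (metis subsetD)
        also have "\<phi> v s + (\<Sum>u\<in>V - S. \<phi> v u) = s' v" using \<phi>(3)[of v] split'[of "\<phi> v"] sV vV by auto
        finally show ?thesis using bspec[OF s'' vV] by simp
      qed
    qed
    qed
  qed
qed

section \<open>Rounding instances with a terminal\<close>

text \<open>
  In an instance \<open>(V, w, z, e, a)\<close> the vertex \<open>v\<close> is joined to an outside terminal by an edge of weight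
  \<open>z v\<close>, along which a flow of \<open>e v\<close> into \<open>v\<close> is prescribed.
\<close>

definition prefixed :: "'v set \<Rightarrow> ('v \<Rightarrow> 'v \<Rightarrow> real) \<Rightarrow> ('v \<Rightarrow> real) \<Rightarrow> ('v \<Rightarrow> real) \<Rightarrow> bool" where
  "prefixed V w z e \<longleftrightarrow> finite V \<and> weighting w \<and> (\<forall>v\<in>V. 2 * \<bar>e v\<bar> \<le> z v)"

text \<open>Supplies of an antisymmetric flow sum to zero, so a solution has
  \<open>sum y V = sum a V - sum e V\<close>, which must be an integer; on a single vertex its
  rounding error is the absolute value of \<open>e\<close>, hence the bound 1. As
  \<open>sum e V\<close> and \<open>sum a V\<close> agree modulo 1, the last condition says that the
  boundary of \<open>V\<close> is at most its demand.\<close>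

definition balanced :: "'v set \<Rightarrow> ('v \<Rightarrow> real) \<Rightarrow> ('v \<Rightarrow> real) \<Rightarrow> ('v \<Rightarrow> real) \<Rightarrow> bool" where
  "balanced V z e a \<longleftrightarrow> \<bar>sum e V\<bar> < 1 \<and> sum e V - sum a V \<in> \<int> \<and>
     sum z V \<le> 5 + 2 * int_dist (sum e V)"

definition demand :: "('v \<Rightarrow> real) \<Rightarrow> 'v set \<Rightarrow> real" where
  "demand a A = 5 + 2 * int_dist (sum a A)"

definition normal ::
  "'v set \<Rightarrow> ('v \<Rightarrow> 'v \<Rightarrow> real) \<Rightarrow> ('v \<Rightarrow> real) \<Rightarrow> ('v \<Rightarrow> real) \<Rightarrow> ('v \<Rightarrow> real) \<Rightarrow> bool" where
  "normal V w z e a \<longleftrightarrow> prefixed V w z e \<and> balanced V z e a \<and>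
     (\<forall>A. A \<noteq> {} \<longrightarrow> A \<subset> V \<longrightarrow> demand a A \<le> boundary V w z A)"

definition solvable :: "'v set \<Rightarrow> ('v \<Rightarrow> 'v \<Rightarrow> real) \<Rightarrow> ('v \<Rightarrow> real) \<Rightarrow> ('v \<Rightarrow> real) \<Rightarrow> bool" where
  "solvable V w e a \<longleftrightarrow> (\<exists>y :: 'v \<Rightarrow> int. (\<forall>v\<in>V. \<bar>y v - a v\<bar> < 1) \<and>
     routable V w (\<lambda>v. y v - a v + e v))"

text \<open>
  This weakening of \<open>normal\<close> is preserved when edges at the integral vertex \<open>x\<close> are split off: a set
  and its union with \<open>x\<close> have the same demand, and no condition is imposed on \<open>V - {x}\<close>.
\<close>

definition splittable ::
  "'v set \<Rightarrow> ('v \<Rightarrow> 'v \<Rightarrow> real) \<Rightarrow> ('v \<Rightarrow> real) \<Rightarrow> ('v \<Rightarrow> real) \<Rightarrow> ('v \<Rightarrow> real) \<Rightarrow> 'v \<Rightarrow> bool" where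
  "splittable V w z e a x \<longleftrightarrow> prefixed V w z e \<and> balanced V z e a \<and> x \<in> V \<and> a x \<in> \<int> \<and>
     z x \<le> cut_weight w {x} (V - {x}) \<and>
     (\<forall>A. A \<noteq> {} \<longrightarrow> A \<subset> V - {x} \<longrightarrow>
        demand a A \<le> boundary V w z A \<and> demand a A \<le> boundary V w z (insert x A))"

abbreviation contr_fun :: "'v set \<Rightarrow> 'v \<Rightarrow> ('v \<Rightarrow> real) \<Rightarrow> 'v \<Rightarrow> real" where
  "contr_fun S s f \<equiv> \<lambda>u. sum f (fibre S s u)"

abbreviation contr_weight :: "'v set \<Rightarrow> 'v \<Rightarrow> ('v \<Rightarrow> 'v \<Rightarrow> real) \<Rightarrow> 'v \<Rightarrow> 'v \<Rightarrow> real" where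
  "contr_weight S s w \<equiv> \<lambda>u v. cut_weight w (fibre S s u) (fibre S s v)"

abbreviation inner_term :: "'v set \<Rightarrow> 'v set \<Rightarrow> ('v \<Rightarrow> 'v \<Rightarrow> real) \<Rightarrow> ('v \<Rightarrow> real) \<Rightarrow> 'v \<Rightarrow> real" where
  "inner_term V S w z \<equiv> \<lambda>v. z v + cut_weight w {v} (V - S)"

lemma demand_insert_Ints:
  "finite A \<Longrightarrow> x \<notin> A \<Longrightarrow> a x \<in> \<int> \<Longrightarrow> demand a (insert x A) = demand a A"
  using int_dist_add_Ints[of "a x" "sum a A"] by (simp add: demand_def add.commute)

text \<open>The two solutions are glued along the cut around \<open>S\<close>. The inner terminal
  flow is the old terminal flow less the amount \<xi> that the outer flow sends out of
  \<open>S\<close>; its total is determined by the value chosen for the contracted vertex.\<close>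

lemma solvable_expand:
  assumes "prefixed V w z e" "S \<subseteq> V" "s \<in> S"
    and outer: "solvable (insert s (V - S)) (contr_weight S s w) (contr_fun S s e) (contr_fun S s a)"
    and inner: "\<And>e1. (\<And>v. v \<in> S \<Longrightarrow> 2 * \<bar>e1 v\<bar> \<le> inner_term V S w z v) \<Longrightarrow> \<bar>sum e1 S\<bar> < 1 \<Longrightarrow>
      sum e1 S - sum a S \<in> \<int> \<Longrightarrow> solvable S w e1 a"
  shows "solvable V w e a"
proof -
  have fin: "finite V" and w: "weighting w" and e: "\<And>v. v \<in> V \<Longrightarrow> 2 * \<bar>e v\<bar> \<le> z v"
    using assms(1) by (auto simp: prefixed_def)
  from outer obtain y where y: "\<And>v. v \<in> insert s (V - S) \<Longrightarrow> \<bar>of_int (y v) - contr_fun S s a v\<bar> < 1"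
    and r: "routable (insert s (V - S)) (contr_weight S s w)
      (\<lambda>v. of_int (y v) - contr_fun S s a v + contr_fun S s e v)"
    unfolding solvable_def by blast
  obtain \<xi> where \<xi>: "\<And>v. v \<in> S \<Longrightarrow> 2 * \<bar>\<xi> v\<bar> \<le> cut_weight w {v} (V - S)"
    "sum \<xi> S = of_int (y s) - contr_fun S s a s + contr_fun S s e s"
    "\<forall>s''. (\<forall>v\<in>V - S. s'' v = of_int (y v) - contr_fun S s a v + contr_fun S s e v) \<longrightarrow>
      routable S w (\<lambda>v. s'' v - \<xi> v) \<longrightarrow> routable V w s''"
    by (rule routable_expand[OF fin assms(2,3) w r]) (rule that)
  have fs: "fibre S s s = S" by (simp add: fibre_def)
  have fv: "fibre S s v = {v}" if "v \<in> V - S" for v using that assms(3) by (auto simp: fibre_def)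
  define e1 where "e1 v = e v - \<xi> v" for v
  have sum_e1: "sum e1 S = sum a S - of_int (y s)"
    using \<xi>(2) by (simp add: e1_def sum_subtractf fs)
  have "solvable S w e1 a"
  proof (rule inner)
    fix v assume "v \<in> S"
    then have "2 * \<bar>e v\<bar> \<le> z v" "2 * \<bar>- \<xi> v\<bar> \<le> cut_weight w {v} (V - S)"
      using e \<xi>(1) assms(2) by auto
    then show "2 * \<bar>e1 v\<bar> \<le> inner_term V S w z v"
      using double_abs_add_le by (fastforce simp: e1_def)
  next
    \<comment> \<open>The total inner inflow is the rounding error at the contracted vertex, up to
      sign.\<close>
    show "\<bar>sum e1 S\<bar> < 1" using y[of s] by (simp add: sum_e1 fs abs_minus_commute)
    show "sum e1 S - sum a S \<in> \<int>" by (simp add: sum_e1)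
  qed
  then obtain y1 where y1: "\<And>v. v \<in> S \<Longrightarrow> \<bar>of_int (y1 v) - a v\<bar> < 1"
    and r1: "routable S w (\<lambda>v. of_int (y1 v) - a v + e1 v)"
    unfolding solvable_def by blast
  define y2 where "y2 v = (if v \<in> S then y1 v else y v)" for v
  show ?thesis
    unfolding solvable_def
  proof (intro exI[of _ y2] conjI ballI)
    fix v assume "v \<in> V"
    then show "\<bar>of_int (y2 v) - a v\<bar> < 1" using y1 y[of v] fv[of v] by (auto simp: y2_def)
  next
    show "routable V w (\<lambda>v. of_int (y2 v) - a v + e v)"
    proof (rule \<xi>(3)[rule_format])
      fix v assume "v \<in> V - S"
      then show "of_int (y2 v) - a v + e v = of_int (y v) - contr_fun S s a v + contr_fun S s e v"
        using fv[of v] by (simp add: y2_def)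
    next
      show "routable S w (\<lambda>v. of_int (y2 v) - a v + e v - \<xi> v)"
        by (rule routable_cong[OF _ r1]) (simp add: y2_def e1_def)
    qed
  qed
qed

lemma boundary_inner:
  assumes "finite V" "A \<subseteq> S" "S \<subseteq> V"
  shows "boundary S w (inner_term V S w z) A = boundary V w z A"
proof -
  have fin: "finite (S - A)" "finite (V - S)" using assms by (auto intro: finite_subset)
  have "V - A = (S - A) \<union> (V - S)" using assms by auto
  then have "cut_weight w A (V - A) = cut_weight w A (S - A) + cut_weight w A (V - S)"
    using cut_Un_right[of "S - A" "V - S" w A] fin by auto
  moreover have "(\<Sum>v\<in>A. cut_weight w {v} (V - S)) = cut_weight w A (V - S)"
    by (simp add: cut_weight_def)
  ultimately show ?thesis by (simp add: boundary_def sum.distrib)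
qed

lemma prefixed_inner:
  assumes "prefixed V w z e" "S \<subseteq> V" "\<And>v. v \<in> S \<Longrightarrow> 2 * \<bar>e1 v\<bar> \<le> inner_term V S w z v"
  shows "prefixed S w (inner_term V S w z) e1"
  using assms by (auto simp: prefixed_def intro: finite_subset)

text \<open>The inner terminal weight is the boundary of \<open>S\<close>; this is where an upper
  bound on that boundary, that is, tightness of \<open>S\<close>, enters.\<close>

lemma balanced_inner:
  assumes "finite V" "S \<subseteq> V" "boundary V w z S \<le> demand a S"
    and "\<bar>sum e1 S\<bar> < 1" "sum e1 S - sum a S \<in> \<int>"
  shows "balanced S (inner_term V S w z) e1 a"
proof -
  have "sum (inner_term V S w z) S = boundary S w (inner_term V S w z) S"
    by (simp add: boundary_def cut_weight_def)
  also have "\<dots> = boundary V w z S" using assms by (intro boundary_inner) auto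
  finally show ?thesis
    using assms(3-5) int_dist_diff_Ints[OF assms(5)] by (simp add: balanced_def demand_def)
qed

lemma prefixed_outer:
  assumes "prefixed V w z e" "S \<subseteq> V"
  shows "prefixed (insert s (V - S)) (contr_weight S s w) (contr_fun S s z) (contr_fun S s e)"
  unfolding prefixed_def
proof (intro conjI ballI)
  fix v assume "v \<in> insert s (V - S)"
  then have "fibre S s v \<subseteq> V" using assms(2) by (auto simp: fibre_def)
  then have le: "(\<Sum>u\<in>fibre S s v. 2 * \<bar>e u\<bar>) \<le> sum z (fibre S s v)"
    using assms(1) by (intro sum_mono) (auto simp: prefixed_def)
  have "2 * \<bar>sum e (fibre S s v)\<bar> \<le> (\<Sum>u\<in>fibre S s v. 2 * \<bar>e u\<bar>)"
    using sum_abs[of e "fibre S s v"] by (simp add: sum_distrib_left[symmetric])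
  then show "2 * \<bar>sum e (fibre S s v)\<bar> \<le> sum z (fibre S s v)" using le by linarith
qed (use assms in \<open>auto simp: prefixed_def intro: weighting_fibre\<close>)

lemma balanced_outer:
  assumes "finite V" "S \<subseteq> V" "s \<in> S" "balanced V z e a"
  shows "balanced (insert s (V - S)) (contr_fun S s z) (contr_fun S s e) (contr_fun S s a)"
  using assms(4) unfolding balanced_def
  by (simp only: sum_fibre[OF assms(1-3) subset_refl] blow_up_all[OF assms(2,3)])

lemma demand_outer:
  assumes "finite V" "S \<subseteq> V" "s \<in> S" "A \<subseteq> insert s (V - S)"
  shows "demand (contr_fun S s a) A = demand a (blow_up S s A)"
  unfolding demand_def by (simp only: sum_fibre[OF assms])

lemma normal_outer:
  assumes "prefixed V w z e" "balanced V z e a" "S \<subseteq> V" "s \<in> S"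
    and "\<And>A. A \<noteq> {} \<Longrightarrow> A \<subset> insert s (V - S) \<Longrightarrow> demand a (blow_up S s A) \<le> boundary V w z (blow_up S s A)"
  shows "normal (insert s (V - S)) (contr_weight S s w) (contr_fun S s z) (contr_fun S s e) (contr_fun S s a)"
proof -
  have fin: "finite V" using assms(1) by (simp add: prefixed_def)
  show ?thesis
    unfolding normal_def
  proof (intro conjI allI impI)
    fix A assume A: "A \<noteq> {}" "A \<subset> insert s (V - S)"
    then show "demand (contr_fun S s a) A \<le> boundary (insert s (V - S)) (contr_weight S s w) (contr_fun S s z) A"
      using assms(5)[OF A] demand_outer[OF fin assms(3,4)] boundary_fibre[OF fin assms(3,4)] by simp
  qed (fact prefixed_outer[OF assms(1,3)], fact balanced_outer[OF fin assms(3,4,2)])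
qed

text \<open>
  Contract \<open>S\<close> and solve the rest; the flow found there prescribes the inflow at \<open>S\<close>, whose boundary
  is small enough for \<open>S\<close>, with everything outside as terminal, to be normal again.
\<close>

lemma solvable_tight:
  fixes V :: "'v set"
  assumes IH: "\<And>(V' :: 'v set) w z e a. card V' < card V \<Longrightarrow> normal V' w z e a \<Longrightarrow> solvable V' w e a"
    and nor: "normal V w z e a" and S: "S \<subset> V" "2 \<le> card S" "boundary V w z S \<le> demand a S"
  shows "solvable V w e a"
proof -
  have p: "prefixed V w z e" and b: "balanced V z e a"
    and d: "\<And>A. A \<noteq> {} \<Longrightarrow> A \<subset> V \<Longrightarrow> demand a A \<le> boundary V w z A"
    using nor by (auto simp: normal_def)
  have fin: "finite V" using p by (simp add: prefixed_def)
  have "S \<noteq> {}" using S(2) by auto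
  then obtain s where s: "s \<in> S" by blast
  have SV: "S \<subseteq> V" using S(1) by auto
  have cS: "card S < card V" using S(1) fin by (rule psubset_card_mono[rotated])
  have finS: "finite S" using SV fin by (rule finite_subset)
  have "card (insert s (V - S)) = Suc (card V - card S)"
    using fin finS SV s by (simp add: card_Diff_subset)
  then have c': "card (insert s (V - S)) < card V" using S(2) cS by simp
  show ?thesis
  proof (rule solvable_expand[OF p SV s])
    show "solvable (insert s (V - S)) (contr_weight S s w) (contr_fun S s e) (contr_fun S s a)"
    proof (rule IH[OF c'], rule normal_outer[OF p b SV s])
      fix A assume "A \<noteq> {}" "A \<subset> insert s (V - S)"
      then show "demand a (blow_up S s A) \<le> boundary V w z (blow_up S s A)"
        by (intro d blow_up_proper[OF SV s])
    qed
  next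
    fix e1 assume e1: "\<And>v. v \<in> S \<Longrightarrow> 2 * \<bar>e1 v\<bar> \<le> inner_term V S w z v" "\<bar>sum e1 S\<bar> < 1"
      "sum e1 S - sum a S \<in> \<int>"
    show "solvable S w e1 a"
    proof (rule IH[OF cS, where z = "inner_term V S w z"])
      show "normal S w (inner_term V S w z) e1 a"
        unfolding normal_def
      proof (intro conjI allI impI)
        show "prefixed S w (inner_term V S w z) e1" by (rule prefixed_inner[OF p SV e1(1)])
        show "balanced S (inner_term V S w z) e1 a" by (rule balanced_inner[OF fin SV S(3) e1(2,3)])
        fix A assume "A \<noteq> {}" "A \<subset> S"
        moreover from this have "A \<subseteq> S" "A \<subset> V" using SV by auto
        ultimately show "demand a A \<le> boundary S w (inner_term V S w z) A"
          using d[of A] boundary_inner[OF fin _ SV, of A w z] by simp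
      qed
    qed
  qed
qed

section \<open>Splitting off an integral vertex\<close>

lemma sum_shift:
  assumes "finite A"
  shows "(\<Sum>v\<in>A. f v + c * (of_bool (v = x) - of_bool (v = y))) =
    sum f A + c * (of_bool (x \<in> A) - of_bool (y \<in> A) :: real)"
proof -
  have "(\<Sum>v\<in>A. of_bool (v = p)) = (of_bool (p \<in> A) :: real)" for p
    using assms by (simp add: of_bool_def sum.delta)
  then show ?thesis
    by (simp add: sum.distrib sum_subtractf flip: sum_distrib_left)
qed

lemma cut_link_boundary:
  assumes "finite V" "A \<subseteq> V" "p \<in> V" "q \<in> V"
  shows "cut_weight (link p q) A (V - A) = of_bool ((p \<in> A) \<noteq> (q \<in> A))"
  using assms by (simp add: cut_link finite_subset of_bool_def)

lemma cut_link_scale: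
  "cut_weight (\<lambda>u v. w u v - c * link p q u v) A B = cut_weight w A B - c * cut_weight (link p q) A B"
  by (simp only: cut_diff cut_scale)

lemma boundary_minus_link:
  assumes "finite V" "A \<subseteq> V" "p \<in> V" "q \<in> V"
  shows "boundary V (\<lambda>u v. w u v - c * link p q u v) z A =
    boundary V w z A - c * of_bool ((p \<in> A) \<noteq> (q \<in> A))"
  unfolding boundary_def cut_link_scale cut_link_boundary[OF assms] by simp

lemma boundary_plus_link:
  assumes "finite V" "A \<subseteq> V" "p \<in> V" "q \<in> V"
  shows "boundary V (\<lambda>u v. w u v + c * link p q u v) z A =
    boundary V w z A + c * of_bool ((p \<in> A) \<noteq> (q \<in> A))"
  unfolding boundary_def cut_add cut_scale cut_link_boundary[OF assms] by simp

lemma weighting_minus_link: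
  assumes "weighting w" "c \<le> w p q" "p \<noteq> q"
  shows "weighting (\<lambda>u v. w u v - c * link p q u v)"
  unfolding weighting_def
proof (intro allI conjI)
  fix u v
  show "w u v - c * link p q u v = w v u - c * link p q v u"
    unfolding weightingD(1)[OF assms(1), of u v] link_commute[of p q u v] by (rule refl)
  show "0 \<le> w u v - c * link p q u v"
  proof (cases "(u = p \<and> v = q) \<or> (u = q \<and> v = p)")
    case True
    then show ?thesis
      using assms(2) link_arrow_values[OF assms(3)] weightingD(1)[OF assms(1), of q p] by auto
  next
    case False
    then show ?thesis using link_eq_0[of u p v q] weightingD(2)[OF assms(1), of u v] by auto
  qed
qed

lemma weighting_plus_link:
  assumes "weighting w" "0 \<le> c"
  shows "weighting (\<lambda>u v. w u v + c * link p q u v)"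
  unfolding weighting_def
proof (intro allI conjI)
  fix u v
  show "w u v + c * link p q u v = w v u + c * link p q v u"
    unfolding weightingD(1)[OF assms(1), of u v] link_commute[of p q u v] by (rule refl)
  show "0 \<le> w u v + c * link p q u v"
    using weightingD(2)[OF assms(1), of u v] link_nonneg[of p q u v] assms(2) by simp
qed

lemma splittableD:
  assumes "splittable V w z e a x"
  shows "prefixed V w z e" "balanced V z e a" "x \<in> V" "a x \<in> \<int>" "z x \<le> cut_weight w {x} (V - {x})"
    "\<And>A. A \<noteq> {} \<Longrightarrow> A \<subset> V - {x} \<Longrightarrow> demand a A \<le> boundary V w z A"
    "\<And>A. A \<noteq> {} \<Longrightarrow> A \<subset> V - {x} \<Longrightarrow> demand a A \<le> boundary V w z (insert x A)"
    "finite V" "weighting w" "\<And>v. v \<in> V \<Longrightarrow> 2 * \<bar>e v\<bar> \<le> z v"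
  using assms by (auto simp: splittable_def prefixed_def)

text \<open>\<open>x\<close> keeps its integral value and passes its inflow \<open>e x\<close> on to
  \<open>u\<close>; the integer at \<open>u\<close> is then forced, with error
  \<open>e u + e x\<close> up to sign.\<close>

lemma solvable_pair:
  assumes "weighting w" "u \<noteq> x" "a x \<in> \<int>" "2 * \<bar>e x\<bar> \<le> w x u" "\<bar>e u + e x\<bar> < 1"
    "e u + e x - (a u + a x) \<in> \<int>"
  shows "solvable {u, x} w e a"
proof -
  obtain i where i: "a x = of_int i" using assms(3) by (auto elim: Ints_cases)
  obtain j where j: "e u + e x - (a u + a x) = of_int j" using assms(6) by (auto elim: Ints_cases)
  define y where "y v = (if v = x then i else - j - i)" for v
  show ?thesis
    unfolding solvable_def
  proof (intro exI[of _ y] conjI ballI)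
    fix v assume "v \<in> {u, x}"
    then show "\<bar>of_int (y v) - a v\<bar> < 1"
      using assms(2,5) i j by (auto simp: y_def)
  next
    have "routable {u, x} (\<lambda>p q. w p q - w x u * link x u p q) (\<lambda>v. 0)"
      unfolding routable_def
      using weighting_minus_link[OF assms(1), of "w x u" x u] assms(2)
      by (intro exI[of _ "\<lambda>p q. 0"]) (auto simp: weighting_def)
    then show "routable {u, x} w (\<lambda>v. of_int (y v) - a v + e v)"
      by (rule routable_restore_edge[where \<kappa> = "e x"])
        (use assms i j in \<open>auto simp: y_def\<close>)
  qed
qed

text \<open>Contract the edge xu. All inflow into \<open>x\<close> other than along xu is at most
  half the remaining weight at \<open>x\<close>, hence at most half of \<open>w x u\<close>, so it
  can be passed on to \<open>u\<close>. The outer instance is normal because a contracted set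
  corresponds to some A or to A with \<open>x\<close> added, and these have equal demand.\<close>

lemma solvable_majority:
  fixes V :: "'v set"
  assumes IH: "\<And>(V' :: 'v set) w z e a. card V' < card V \<Longrightarrow> normal V' w z e a \<Longrightarrow> solvable V' w e a"
    and sp: "splittable V w z e a x" and u: "u \<in> V" "u \<noteq> x"
    and maj: "cut_weight w {x} (V - {x}) + z x \<le> 2 * w x u"
  shows "solvable V w e a"
proof -
  note D = splittableD[OF sp]
  have SV: "{u, x} \<subseteq> V" using u D(3) by simp
  have V': "insert u (V - {u, x}) = V - {x}" using u by auto
  have c': "card (V - {x}) < card V" using D(3,8) by (rule card_Diff1_less[rotated])
  have "V - {x} - {u} = V - {u, x}" by auto
  then have h: "cut_weight w {x} (V - {x}) = w x u + cut_weight w {x} (V - {u, x})"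
    using sum.remove[of "V - {x}" u "w x"] D(8) u unfolding cut_weight_def by auto
  show ?thesis
  proof (rule solvable_expand[OF D(1) SV, of u])
    show "solvable (insert u (V - {u, x})) (contr_weight {u, x} u w) (contr_fun {u, x} u e) (contr_fun {u, x} u a)"
    proof (rule IH[OF _ normal_outer[OF D(1,2) SV]])
      show "card (insert u (V - {u, x})) < card V" unfolding V' by (rule c')
      fix A assume A: "A \<noteq> {}" "A \<subset> insert u (V - {u, x})"
      then have A': "A \<subset> V - {x}" unfolding V' by simp
      have fA: "finite A" "x \<notin> A" using A' D(8) by (auto intro: finite_subset)
      have "blow_up {u, x} u A = (if u \<in> A then insert x A else A)" by (auto simp: blow_up_def)
      then show "demand a (blow_up {u, x} u A) \<le> boundary V w z (blow_up {u, x} u A)"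
        using D(6)[OF A(1) A'] D(7)[OF A(1) A'] demand_insert_Ints[OF fA, of a] D(4) by simp
    qed simp
  next
    fix e1 assume e1: "\<And>v. v \<in> {u, x} \<Longrightarrow> 2 * \<bar>e1 v\<bar> \<le> inner_term V {u, x} w z v"
      "\<bar>sum e1 {u, x}\<bar> < 1" "sum e1 {u, x} - sum a {u, x} \<in> \<int>"
    show "solvable {u, x} w e1 a"
    proof (rule solvable_pair[of w u x a e1, OF D(9) u(2) D(4)])
      show "2 * \<bar>e1 x\<bar> \<le> w x u" using e1(1)[of x] maj h by simp
    qed (use e1(2,3) u(2) in auto)
  qed simp
qed

text \<open>As \<open>S\<close> avoids \<open>x\<close>, the vertex \<open>x\<close> survives in the
  outer instance, which remains splittable; all subsets of \<open>S\<close> satisfy their demands,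
  so the inner instance is normal.\<close>

lemma solvable_split_tight:
  fixes V :: "'v set"
  assumes IH: "\<And>(V' :: 'v set) w z e a. card V' < card V \<Longrightarrow> normal V' w z e a \<Longrightarrow> solvable V' w e a"
    and IH2: "\<And>(V' :: 'v set) w z e a. card V' < card V \<Longrightarrow> splittable V' w z e a x \<Longrightarrow> 2 \<le> card V' \<Longrightarrow>
      solvable V' w e a"
    and sp: "splittable V w z e a x"
    and S: "S \<subset> V - {x}" "2 \<le> card S" "boundary V w z S \<le> demand a S"
  shows "solvable V w e a"
proof -
  note D = splittableD[OF sp]
  have "S \<noteq> {}" using S(2) by auto
  then obtain s where s: "s \<in> S" by blast
  have SV: "S \<subseteq> V" and xS: "x \<notin> S" using S(1) by auto
  then have sx: "s \<noteq> x" using s by auto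
  have finS: "finite S" using SV D(8) by (rule finite_subset)
  have cS: "card S < card V" using S(1) D(8) by (intro psubset_card_mono) auto
  let ?V' = "insert s (V - S)"
  have "card ?V' = Suc (card V - card S)"
    using D(8) finS SV s by (simp add: card_Diff_subset)
  then have c': "card ?V' < card V" "2 \<le> card ?V'" using S(2) cS by simp_all
  have fx: "fibre S s x = {x}" using sx by (simp add: fibre_def)
  show ?thesis
  proof (rule solvable_expand[OF D(1) SV s])
    have "splittable ?V' (contr_weight S s w) (contr_fun S s z) (contr_fun S s e) (contr_fun S s a) x"
      unfolding splittable_def
    proof (intro conjI allI impI)
      show "prefixed ?V' (contr_weight S s w) (contr_fun S s z) (contr_fun S s e)"
        by (rule prefixed_outer[OF D(1) SV])
      show "balanced ?V' (contr_fun S s z) (contr_fun S s e) (contr_fun S s a)"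
        by (rule balanced_outer[OF D(8) SV s D(2)])
      show xV': "x \<in> ?V'" using xS D(3) by simp
      show "contr_fun S s a x \<in> \<int>" using D(4) fx by simp
      have "blow_up S s {x} = {x}" "blow_up S s (?V' - {x}) = V - {x}"
        using sx xS s SV by (auto simp: blow_up_def)
      then have "cut_weight (contr_weight S s w) {x} (?V' - {x}) = cut_weight w {x} (V - {x})"
        using cut_fibre[OF D(8) SV s, of "{x}" "?V' - {x}" w] xV' by auto
      then show "contr_fun S s z x \<le> cut_weight (contr_weight S s w) {x} (?V' - {x})"
        using D(5) fx by simp
    next
      fix A assume A: "A \<noteq> {}" "A \<subset> ?V' - {x}"
      have B: "blow_up S s A \<noteq> {}" "blow_up S s A \<subset> V - {x}" "A \<subseteq> ?V'"
        using A s SV xS sx by (auto simp: blow_up_def)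
      have i: "insert x A \<subseteq> ?V'" "blow_up S s (insert x A) = insert x (blow_up S s A)"
        using B(3) xS D(3) sx by (auto simp: blow_up_def)
      show "demand (contr_fun S s a) A \<le> boundary ?V' (contr_weight S s w) (contr_fun S s z) A"
        unfolding demand_outer[OF D(8) SV s B(3)] boundary_fibre[OF D(8) SV s B(3)]
        by (rule D(6)[OF B(1,2)])
      show "demand (contr_fun S s a) A \<le> boundary ?V' (contr_weight S s w) (contr_fun S s z) (insert x A)"
        unfolding demand_outer[OF D(8) SV s B(3)] boundary_fibre[OF D(8) SV s i(1)] i(2)
        by (rule D(7)[OF B(1,2)])
    qed
    then show "solvable ?V' (contr_weight S s w) (contr_fun S s e) (contr_fun S s a)"
      by (rule IH2[OF c'(1) _ c'(2)])
  next
    fix e1 assume e1: "\<And>v. v \<in> S \<Longrightarrow> 2 * \<bar>e1 v\<bar> \<le> inner_term V S w z v" "\<bar>sum e1 S\<bar> < 1"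
      "sum e1 S - sum a S \<in> \<int>"
    show "solvable S w e1 a"
    proof (rule IH[OF cS, where z = "inner_term V S w z"])
      show "normal S w (inner_term V S w z) e1 a"
        unfolding normal_def
      proof (intro conjI allI impI)
        show "prefixed S w (inner_term V S w z) e1" by (rule prefixed_inner[OF D(1) SV e1(1)])
        show "balanced S (inner_term V S w z) e1 a" by (rule balanced_inner[OF D(8) SV S(3) e1(2,3)])
        fix A assume "A \<noteq> {}" "A \<subset> S"
        moreover from this have "A \<subseteq> S" "A \<subset> V - {x}" using S(1) by auto
        ultimately show "demand a A \<le> boundary S w (inner_term V S w z) A"
          using D(6)[of A] boundary_inner[OF D(8) _ SV, of A w z] by simp
      qed
    qed
  qed
qed

text \<open>The roles are exchanged: \<open>x\<close> is absorbed by the contracted set, which makes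
  the outer instance normal, while the inner instance contains \<open>x\<close> and is only
  splittable.\<close>

lemma solvable_split_tight_insert:
  fixes V :: "'v set"
  assumes IH: "\<And>(V' :: 'v set) w z e a. card V' < card V \<Longrightarrow> normal V' w z e a \<Longrightarrow> solvable V' w e a"
    and IH2: "\<And>(V' :: 'v set) w z e a. card V' < card V \<Longrightarrow> splittable V' w z e a x \<Longrightarrow> 2 \<le> card V' \<Longrightarrow>
      solvable V' w e a"
    and sp: "splittable V w z e a x"
    and A: "A \<noteq> {}" "A \<subset> V - {x}" "boundary V w z (insert x A) \<le> demand a A"
  shows "solvable V w e a"
proof -
  note D = splittableD[OF sp]
  obtain s where s: "s \<in> A" using A(1) by blast
  define S where "S = insert x A"
  have sS: "s \<in> S" and SV: "S \<subseteq> V" and xA: "x \<notin> A" using s A(2) D(3) by (auto simp: S_def)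
  have finA: "finite A" and finS: "finite S" using SV D(8) by (auto simp: S_def intro: finite_subset)
  have "S \<subset> V" using A(2) D(3) by (auto simp: S_def)
  then have cS: "card S < card V" using D(8) by (intro psubset_card_mono)
  have cS2: "2 \<le> card S" using finA xA A(1) card_gt_0_iff[of A] by (simp add: S_def)
  let ?V' = "insert s (V - S)"
  have "card ?V' = Suc (card V - card S)"
    using D(8) finS SV sS by (simp add: card_Diff_subset)
  then have c': "card ?V' < card V" using cS2 cS by simp
  have dS: "demand a S = demand a A"
    unfolding S_def by (rule demand_insert_Ints[of A x a, OF finA xA D(4)])
  have tight: "boundary V w z S \<le> demand a S" unfolding dS unfolding S_def by (rule A(3))
  show ?thesis
  proof (rule solvable_expand[OF D(1) SV sS])
    show "solvable ?V' (contr_weight S s w) (contr_fun S s e) (contr_fun S s a)"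
    proof (rule IH[OF c'], rule normal_outer[OF D(1,2) SV sS])
      fix B assume B: "B \<noteq> {}" "B \<subset> ?V'"
      show "demand a (blow_up S s B) \<le> boundary V w z (blow_up S s B)"
      proof (cases "s \<in> B")
        case True
        then have eq: "blow_up S s B = insert x (A \<union> B)" by (auto simp: blow_up_def S_def)
        obtain v where "v \<in> ?V'" "v \<notin> B" using B(2) by blast
        then have "v \<in> V - {x}" "v \<notin> A \<union> B" using True by (auto simp: S_def)
        moreover have "A \<union> B \<subseteq> V - {x}" using B(2) A(2) s by (auto simp: S_def)
        ultimately have AB: "A \<union> B \<subset> V - {x}" by blast
        then have fAB: "finite (A \<union> B)" "x \<notin> A \<union> B" using D(8) by (auto intro: finite_subset)
        show ?thesis unfolding eq demand_insert_Ints[of "A \<union> B" x a, OF fAB D(4)]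
          using D(7)[OF _ AB] A(1) by simp
      next
        case False
        then have eq: "blow_up S s B = B" by (simp add: blow_up_def)
        have "B \<subset> V - {x}" using B(2) A(2) s False by (auto simp: S_def)
        then show ?thesis unfolding eq by (rule D(6)[OF B(1)])
      qed
    qed
  next
    fix e1 assume e1: "\<And>v. v \<in> S \<Longrightarrow> 2 * \<bar>e1 v\<bar> \<le> inner_term V S w z v" "\<bar>sum e1 S\<bar> < 1"
      "sum e1 S - sum a S \<in> \<int>"
    have "splittable S w (inner_term V S w z) e1 a x"
      unfolding splittable_def
    proof (intro conjI allI impI)
      show "prefixed S w (inner_term V S w z) e1" by (rule prefixed_inner[OF D(1) SV e1(1)])
      show "balanced S (inner_term V S w z) e1 a"
        by (rule balanced_inner[OF D(8) SV tight e1(2,3)])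
      show "x \<in> S" by (simp add: S_def)
      show "a x \<in> \<int>" by (rule D(4))
      have SxA: "S - {x} = A" using xA by (auto simp: S_def)
      have VA: "V - A = {x} \<union> (V - S)" using D(3) xA by (auto simp: S_def)
      have fVS: "finite (V - S)" "{x} \<inter> (V - S) = {}" using D(8) by (auto simp: S_def)
      have bA: "boundary V w z A = cut_weight w A {x} + cut_weight w A (V - S) + sum z A"
        unfolding boundary_def VA using cut_Un_right[OF _ fVS] by simp
      have SA: "S = {x} \<union> A" by (simp add: S_def)
      have "cut_weight w S (V - S) = cut_weight w {x} (V - S) + cut_weight w A (V - S)"
        unfolding SA using finA xA by (intro cut_Un_left) auto
      moreover have "sum z S = z x + sum z A" using finA xA by (simp add: S_def)
      ultimately have bS: "boundary V w z S = cut_weight w {x} (V - S) + cut_weight w A (V - S) + z x + sum z A"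
        by (simp add: boundary_def)
      \<comment> \<open>Deleting \<open>x\<close> from the tight set keeps the demand, so it cannot
        lower the boundary. Hence the edges from \<open>x\<close> to \<open>A\<close> outweigh all
        other weight at \<open>x\<close>, including the terminal edge.\<close>
      have "boundary V w z S \<le> boundary V w z A" using tight D(6)[OF A(1,2)] unfolding dS by (rule order_trans)
      then show "inner_term V S w z x \<le> cut_weight w {x} (S - {x})"
        using bA bS cut_commute[OF D(9), of A "{x}"] SxA by simp
      fix B assume B: "B \<noteq> {}" "B \<subset> S - {x}"
      then have B': "B \<subseteq> S" "insert x B \<subseteq> S" "B \<subset> V - {x}" using A(2) SxA by (auto simp: S_def)
      show "demand a B \<le> boundary S w (inner_term V S w z) B"
        unfolding boundary_inner[OF D(8) B'(1) SV] by (rule D(6)[OF B(1) B'(3)])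
      show "demand a B \<le> boundary S w (inner_term V S w z) (insert x B)"
        unfolding boundary_inner[OF D(8) B'(2) SV] by (rule D(7)[OF B(1) B'(3)])
    qed
    then show "solvable S w e1 a" by (rule IH2[OF cS _ cS2])
  qed
qed

text \<open>\<open>R\<close> will consist of the slacks of the endangered sets. Each falls at rate
  2, so the process stops at \<open>T\<close> or at half the least slack.\<close>

lemma first_tight:
  fixes R :: "real set"
  assumes "finite R" "0 \<le> T" "\<And>r. r \<in> R \<Longrightarrow> 0 \<le> r"
  shows "\<exists>\<theta>. 0 \<le> \<theta> \<and> \<theta> \<le> T \<and> (\<forall>r\<in>R. 2 * \<theta> \<le> r) \<and> (\<theta> = T \<or> 2 * \<theta> \<in> R)"
proof (cases "\<forall>r\<in>R. 2 * T \<le> r")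
  case True
  then show ?thesis using assms(2) by (intro exI[of _ T]) simp
next
  case False
  then obtain r where r: "r \<in> R" "r < 2 * T" by force
  then have m: "Min R \<in> R" "\<forall>r\<in>R. Min R \<le> r" using assms(1) Min_in by auto
  then have "Min R < 2 * T" "0 \<le> Min R" using r assms(3) by force+
  then show ?thesis using m by (intro exI[of _ "Min R / 2"]) simp
qed

text \<open>
  If no neighbour carries half of the weight at \<open>x\<close>, split off a pair of edges at \<open>x\<close> as far as
  possible, that is, until one of them vanishes or a set becomes tight. When \<open>z x\<close> has reached the
  weight of the other edges at \<open>x\<close>, the terminal edge takes part in each pair.
\<close>

lemma solvable_splittable_aux:
  fixes V :: "'v set"
  assumes IH: "\<And>(V' :: 'v set) w z e a. card V' < card V \<Longrightarrow> normal V' w z e a \<Longrightarrow> solvable V' w e a"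
    and IH2: "\<And>(V' :: 'v set) w z e a. card V' < card V \<Longrightarrow> splittable V' w z e a x \<Longrightarrow> 2 \<le> card V' \<Longrightarrow>
      solvable V' w e a"
    and card2: "2 \<le> card V" and sp: "splittable V w z e a x"
  shows "solvable V w e a"
  using sp
\<comment> \<open>The factor 2 lets the loss of a neighbour outweigh the flag, which only records
  whether the terminal edge is still lighter than the other edges at \<open>x\<close>
  together.\<close>
proof (induction "2 * card {u \<in> V - {x}. 0 < w x u} + (if z x < cut_weight w {x} (V - {x}) then 1 else 0)"
    arbitrary: w z e rule: less_induct)
  case (less w z e)
  note D = splittableD[OF less.prems]
  define h where "h = cut_weight w {x} (V - {x})"
  have h_sum: "h = (\<Sum>u\<in>V - {x}. w x u)" by (simp add: h_def cut_weight_def)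
  have finV: "finite (V - {x})" using D(8) by simp
  have w0: "0 \<le> w p q" for p q by (rule weightingD(2)[OF D(9)])
  have z0: "0 \<le> z x" using D(10)[OF D(3)] by linarith
  have w_le_h: "w x u \<le> h" if "u \<in> V - {x}" for u
    unfolding h_sum using that finV w0 by (intro member_le_sum) auto
  show ?case
  proof (cases "\<exists>u\<in>V - {x}. h + z x \<le> 2 * w x u")
    case True
    then obtain u where "u \<in> V" "u \<noteq> x" "h + z x \<le> 2 * w x u" by auto
    then show ?thesis using solvable_majority[OF IH less.prems] by (simp add: h_def)
  next
    case nomaj: False
    have "V - {x} \<noteq> {}"
    proof
      assume "V - {x} = {}"
      then have "V = {x}" using D(3) by auto
      then show False using card2 by simp
    qed
    have hpos: "0 < h"
    proof (rule ccontr)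
      assume "\<not> 0 < h"
      moreover obtain u where "u \<in> V - {x}" using \<open>V - {x} \<noteq> {}\<close> by blast
      ultimately show False using nomaj D(5) w0[of x u] by (force simp: h_def)
    qed
    have nb: "\<exists>u\<in>V - {x} - U. 0 < w x u" if "(\<Sum>u\<in>U. w x u) < h" "U \<subseteq> V - {x}" for U
    proof (rule ccontr)
      assume "\<not> ?thesis"
      then have "(\<Sum>u\<in>V - {x} - U. w x u) = 0" using w0 by (intro sum.neutral) (auto simp: order.antisym not_less)
      then have "h = (\<Sum>u\<in>U. w x u)" unfolding h_sum using sum.subset_diff[OF that(2) finV, of "w x"] by simp
      then show False using that(1) by simp
    qed
    obtain y where y: "y \<in> V" "y \<noteq> x" "0 < w x y" using nb[of "{}"] hpos by auto
    have tight1: "solvable V w' e' a"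
      if "splittable V w' z' e' a x" "A \<subset> V - {x}" "2 \<le> card A" "boundary V w' z' A \<le> demand a A" for w' z' e' A
      using solvable_split_tight[OF IH IH2 that] .
    have tight2: "solvable V w' e' a"
      if "splittable V w' z' e' a x" "A \<noteq> {}" "A \<subset> V - {x}" "boundary V w' z' (insert x A) \<le> demand a A" for w' z' e' A
      using solvable_split_tight_insert[OF IH IH2 that] .
    show ?thesis
    proof (cases "z x < h")
      case True
      have "w x y < h"
      proof (rule ccontr)
        assume "\<not> w x y < h"
        then have "h + z x \<le> 2 * w x y" using True by simp
        then show False using nomaj y by blast
      qed
      then obtain y' where y': "y' \<in> V" "y' \<noteq> x" "y' \<noteq> y" "0 < w x y'" using nb[of "{y}"] y by auto
      \<comment> \<open>The third bound keeps the terminal weight at \<open>x\<close> at most the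
        weight of its other edges, which falls by 2\<theta>.\<close>
      define T where "T = min (min (w x y) (w x y')) ((h - z x) / 2)"
      \<comment> \<open>Only cuts with \<open>x\<close> on one side and both \<open>y\<close> and
        \<open>y'\<close> on the other lose 2\<theta>; in every other cut the new edge yy'
        compensates any loss. A set in \<open>K1\<close> has two elements, as contraction
        requires.\<close>
      define K1 where "K1 = {A. A \<subset> V - {x} \<and> y \<in> A \<and> y' \<in> A}"
      define K2 where "K2 = {A. A \<noteq> {} \<and> A \<subset> V - {x} \<and> y \<notin> A \<and> y' \<notin> A}"
      define R where "R = (\<lambda>A. boundary V w z A - demand a A) ` K1 \<union>
        (\<lambda>A. boundary V w z (insert x A) - demand a A) ` K2"
      have finP: "finite (Pow (V - {x}))" using finV by simp
      have "finite K1" "finite K2"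
        by (rule finite_subset[OF _ finP], force simp: K1_def K2_def)+
      then have "finite R" by (simp add: R_def)
      moreover have "0 \<le> T" using True w0 by (simp add: T_def)
      moreover have "0 \<le> r" if r: "r \<in> R" for r
      proof -
        from r consider A where "A \<in> K1" "r = boundary V w z A - demand a A"
          | A where "A \<in> K2" "r = boundary V w z (insert x A) - demand a A"
          unfolding R_def by (elim UnE imageE)
        then show ?thesis
        proof cases
          case 1
          then show ?thesis using D(6)[of A] unfolding K1_def by auto
        next
          case 2
          then show ?thesis using D(7)[of A] unfolding K2_def by auto
        qed
      qed
      ultimately have "\<exists>\<theta>. 0 \<le> \<theta> \<and> \<theta> \<le> T \<and> (\<forall>r\<in>R. 2 * \<theta> \<le> r) \<and> (\<theta> = T \<or> 2 * \<theta> \<in> R)"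
        by (rule first_tight)
      then obtain \<theta> where \<theta>: "0 \<le> \<theta>" "\<theta> \<le> T" "\<And>r. r \<in> R \<Longrightarrow> 2 * \<theta> \<le> r" "\<theta> = T \<or> 2 * \<theta> \<in> R"
        by blast
      define w1 where "w1 = (\<lambda>u v. w u v - \<theta> * link x y u v - \<theta> * link x y' u v + \<theta> * link y y' u v)"
      have \<theta>_le: "\<theta> \<le> w x y" "\<theta> \<le> w x y'" "2 * \<theta> \<le> h - z x" using \<theta>(2) by (auto simp: T_def)
      have W1: "weighting w1"
        unfolding w1_def
        by (intro weighting_plus_link weighting_minus_link D(9))
          (use \<theta>_le \<theta>(1) y y' in \<open>auto simp: link_eq_0\<close>)
      have b1: "boundary V w1 z A = boundary V w z A - \<theta> * of_bool ((x \<in> A) \<noteq> (y \<in> A)) -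
          \<theta> * of_bool ((x \<in> A) \<noteq> (y' \<in> A)) + \<theta> * of_bool ((y \<in> A) \<noteq> (y' \<in> A))" if "A \<subseteq> V" for A
        unfolding w1_def using D(3,8) y(1) y'(1) that
        by (simp only: boundary_plus_link boundary_minus_link)
      have xy: "w1 x y = w x y - \<theta>" "w1 x y' = w x y' - \<theta>"
        using y y' by (simp_all add: w1_def link_arrow_values link_eq_0)
      have w1_le: "w1 x u \<le> w x u" if "u \<noteq> x" for u
        using that y(2) y'(2) mult_nonneg_nonneg[OF \<theta>(1) link_nonneg[of x y x u]]
          mult_nonneg_nonneg[OF \<theta>(1) link_nonneg[of x y' x u]]
        by (simp add: w1_def link_eq_0)
      have h1: "cut_weight w1 {x} (V - {x}) = h - 2 * \<theta>"
        using b1[of "{x}"] y y' D(3) by (simp add: boundary_def h_def)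
      have sp1: "splittable V w1 z e a x"
        unfolding splittable_def
      proof (intro conjI allI impI)
        show "prefixed V w1 z e" using D(1) W1 by (simp add: prefixed_def)
        show "z x \<le> cut_weight w1 {x} (V - {x})" unfolding h1 using \<theta>_le by simp
        fix A assume A: "A \<noteq> {}" "A \<subset> V - {x}"
        have AV: "A \<subseteq> V" "insert x A \<subseteq> V" "x \<notin> A" using A D(3) by auto
        show "demand a A \<le> boundary V w1 z A"
        proof (cases "y \<in> A \<and> y' \<in> A")
          case True
          then have "A \<in> K1" using A by (simp add: K1_def)
          then have "2 * \<theta> \<le> boundary V w z A - demand a A" by (intro \<theta>(3)) (simp add: R_def)
          then show ?thesis using b1[OF AV(1)] AV(3) True by simp
        next
          case False
          then show ?thesis using b1[OF AV(1)] AV(3) D(6)[OF A] \<theta>(1) by auto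
        qed
        show "demand a A \<le> boundary V w1 z (insert x A)"
        proof (cases "y \<notin> A \<and> y' \<notin> A")
          case True
          then have "A \<in> K2" using A by (simp add: K2_def)
          then have "2 * \<theta> \<le> boundary V w z (insert x A) - demand a A" by (intro \<theta>(3)) (simp add: R_def)
          then show ?thesis using b1[OF AV(2)] y y' True by simp
        next
          case False
          then show ?thesis using b1[OF AV(2)] y y' D(7)[OF A] \<theta>(1) by auto
        qed
      qed (fact D(2) D(3) D(4))+
      have "solvable V w1 e a"
      proof (cases "\<theta> = T")
        case T: True
        let ?N = "{u \<in> V - {x}. 0 < w x u}" and ?N1 = "{u \<in> V - {x}. 0 < w1 x u}"
        have sub: "?N1 \<subseteq> ?N" using w1_le by fastforce
        have finN: "finite ?N" using finV by simp
        have "\<theta> = w x y \<or> \<theta> = w x y' \<or> 2 * \<theta> = h - z x" using T by (auto simp: T_def min_def)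
        then consider "y \<notin> ?N1 \<or> y' \<notin> ?N1" | "2 * \<theta> = h - z x" using xy by fastforce
        then show ?thesis
        proof cases
          case 1
          then have "?N1 \<subset> ?N" using sub y y' by blast
          then have "card ?N1 < card ?N" using finN by (intro psubset_card_mono)
          then show ?thesis by (intro less.hyps[OF _ sp1]) (auto split: if_splits)
        next
          case 2
          then have "\<not> z x < cut_weight w1 {x} (V - {x})" using h1 by simp
          moreover have "z x < cut_weight w {x} (V - {x})" using True by (simp add: h_def)
          moreover have "card ?N1 \<le> card ?N" using finN sub by (intro card_mono)
          ultimately show ?thesis by (intro less.hyps[OF _ sp1]) auto
        qed
      next
        case False
        then have "2 * \<theta> \<in> R" using \<theta>(4) by blast
        then consider A where "A \<subset> V - {x}" "y \<in> A" "y' \<in> A" "2 * \<theta> = boundary V w z A - demand a A"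
          | A where "A \<noteq> {}" "A \<subset> V - {x}" "y \<notin> A" "y' \<notin> A"
            "2 * \<theta> = boundary V w z (insert x A) - demand a A"
          unfolding R_def K1_def K2_def by blast
        then show ?thesis
        proof cases
          case 1
          have "card {y, y'} \<le> card A" using 1 finV by (intro card_mono) (auto intro: finite_subset)
          then have "2 \<le> card A" using y'(3) by simp
          moreover have "A \<subseteq> V" "x \<notin> A" using 1(1) by auto
          then have "boundary V w1 z A \<le> demand a A" using b1[of A] 1(2-4) by simp
          ultimately show ?thesis using tight1[OF sp1] 1 by blast
        next
          case 2
          have "insert x A \<subseteq> V" using 2(2) D(3) by auto
          then have "boundary V w1 z (insert x A) \<le> demand a A"
            using b1[of "insert x A"] y y' 2(3-5) by simp
          then show ?thesis using tight2[OF sp1] 2 by blast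
        qed
      qed
      then obtain Y where Y: "\<forall>v\<in>V. \<bar>of_int (Y v) - a v\<bar> < 1" "routable V w1 (\<lambda>v. of_int (Y v) - a v + e v)"
        unfolding solvable_def by blast
      have "distinct [x, y, y']" using y(2) y'(2,3) by auto
      then have "routable V w (\<lambda>v. of_int (Y v) - a v + e v)"
        by (rule routable_unlift[OF Y(2)[unfolded w1_def] D(8,3) y(1) y'(1) _ \<theta>(1) D(9)])
      then show ?thesis using Y(1) unfolding solvable_def by blast
    next
      case False
      then have zh: "z x = h" using D(5) by (simp add: h_def)
      define T where "T = w x y"
      \<comment> \<open>A set containing \<open>y\<close> but not \<open>x\<close> loses the edge xy
        and gains the terminal weight moved to \<open>y\<close>. Thus only sets containing
        \<open>x\<close> but not \<open>y\<close> lose weight.\<close>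
      define K where "K = {A. A \<noteq> {} \<and> A \<subset> V - {x} \<and> y \<notin> A}"
      define R where "R = (\<lambda>A. boundary V w z (insert x A) - demand a A) ` K"
      have finP: "finite (Pow (V - {x}))" using finV by simp
      have "finite K" by (rule finite_subset[OF _ finP]) (force simp: K_def)
      then have "finite R" by (simp add: R_def)
      moreover have "0 \<le> T" using w0 by (simp add: T_def)
      moreover have "0 \<le> r" if r: "r \<in> R" for r
      proof -
        from r obtain A where "A \<in> K" "r = boundary V w z (insert x A) - demand a A"
          unfolding R_def by (elim imageE)
        then show ?thesis using D(7)[of A] unfolding K_def by auto
      qed
      ultimately have "\<exists>\<theta>. 0 \<le> \<theta> \<and> \<theta> \<le> T \<and> (\<forall>r\<in>R. 2 * \<theta> \<le> r) \<and> (\<theta> = T \<or> 2 * \<theta> \<in> R)"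
        by (rule first_tight)
      then obtain \<theta> where \<theta>: "0 \<le> \<theta>" "\<theta> \<le> T" "\<And>r. r \<in> R \<Longrightarrow> 2 * \<theta> \<le> r" "\<theta> = T \<or> 2 * \<theta> \<in> R"
        by blast
      \<comment> \<open>The prescribed flow moves with its weight in proportion, so the capacity
        bound survives on both the moved and the remaining terminal weight.\<close>
      define \<kappa> where "\<kappa> = e x * (\<theta> / z x)"
      define w1 where "w1 = (\<lambda>u v. w u v - \<theta> * link x y u v)"
      define z1 where "z1 = (\<lambda>v. z v + (- \<theta>) * (of_bool (v = x) - of_bool (v = y)))"
      define e1 where "e1 = (\<lambda>v. e v + (- \<kappa>) * (of_bool (v = x) - of_bool (v = y)))"
      have \<theta>z: "\<theta> \<le> z x" "\<theta> \<le> w x y" using \<theta>(2) w_le_h[of y] y zh by (auto simp: T_def)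
      have zpos: "0 < z x" using zh hpos by simp
      have ex: "2 * \<bar>e x\<bar> \<le> z x" by (rule D(10)[OF D(3)])
      have \<kappa>: "2 * \<bar>\<kappa>\<bar> \<le> \<theta>"
      proof -
        have "2 * \<bar>\<kappa>\<bar> = 2 * \<bar>e x\<bar> * (\<theta> / z x)" using \<theta>(1) zpos by (simp add: \<kappa>_def abs_mult)
        also have "\<dots> \<le> z x * (\<theta> / z x)" using ex \<theta>(1) zpos by (intro mult_right_mono) auto
        finally show ?thesis using zpos by simp
      qed
      have ex1: "2 * \<bar>e x - \<kappa>\<bar> \<le> z x - \<theta>"
      proof -
        have "e x - \<kappa> = e x * ((z x - \<theta>) / z x)" using zpos by (simp add: \<kappa>_def field_simps)
        then have "2 * \<bar>e x - \<kappa>\<bar> = 2 * \<bar>e x\<bar> * ((z x - \<theta>) / z x)" using \<theta>z zpos by (simp add: abs_mult)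
        also have "\<dots> \<le> z x * ((z x - \<theta>) / z x)" using ex \<theta>z zpos by (intro mult_right_mono) auto
        finally show ?thesis using zpos by simp
      qed
      have W1: "weighting w1"
        unfolding w1_def using \<theta>z y by (intro weighting_minus_link D(9)) auto
      have sz: "sum z1 A = sum z A - \<theta> * (of_bool (x \<in> A) - of_bool (y \<in> A))" if "finite A" for A
        unfolding z1_def sum_shift[OF that] by simp
      have se: "sum e1 V = sum e V"
        unfolding e1_def sum_shift[OF D(8)] using D(3) y by simp
      have b1: "boundary V w1 z1 A = boundary V w z A - \<theta> * of_bool ((x \<in> A) \<noteq> (y \<in> A))
          - \<theta> * (of_bool (x \<in> A) - of_bool (y \<in> A))" if "A \<subseteq> V" for A
      proof -
        have "boundary V w1 z1 A = boundary V w1 z A - \<theta> * (of_bool (x \<in> A) - of_bool (y \<in> A))"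
          using sz[of A] that D(8) by (simp add: boundary_def finite_subset)
        then show ?thesis using boundary_minus_link[OF D(8) that D(3) y(1), of w \<theta> z] by (simp add: w1_def)
      qed
      have h1: "cut_weight w1 {x} (V - {x}) = h - \<theta>"
        using boundary_minus_link[OF D(8) _ D(3) y(1), of "{x}" w \<theta> z] y D(3)
        by (simp add: boundary_def h_def w1_def)
      have z1x: "z1 x = z x - \<theta>" using y by (simp add: z1_def)
      have sp1: "splittable V w1 z1 e1 a x"
        unfolding splittable_def
      proof (intro conjI allI impI)
        show "prefixed V w1 z1 e1"
          unfolding prefixed_def
        proof (intro conjI ballI D(8) W1)
          fix v assume "v \<in> V"
          then have ev: "2 * \<bar>e v\<bar> \<le> z v" by (rule D(10))
          consider "v = x" | "v = y" "v \<noteq> x" | "v \<noteq> x" "v \<noteq> y" by blast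
          then show "2 * \<bar>e1 v\<bar> \<le> z1 v"
            by cases (use ex1 ev double_abs_add_le[OF ev \<kappa>] y in \<open>auto simp: e1_def z1_def\<close>)
        qed
        show "balanced V z1 e1 a"
          using D(2) sz[OF D(8)] D(3) y unfolding balanced_def se by simp
        show "z1 x \<le> cut_weight w1 {x} (V - {x})" unfolding h1 z1x using zh by simp
        fix A assume A: "A \<noteq> {}" "A \<subset> V - {x}"
        have AV: "A \<subseteq> V" "insert x A \<subseteq> V" "x \<notin> A" using A D(3) by auto
        show "demand a A \<le> boundary V w1 z1 A"
          using b1[OF AV(1)] AV(3) D(6)[OF A] by (cases "y \<in> A") auto
        show "demand a A \<le> boundary V w1 z1 (insert x A)"
        proof (cases "y \<in> A")
          case True
          then show ?thesis using b1[OF AV(2)] D(7)[OF A] by auto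
        next
          case False
          then have "A \<in> K" using A by (simp add: K_def)
          then have "2 * \<theta> \<le> boundary V w z (insert x A) - demand a A" by (intro \<theta>(3)) (simp add: R_def)
          then show ?thesis using b1[OF AV(2)] y False by simp
        qed
      qed (fact D(3) D(4))+
      have "solvable V w1 e1 a"
      proof (cases "\<theta> = T")
        case T: True
        let ?N = "{u \<in> V - {x}. 0 < w x u}" and ?N1 = "{u \<in> V - {x}. 0 < w1 x u}"
        have le: "w1 x u \<le> w x u" for u
          using mult_nonneg_nonneg[OF \<theta>(1) link_nonneg[of x y x u]] by (simp add: w1_def)
        have "?N1 \<subseteq> ?N"
        proof
          fix u assume "u \<in> ?N1"
          then show "u \<in> ?N" using le[of u] by auto
        qed
        moreover have "w1 x y = 0" using T y by (simp add: w1_def T_def link_arrow_values)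
        then have "y \<notin> ?N1" "y \<in> ?N" using y by auto
        ultimately have "?N1 \<subset> ?N" by blast
        then have "card ?N1 < card ?N" using finV by (intro psubset_card_mono) auto
        then show ?thesis by (intro less.hyps[OF _ sp1]) (auto split: if_splits)
      next
        case False
        then have "2 * \<theta> \<in> R" using \<theta>(4) by blast
        then obtain A where A: "A \<noteq> {}" "A \<subset> V - {x}" "y \<notin> A"
            "2 * \<theta> = boundary V w z (insert x A) - demand a A"
          unfolding R_def K_def by blast
        have "insert x A \<subseteq> V" using A(2) D(3) by auto
        then have "boundary V w1 z1 (insert x A) \<le> demand a A"
          using b1[of "insert x A"] y A(3,4) by simp
        then show ?thesis using tight2[OF sp1] A by blast
      qed
      then obtain Y where Y: "\<forall>v\<in>V. \<bar>of_int (Y v) - a v\<bar> < 1" "routable V w1 (\<lambda>v. of_int (Y v) - a v + e1 v)"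
        unfolding solvable_def by blast
      have "routable V w (\<lambda>v. of_int (Y v) - a v + e v)"
        by (rule routable_restore_edge[OF Y(2)[unfolded w1_def] D(8,3) y(1) \<kappa>]) (simp add: e1_def algebra_simps)
      then show ?thesis using Y(1) unfolding solvable_def by blast
    qed
  qed
qed

lemma solvable_splittable:
  fixes V :: "'v set"
  assumes IH: "\<And>(V' :: 'v set) w z e a. card V' < n \<Longrightarrow> normal V' w z e a \<Longrightarrow> solvable V' w e a"
    and "card V \<le> n" "2 \<le> card V" "splittable V w z e a x"
  shows "solvable V w e a"
  using assms(2-4)
proof (induction "card V" arbitrary: V w z e a rule: less_induct)
  case less
  show ?case
  proof (rule solvable_splittable_aux[OF _ _ less.prems(2,3)])
    fix V' :: "'v set" and w z e a assume "card V' < card V" "normal V' w z e a"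
    then show "solvable V' w e a" using IH less.prems(1) by (meson less_le_trans)
  next
    fix V' :: "'v set" and w z e a
    assume "card V' < card V" "splittable V' w z e a x" "2 \<le> card V'"
    then show "solvable V' w e a" using less.hyps less.prems(1) by (meson less_imp_le less_le_trans)
  qed
qed

lemma normalD:
  assumes "normal V w z e a"
  shows "prefixed V w z e" "balanced V z e a" "finite V" "weighting w"
    "\<And>v. v \<in> V \<Longrightarrow> 2 * \<bar>e v\<bar> \<le> z v"
    "\<And>A. A \<noteq> {} \<Longrightarrow> A \<subset> V \<Longrightarrow> demand a A \<le> boundary V w z A"
    "\<bar>sum e V\<bar> < 1" "sum e V - sum a V \<in> \<int>" "sum z V \<le> 5 + 2 * int_dist (sum e V)"
  using assms by (auto simp: normal_def prefixed_def balanced_def)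

text \<open>The only condition of \<open>splittable\<close> not inherited directly is the bound on
  \<open>z x\<close>. It follows from V - {x} and V having the same demand: the boundary of the
  first is at least this demand, \<open>sum z V\<close> is at most it.\<close>

lemma solvable_integral:
  fixes V :: "'v set"
  assumes IH: "\<And>(V' :: 'v set) w z e a. card V' < card V \<Longrightarrow> normal V' w z e a \<Longrightarrow> solvable V' w e a"
    and nor: "normal V w z e a" and card2: "2 \<le> card V" and x: "x \<in> V" "a x \<in> \<int>"
  shows "solvable V w e a"
proof (rule solvable_splittable[OF IH order_refl card2])
  note D = normalD[OF nor]
  have Vx: "V - (V - {x}) = {x}" using x(1) by auto
  have ne: "V - {x} \<noteq> {}"
  proof
    assume "V - {x} = {}"
    then have "V = {x}" using x(1) by auto
    then show False using card2 by simp
  qed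
  have "demand a (V - {x}) \<le> boundary V w z (V - {x})" using ne x(1) by (intro D(6)) auto
  also have "\<dots> = cut_weight w {x} (V - {x}) + sum z (V - {x})"
    unfolding boundary_def Vx using cut_commute[OF D(4)] by simp
  finally have 1: "demand a (V - {x}) \<le> cut_weight w {x} (V - {x}) + sum z (V - {x})" .
  have "demand a (V - {x}) = demand a (insert x (V - {x}))"
    using D(3) x(2) by (intro demand_insert_Ints[symmetric]) auto
  also have "insert x (V - {x}) = V" using x(1) by auto
  finally have "demand a (V - {x}) = 5 + 2 * int_dist (sum e V)"
    using int_dist_diff_Ints[OF D(8)] by (simp add: demand_def)
  moreover have "sum z V = z x + sum z (V - {x})" using D(3) x(1) by (rule sum.remove)
  ultimately have zx: "z x \<le> cut_weight w {x} (V - {x})" using 1 D(9) by linarith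
  show "splittable V w z e a x"
    unfolding splittable_def
  proof (intro conjI allI impI D(1,2) x zx)
    fix A assume A: "A \<noteq> {}" "A \<subset> V - {x}"
    then have A': "A \<subset> V" "insert x A \<subset> V" "x \<notin> A" "finite A"
      using x(1) D(3) by (auto intro: finite_subset)
    show "demand a A \<le> boundary V w z A" by (rule D(6)[OF A(1) A'(1)])
    show "demand a A \<le> boundary V w z (insert x A)"
      using D(6)[OF _ A'(2)] demand_insert_Ints[of A x a, OF A'(4,3) x(2)] by simp
  qed
qed

section \<open>Reducible instances and changes of parameters that preserve solutions\<close>

definition reducible :: "'v set \<Rightarrow> ('v \<Rightarrow> 'v \<Rightarrow> real) \<Rightarrow> ('v \<Rightarrow> real) \<Rightarrow> ('v \<Rightarrow> real) \<Rightarrow> bool" where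
  "reducible V w z a \<longleftrightarrow> (\<exists>x\<in>V. a x \<in> \<int>) \<or>
     (\<exists>S\<subset>V. 2 \<le> card S \<and> boundary V w z S \<le> demand a S)"

lemma solvable_reducible:
  fixes V :: "'v set"
  assumes IH: "\<And>(V' :: 'v set) w z e a. card V' < card V \<Longrightarrow> normal V' w z e a \<Longrightarrow> solvable V' w e a"
    and "normal V w z e a" "2 \<le> card V" "reducible V w z a"
  shows "solvable V w e a"
  using assms(4) unfolding reducible_def
proof (elim disjE bexE exE conjE)
  fix x assume x: "x \<in> V" "a x \<in> \<int>"
  show ?thesis by (rule solvable_integral[OF _ assms(2,3) x]) (rule IH)
next
  fix S assume S: "S \<subset> V" "2 \<le> card S" "boundary V w z S \<le> demand a S"
  show ?thesis by (rule solvable_tight[OF _ assms(2) S]) (rule IH)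
qed

text \<open>The only integers at distance less than 1 from a point of [m, m+1] are m and m+1, and
  both are that close to every interior point. Hence \<open>a\<close> may be moved within its closed
  unit interval before rounding.\<close>

lemma round_within:
  fixes m y :: int and a a' :: real
  assumes "of_int m < a" "a < of_int m + 1" "of_int m \<le> a'" "a' \<le> of_int m + 1" "\<bar>of_int y - a'\<bar> < 1"
  shows "\<bar>of_int y - a\<bar> < 1"
proof -
  have "(of_int (m - 1) :: real) < of_int y" "(of_int y :: real) < of_int (m + 2)" using assms by auto
  then have "m - 1 < y" "y < m + 2" by (simp_all only: of_int_less_iff)
  then have "y = m \<or> y = m + 1" by auto
  then show ?thesis using assms(1,2) by auto
qed

text \<open>The flow condition depends on \<open>e - a\<close> only, and moving \<open>a\<close>
  inside its unit interval is harmless for the rounding.\<close>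

lemma solvable_reparam:
  assumes "solvable V w e' a'" "\<And>v. v \<in> V \<Longrightarrow> e' v - a' v = e v - a v"
    and "\<And>v. v \<in> V \<Longrightarrow> of_int (m v) < a v \<and> a v < of_int (m v) + 1 \<and> of_int (m v) \<le> a' v \<and> a' v \<le> of_int (m v) + 1"
  shows "solvable V w e a"
proof -
  obtain y where y: "\<forall>v\<in>V. \<bar>of_int (y v) - a' v\<bar> < 1" "routable V w (\<lambda>v. of_int (y v) - a' v + e' v)"
    using assms(1) unfolding solvable_def by blast
  have "\<forall>v\<in>V. \<bar>of_int (y v) - a v\<bar> < 1" using y(1) assms(3) round_within by blast
  moreover have "routable V w (\<lambda>v. of_int (y v) - a v + e v)"
    by (rule routable_cong[OF _ y(2)]) (use assms(2) in force)
  ultimately show ?thesis unfolding solvable_def by blast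
qed

lemma solvable_uminus:
  assumes "solvable V w (\<lambda>v. - e v) (\<lambda>v. - a v)"
  shows "solvable V w e a"
proof -
  obtain y where y: "\<forall>v\<in>V. \<bar>of_int (y v) - - a v\<bar> < 1" "routable V w (\<lambda>v. of_int (y v) - - a v + - e v)"
    using assms unfolding solvable_def by blast
  have "routable V w (\<lambda>v. of_int (- y v) - a v + e v)"
    by (rule routable_uminus, rule routable_cong[OF _ y(2)]) simp
  moreover have "\<bar>of_int (- y v) - a v\<bar> = \<bar>of_int (y v) - - a v\<bar>" for v by (simp add: abs_minus_commute)
  ultimately show ?thesis using y(1) unfolding solvable_def by (intro exI[of _ "\<lambda>v. - y v"]) metis
qed

lemma normal_uminus:
  assumes "normal V w z e a"
  shows "normal V w z (\<lambda>v. - e v) (\<lambda>v. - a v)"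
proof -
  note D = normalD[OF assms]
  have "sum e V - sum a V \<in> \<int> \<Longrightarrow> - (sum e V - sum a V) \<in> \<int>" by (rule Ints_minus)
  then have "- sum e V - - sum a V \<in> \<int>" using D(8) by (simp add: algebra_simps)
  then have "balanced V z (\<lambda>v. - e v) (\<lambda>v. - a v)"
    using D(7,9) unfolding balanced_def by (simp add: sum_negf)
  moreover have "prefixed V w z (\<lambda>v. - e v)" using D(1) by (simp add: prefixed_def)
  moreover have "demand (\<lambda>v. - a v) A = demand a A" for A by (simp add: demand_def sum_negf)
  ultimately show ?thesis using D(6) by (simp add: normal_def)
qed

section \<open>Moving towards integrality\<close>

text \<open>
  Raising \<open>a x\<close> and lowering \<open>a y\<close> by \<open>\<theta> / 2\<close> moves both towards the nearest integer, so the demand of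
  each of these two vertices drops by the weight \<open>\<theta>\<close> taken from the edge between them.
\<close>

lemma solvable_opposite:
  fixes V :: "'v set"
  assumes IH: "\<And>(V' :: 'v set) w z e a. card V' < card V \<Longrightarrow> normal V' w z e a \<Longrightarrow> solvable V' w e a"
    and IH2: "\<And>w' z e a. card {(u, v). u \<in> V \<and> v \<in> V \<and> 0 < w' u v} < card {(u, v). u \<in> V \<and> v \<in> V \<and> 0 < w u v} \<Longrightarrow>
      normal V w' z e a \<Longrightarrow> solvable V w' e a"
    and nor: "normal V w z e a" and nint: "\<And>v. v \<in> V \<Longrightarrow> a v \<notin> \<int>"
    and xy: "x \<in> V" "y \<in> V" "x \<noteq> y" "0 < w x y"
      "1/2 \<le> a x - of_int \<lfloor>a x\<rfloor>" "a y - of_int \<lfloor>a y\<rfloor> \<le> 1/2"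
  shows "solvable V w e a"
proof -
  note D = normalD[OF nor]
  have card2: "2 \<le> card V" using card_mono[of V "{x, y}"] xy D(3) by simp
  define m where "m v = \<lfloor>a v\<rfloor>" for v
  have m: "of_int (m v) < a v \<and> a v < of_int (m v) + 1" if "v \<in> V" for v
  proof -
    have "of_int (m v) \<noteq> a v" using nint[OF that] by (metis Ints_of_int)
    then show ?thesis unfolding m_def by linarith
  qed
  define K where "K = {A. A \<subset> V \<and> 2 \<le> card A}"
  \<comment> \<open>A set separating \<open>x\<close> from \<open>y\<close> loses weight \<theta>,
    and its sum of \<open>a\<close> moves by \<theta>/2 in the direction \<sigma>. Singletons are
    excluded from \<open>K\<close>: their demand falls along with their boundary, and their
    tightness would be of no use.\<close>
  define slack where "slack A \<sigma> \<theta> = boundary V w z A - \<theta> - 5 - 2 * int_dist (sum a A + \<sigma> * (\<theta> / 2))" for A \<sigma> \<theta>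
  define F where "F = (\<lambda>A. slack A 1) ` {A \<in> K. x \<in> A \<and> y \<notin> A} \<union> (\<lambda>A. slack A (- 1)) ` {A \<in> K. y \<in> A \<and> x \<notin> A} \<union>
    {\<lambda>\<theta>. of_int (m x) + 1 - a x - \<theta> / 2, \<lambda>\<theta>. a y - of_int (m y) - \<theta> / 2}"
  have finP: "finite (Pow V)" using D(3) by simp
  have "finite K" by (rule finite_subset[OF _ finP]) (force simp: K_def)
  then have finF: "finite F" by (simp add: F_def)
  have T: "0 \<le> w x y" using xy(4) by simp
  have cs: "continuous_on X (slack A \<sigma>)" for X A \<sigma>
    unfolding slack_def by (intro continuous_intros continuous_on_int_dist_comp) simp_all
  have cf: "continuous_on {0..w x y} f" if f: "f \<in> F" for f
  proof -
    have "(\<exists>A \<sigma>. f = slack A \<sigma>) \<or> f = (\<lambda>\<theta>. of_int (m x) + 1 - a x - \<theta> / 2) \<or> f = (\<lambda>\<theta>. a y - of_int (m y) - \<theta> / 2)"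
      using f unfolding F_def by blast
    then show ?thesis using cs by (elim disjE exE) (simp, (simp only:, intro continuous_intros; simp)+)
  qed
  have f0: "0 \<le> f 0" if f: "f \<in> F" for f
  proof -
    have s0: "0 \<le> slack A \<sigma> 0" if "A \<in> K" for A \<sigma>
      using D(6)[of A] that by (force simp: slack_def K_def demand_def)
    have "(\<exists>A \<sigma>. A \<in> K \<and> f = slack A \<sigma>) \<or> f = (\<lambda>\<theta>. of_int (m x) + 1 - a x - \<theta> / 2) \<or> f = (\<lambda>\<theta>. a y - of_int (m y) - \<theta> / 2)"
      using f unfolding F_def by blast
    then show ?thesis using s0 m[OF xy(1)] m[OF xy(2)] by (elim disjE exE conjE) simp_all
  qed
  have "\<exists>\<theta>. 0 \<le> \<theta> \<and> \<theta> \<le> w x y \<and> (\<forall>f\<in>F. 0 \<le> f \<theta>) \<and> (\<theta> = w x y \<or> \<theta> < w x y \<and> (\<exists>f\<in>F. f \<theta> = 0))"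
    by (rule first_zero[of F "w x y"]) (use finF T cf f0 in blast)+
  then obtain \<theta> where \<theta>: "0 \<le> \<theta>" "\<theta> \<le> w x y" "\<And>f. f \<in> F \<Longrightarrow> 0 \<le> f \<theta>"
    "\<theta> = w x y \<or> \<theta> < w x y \<and> (\<exists>f\<in>F. f \<theta> = 0)" by blast
  define w1 where "w1 = (\<lambda>u v. w u v - \<theta> * link x y u v)"
  define a1 where "a1 = (\<lambda>v. a v + (\<theta> / 2) * (of_bool (v = x) - of_bool (v = y)))"
  have a1: "a1 x = a x + \<theta> / 2" "a1 y = a y - \<theta> / 2" "\<And>v. v \<noteq> x \<Longrightarrow> v \<noteq> y \<Longrightarrow> a1 v = a v"
    using xy(3) by (auto simp: a1_def)
  have fx: "\<theta> / 2 \<le> of_int (m x) + 1 - a x" and fy: "\<theta> / 2 \<le> a y - of_int (m y)"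
    using \<theta>(3)[of "\<lambda>\<theta>. of_int (m x) + 1 - a x - \<theta> / 2"] \<theta>(3)[of "\<lambda>\<theta>. a y - of_int (m y) - \<theta> / 2"]
    by (simp_all add: F_def)
  have sa: "sum a1 A = sum a A + (\<theta> / 2) * (of_bool (x \<in> A) - of_bool (y \<in> A))" if "A \<subseteq> V" for A
    unfolding a1_def using that D(3) by (intro sum_shift) (rule finite_subset)
  have b1: "boundary V w1 z A = boundary V w z A - \<theta> * of_bool ((x \<in> A) \<noteq> (y \<in> A))" if "A \<subseteq> V" for A
    unfolding w1_def by (rule boundary_minus_link[OF D(3) that xy(1,2)])
  have W1: "weighting w1" unfolding w1_def by (rule weighting_minus_link[OF D(4) \<theta>(2) xy(3)])
  have nor1: "normal V w1 z e a1"
    unfolding normal_def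
  proof (intro conjI allI impI)
    show "prefixed V w1 z e" using D(1) W1 by (simp add: prefixed_def)
    show "balanced V z e a1" using D(2) sa[of V] xy(1,2) by (simp add: balanced_def)
    fix A assume A: "A \<noteq> {}" "A \<subset> V"
    then have AV: "A \<subseteq> V" and finA: "finite A" using D(3) by (auto intro: finite_subset)
    note dA = D(6)[OF A]
    consider "(x \<in> A) = (y \<in> A)" | "x \<in> A" "y \<notin> A" "2 \<le> card A" | "y \<in> A" "x \<notin> A" "2 \<le> card A"
      | "x \<in> A" "y \<notin> A" "card A < 2" | "y \<in> A" "x \<notin> A" "card A < 2" by linarith
    then show "demand a1 A \<le> boundary V w1 z A"
    proof cases
      case 1
      then show ?thesis using dA b1[OF AV] sa[OF AV] by (simp add: demand_def)
    next
      case 2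
      then have "slack A 1 \<in> F" using A by (auto simp: F_def K_def)
      from \<theta>(3)[OF this] show ?thesis using 2 b1[OF AV] sa[OF AV] by (simp add: demand_def slack_def)
    next
      case 3
      then have "slack A (- 1) \<in> F" using A by (auto simp: F_def K_def)
      from \<theta>(3)[OF this] show ?thesis using 3 b1[OF AV] sa[OF AV] by (simp add: demand_def slack_def)
    next
      case 4
      then have "card A = 1" using finA A(1) card_gt_0_iff[of A] by linarith
      then have Ax: "A = {x}" using 4(1) by (auto simp: card_1_singleton_iff)
      have "int_dist (a x) = of_int (m x + 1) - a x" "int_dist (a1 x) = of_int (m x + 1) - a1 x"
        using xy(5) m[OF xy(1)] fx \<theta>(1) int_dist_below[of "m x + 1" "a x"] int_dist_below[of "m x + 1" "a1 x"]
        by (simp_all add: a1 m_def)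
      then show ?thesis using dA b1[OF AV] xy(3) unfolding Ax by (simp add: demand_def a1)
    next
      case 5
      then have "card A = 1" using finA A(1) card_gt_0_iff[of A] by linarith
      then have Ay: "A = {y}" using 5(1) by (auto simp: card_1_singleton_iff)
      have "int_dist (a y) = a y - of_int (m y)" "int_dist (a1 y) = a1 y - of_int (m y)"
        using xy(6) m[OF xy(2)] fy \<theta>(1) int_dist_above[of "m y" "a y"] int_dist_above[of "m y" "a1 y"]
        by (simp_all add: a1 m_def)
      then show ?thesis using dA b1[OF AV] xy(3) unfolding Ay by (simp add: demand_def a1)
    qed
  qed
  have "solvable V w1 e a1"
  proof (cases "\<theta> = w x y")
    case True
    let ?E = "{(u, v). u \<in> V \<and> v \<in> V \<and> 0 < w u v}" and ?E1 = "{(u, v). u \<in> V \<and> v \<in> V \<and> 0 < w1 u v}"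
    have "w1 u v \<le> w u v" for u v
      using mult_nonneg_nonneg[OF \<theta>(1) link_nonneg[of x y u v]] by (simp add: w1_def)
    then have "?E1 \<subseteq> ?E" by (auto intro: less_le_trans)
    moreover have "w1 x y = 0" using True xy(3) by (simp add: w1_def link_arrow_values)
    then have "(x, y) \<notin> ?E1" "(x, y) \<in> ?E" using xy by auto
    ultimately have "?E1 \<subset> ?E" by blast
    moreover have "finite ?E" by (rule finite_subset[of _ "V \<times> V"]) (use D(3) in auto)
    ultimately have "card ?E1 < card ?E" by (intro psubset_card_mono)
    then show ?thesis by (rule IH2[OF _ nor1])
  next
    case False
    then obtain f where f: "f \<in> F" "f \<theta> = 0" using \<theta>(4) by blast
    have red: "reducible V w1 z a1"
    proof -
      consider A where "f = slack A 1" "A \<in> K" "x \<in> A" "y \<notin> A" | A where "f = slack A (- 1)" "A \<in> K" "y \<in> A" "x \<notin> A"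
        | "f = (\<lambda>\<theta>. of_int (m x) + 1 - a x - \<theta> / 2)" | "f = (\<lambda>\<theta>. a y - of_int (m y) - \<theta> / 2)"
        using f(1) unfolding F_def by blast
      then show ?thesis
      proof cases
        case 1
        then have "A \<subseteq> V" by (auto simp: K_def)
        then have "boundary V w1 z A \<le> demand a1 A"
          using f(2) 1 b1[of A] sa[of A] by (simp add: slack_def demand_def)
        then show ?thesis using 1 unfolding reducible_def K_def by blast
      next
        case 2
        then have "A \<subseteq> V" by (auto simp: K_def)
        then have "boundary V w1 z A \<le> demand a1 A"
          using f(2) 2 b1[of A] sa[of A] by (simp add: slack_def demand_def)
        then show ?thesis using 2 unfolding reducible_def K_def by blast
      next
        case 3
        then have "a1 x = of_int (m x + 1)" using f(2) by (simp add: a1)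
        then show ?thesis unfolding reducible_def using xy(1) Ints_of_int by metis
      next
        case 4
        then have "a1 y = of_int (m y)" using f(2) by (simp add: a1)
        then show ?thesis unfolding reducible_def using xy(2) Ints_of_int by metis
      qed
    qed
    show ?thesis by (rule solvable_reducible[OF _ nor1 card2 red]) (rule IH)
  qed
  then obtain Y where Y: "\<forall>v\<in>V. \<bar>of_int (Y v) - a1 v\<bar> < 1" "routable V w1 (\<lambda>v. of_int (Y v) - a1 v + e v)"
    unfolding solvable_def by blast
  have "routable V w (\<lambda>v. of_int (Y v) - a v + e v)"
  \<comment> \<open>Half of the withheld weight \<theta> is sent from \<open>x\<close> to
    \<open>y\<close>, exactly undoing the change of \<open>a\<close>.\<close>
  proof (rule routable_restore_edge[OF Y(2)[unfolded w1_def] D(3) xy(1,2), where \<kappa> = "\<theta> / 2"])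
    show "2 * \<bar>\<theta> / 2\<bar> \<le> \<theta>" using \<theta>(1) by simp
    show "of_int (Y v) - a v + e v = of_int (Y v) - a1 v + e v + \<theta> / 2 * (of_bool (v = x) - of_bool (v = y))" for v
      by (simp add: a1_def)
  qed
  moreover have "\<bar>of_int (Y v) - a v\<bar> < 1" if v: "v \<in> V" for v
  proof (rule round_within[of "m v" _ "a1 v"])
    show "of_int (m v) \<le> a1 v" "a1 v \<le> of_int (m v) + 1"
      using m[OF v] fx fy a1(1,2) a1(3)[of v] \<theta>(1) by (cases "v = x"; cases "v = y"; force)+
  qed (use m[OF v] Y(1) v in auto)
  ultimately show ?thesis unfolding solvable_def by blast
qed

lemma sum_point: "finite A \<Longrightarrow> (\<Sum>v\<in>A. c * of_bool (v = u)) = (c * of_bool (u \<in> A) :: real)"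
  by (cases "u \<in> A") (simp_all add: of_bool_def sum.delta if_distrib cong: if_cong)

text \<open>Raising \<open>z u\<close> by 2\<delta> pays both for the changed inflow at
  \<open>u\<close> and for the demand of every set containing \<open>u\<close>, since
  \<open>int_dist\<close> is 1-Lipschitz. Only the conditions on \<open>V\<close> as a whole have to
  be supplied anew.\<close>

lemma normal_lower:
  assumes pre: "prefixed V w z e" and dem: "\<And>A. A \<noteq> {} \<Longrightarrow> A \<subset> V \<Longrightarrow> demand a A \<le> boundary V w z A"
    and int: "sum e V - sum a V \<in> \<int>" and u: "u \<in> V" and \<delta>: "0 \<le> \<delta>"
    and E: "\<bar>sum e V - \<delta>\<bar> < 1" and Z: "sum z V + 2 * \<delta> \<le> 5 + 2 * int_dist (sum e V - \<delta>)"
  shows "normal V w (\<lambda>v. z v + 2 * \<delta> * of_bool (v = u)) (\<lambda>v. e v - \<delta> * of_bool (v = u)) (\<lambda>v. a v - \<delta> * of_bool (v = u))"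
proof -
  have finV: "finite V" using pre by (simp add: prefixed_def)
  have sums: "(\<Sum>v\<in>A. f v + 2 * \<delta> * of_bool (v = u)) = sum f A + 2 * \<delta> * of_bool (u \<in> A)"
    "(\<Sum>v\<in>A. f v - \<delta> * of_bool (v = u)) = sum f A - \<delta> * of_bool (u \<in> A)" if "A \<subseteq> V" for A and f :: "'a \<Rightarrow> real"
    using sum_point[OF finite_subset[OF that finV], of "2 * \<delta>" u] sum_point[OF finite_subset[OF that finV], of \<delta> u]
    by (simp_all add: sum.distrib sum_subtractf)
  show ?thesis
    unfolding normal_def
  proof (intro conjI allI impI)
    have "2 * \<bar>e v - \<delta> * of_bool (v = u)\<bar> \<le> z v + 2 * \<delta> * of_bool (v = u)" if "v \<in> V" for v
      using that pre \<delta> double_abs_add_le[of "e u" "z u" "- \<delta>" "2 * \<delta>"] by (cases "v = u") (auto simp: prefixed_def)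
    then show "prefixed V w (\<lambda>v. z v + 2 * \<delta> * of_bool (v = u)) (\<lambda>v. e v - \<delta> * of_bool (v = u))"
      using pre by (simp add: prefixed_def)
    show "balanced V (\<lambda>v. z v + 2 * \<delta> * of_bool (v = u)) (\<lambda>v. e v - \<delta> * of_bool (v = u)) (\<lambda>v. a v - \<delta> * of_bool (v = u))"
      unfolding balanced_def sums[OF order_refl] using int u E Z by simp
    fix A assume A: "A \<noteq> {}" "A \<subset> V"
    then have AV: "A \<subseteq> V" by auto
    have "int_dist (sum a A - \<delta> * of_bool (u \<in> A)) \<le> int_dist (sum a A) + \<delta> * of_bool (u \<in> A)"
      using int_dist_Lipschitz[of "sum a A - \<delta> * of_bool (u \<in> A)" "sum a A"] \<delta> by (simp add: abs_mult)
    then show "demand (\<lambda>v. a v - \<delta> * of_bool (v = u)) A \<le> boundary V w (\<lambda>v. z v + 2 * \<delta> * of_bool (v = u)) A"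
      using dem[OF A] unfolding demand_def boundary_def sums[OF AV] by linarith
  qed
qed

lemma solvable_lower:
  assumes "solvable V w (\<lambda>v. e v - \<delta> * of_bool (v = u)) (\<lambda>v. a v - \<delta> * of_bool (v = u))"
    and "\<And>v. v \<in> V \<Longrightarrow> of_int (m v) < b v \<and> b v < of_int (m v) + 1"
    and "\<And>v. v \<in> V \<Longrightarrow> of_int (m v) \<le> a v \<and> a v \<le> of_int (m v) + 1"
    and "of_int (m u) \<le> a u - \<delta>" "0 \<le> \<delta>" "\<And>v. v \<in> V \<Longrightarrow> e v - a v = d v - b v"
  shows "solvable V w d b"
proof (rule solvable_reparam[OF assms(1)])
  fix v assume v: "v \<in> V"
  show "e v - \<delta> * of_bool (v = u) - (a v - \<delta> * of_bool (v = u)) = d v - b v" using assms(6)[OF v] by simp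
  show "of_int (m v) < b v \<and> b v < of_int (m v) + 1 \<and> of_int (m v) \<le> a v - \<delta> * of_bool (v = u) \<and>
      a v - \<delta> * of_bool (v = u) \<le> of_int (m v) + 1"
    using assms(2,3)[OF v] assms(4,5) by (cases "v = u") auto
qed

text \<open>Choose \<open>u\<close> away from what makes the instance reducible: different from the
  integral vertex, or outside the tight set.\<close>

lemma reducible_lower:
  assumes "reducible V w z a" "finite V" "2 \<le> card V"
  shows "\<exists>u\<in>V. reducible V w (\<lambda>v. z v + 2 * \<delta> * of_bool (v = u)) (\<lambda>v. a v - \<delta> * of_bool (v = u))"
proof -
  consider x where "x \<in> V" "a x \<in> \<int>" | S where "S \<subset> V" "2 \<le> card S" "boundary V w z S \<le> demand a S"
    using assms(1) unfolding reducible_def by blast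
  then show ?thesis
  proof cases
    case 1
    have "V \<noteq> {x}" using assms(3) by auto
    then obtain u where u: "u \<in> V" "u \<noteq> x" using 1(1) by blast
    then show ?thesis using 1 unfolding reducible_def by (intro bexI[of _ u] disjI1 bexI[of _ x]) auto
  next
    case 2
    then obtain u where u: "u \<in> V" "u \<notin> S" by blast
    then have "sum (\<lambda>v. f v + c * of_bool (v = u)) S = sum f S" for f and c :: real
      by (intro sum.cong) auto
    moreover have "sum (\<lambda>v. f v - c * of_bool (v = u)) S = sum f S" for f and c :: real
      using u by (intro sum.cong) auto
    ultimately have "boundary V w (\<lambda>v. z v + 2 * \<delta> * of_bool (v = u)) S \<le> demand (\<lambda>v. a v - \<delta> * of_bool (v = u)) S"
      using 2(3) unfolding boundary_def demand_def by simp
    then show ?thesis using 2 u unfolding reducible_def by blast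
  qed
qed

text \<open>
  Here \<open>a\<close> is raised at all vertices at the expense of the terminal edges, which are used up to
  capacity at \<open>\<theta> = 1\<close>. If nothing becomes tight or integral before the inflow exceeds the fractional
  part of \<open>a\<close> at a chosen vertex \<open>x\<close> by \<open>1/2\<close>, or before \<open>\<theta> = 1\<close>, then \<open>a x\<close> is lowered to an integer
  instead. When a set becomes tight while the total inflow is already at least 1, lowering \<open>a\<close> by \<open>1/2\<close>
  at a vertex outside that set restores a normal instance.
\<close>

lemma solvable_upper_half:
  fixes V :: "'v set"
  assumes IH: "\<And>(V' :: 'v set) w z e a. card V' < card V \<Longrightarrow> normal V' w z e a \<Longrightarrow> solvable V' w e a"
    and nor: "normal V w z e a" and card2: "2 \<le> card V" and nint: "\<And>v. v \<in> V \<Longrightarrow> a v \<notin> \<int>"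
    and half: "\<And>v. v \<in> V \<Longrightarrow> 1/2 \<le> a v - of_int \<lfloor>a v\<rfloor>"
  shows "solvable V w e a"
proof -
  note D = normalD[OF nor]
  obtain x where x: "x \<in> V" using card2 by fastforce
  define m where "m v = \<lfloor>a v\<rfloor>" for v
  have m: "of_int (m v) < a v \<and> a v < of_int (m v) + 1" if "v \<in> V" for v
  proof -
    have "of_int (m v) \<noteq> a v" using nint[OF that] by (metis Ints_of_int)
    then show ?thesis unfolding m_def by linarith
  qed
  have mh: "of_int (m v) + 1/2 \<le> a v" if "v \<in> V" for v using half[OF that] by (simp add: m_def)
  define g where "g v = z v / 2 - e v" for v
  have g: "0 \<le> g v" if "v \<in> V" for v using D(5)[OF that] by (simp add: g_def)
  define a1 where "a1 \<theta> = (\<lambda>v. a v + \<theta> / 2 * g v)" for \<theta>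
  define e1 where "e1 \<theta> = (\<lambda>v. e v + \<theta> / 2 * g v)" for \<theta>
  define z1 where "z1 \<theta> = (\<lambda>v. z v - \<theta> * g v)" for \<theta>
  define G where "G = sum g V"
  define E where "E \<theta> = sum e V + \<theta> / 2 * G" for \<theta>
  define \<alpha> where "\<alpha> \<theta> = a1 \<theta> x - of_int (m x)" for \<theta>
  have sa: "sum (a1 \<theta>) A = sum a A + \<theta> / 2 * sum g A" for \<theta> A
    by (simp add: a1_def sum.distrib sum_distrib_left)
  have sz: "sum (z1 \<theta>) A = sum z A - \<theta> * sum g A" for \<theta> A
    by (simp add: z1_def sum_subtractf sum_distrib_left)
  have se: "sum (e1 \<theta>) V = E \<theta>" for \<theta>
    by (simp add: e1_def E_def G_def sum.distrib sum_distrib_left)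
  have GZ: "G = sum z V / 2 - sum e V"
    by (simp add: G_def g_def sum_subtractf sum_divide_distrib)
  have gx: "0 \<le> G - g x"
    unfolding G_def using D(3) x g by (subst sum.remove[of _ x]) (auto intro: sum_nonneg)
  have Zge: "0 \<le> sum z V + 2 * sum e V"
  proof -
    have "0 \<le> (\<Sum>v\<in>V. z v + 2 * e v)" using D(5) by (intro sum_nonneg) fastforce
    then show ?thesis by (simp add: sum.distrib sum_distrib_left)
  qed
  \<comment> \<open>\<open>sum z V + 2 * sum e V\<close> does not depend on \<theta>, so the bound 7
    holds throughout; it yields the terminal bound after lowering at \<open>u\<close> by 1/2, and
    after lowering at \<open>x\<close> when \<open>h\<close> is 1/2.\<close>
  have Zle: "sum z V + 2 * sum e V \<le> 7"
  proof -
    have "int_dist (sum e V) \<le> 1 - sum e V" using int_dist_le[of "sum e V" 1] D(7) by simp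
    then show ?thesis using D(9) by simp
  qed
  \<comment> \<open>This is the total inflow that would remain if \<open>a x\<close> were now
    lowered to the integer \<open>m x\<close>.\<close>
  define h where "h \<theta> = E \<theta> - \<alpha> \<theta>" for \<theta>
  have h: "2 * h \<theta> = 2 * h 0 + \<theta> * (G - g x)" for \<theta>
    by (simp add: h_def E_def \<alpha>_def a1_def field_simps)
  have h0: "h 0 < 1/2" using D(7) mh[OF x] by (simp add: h_def E_def \<alpha>_def a1_def)
  have "\<exists>T. 0 < T \<and> T \<le> 1 \<and> h T \<le> 1/2 \<and> (T = 1 \<or> h T = 1/2)"
  proof (cases "h 1 \<le> 1/2")
    case True
    then show ?thesis by (intro exI[of _ 1]) simp
  next
    case False
    have h1: "2 * h 1 = 2 * h 0 + (G - g x)" using h[of 1] by simp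
    have pos: "0 < G - g x" using False h0 h1 by linarith
    have le: "2 * (1/2 - h 0) \<le> G - g x" using False h1 by (simp add: field_simps)
    define T where "T = 2 * (1/2 - h 0) / (G - g x)"
    have "T * (G - g x) = 2 * (1/2 - h 0)" using pos by (simp add: T_def)
    then have "h T = 1/2" using h[of T] by simp
    moreover have "0 < T" "T \<le> 1" using le pos h0 by (simp_all add: T_def divide_le_eq)
    ultimately show ?thesis by (intro exI[of _ T]) simp
  qed
  then obtain T where T: "0 < T" "T \<le> 1" "h T \<le> 1/2" "T = 1 \<or> h T = 1/2" by blast
  have hT: "h \<theta> < 1/2" if "0 \<le> \<theta>" "\<theta> < T" for \<theta>
  proof (cases "G - g x = 0")
    case True
    then show ?thesis using h[of \<theta>] h0 by simp
  next
    case False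
    then have "\<theta> * (G - g x) < T * (G - g x)" using gx that by (intro mult_strict_right_mono) auto
    then show ?thesis using h[of \<theta>] h[of T] T(3) by linarith
  qed
  define K where "K = {A. A \<subset> V \<and> 2 \<le> card A}"
  define slack where "slack A \<theta> = boundary V w (z1 \<theta>) A - demand (a1 \<theta>) A" for A \<theta>
  define F where "F = slack ` K \<union> (\<lambda>v \<theta>. of_int (m v) + 1 - a1 \<theta> v) ` V"
  have finP: "finite (Pow V)" using D(3) by simp
  have "finite K" by (rule finite_subset[OF _ finP]) (force simp: K_def)
  then have finF: "finite F" using D(3) by (simp add: F_def)
  have z0: "z1 0 = z" "a1 0 = a" by (simp_all add: z1_def a1_def)
  have cf: "continuous_on {0..T} f" if f: "f \<in> F" for f
  proof -
    have "continuous_on {0..T} (slack A)" for A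
      unfolding slack_def demand_def boundary_def sa sz
      by (intro continuous_intros continuous_on_int_dist_comp) simp_all
    moreover have "continuous_on {0..T} (\<lambda>\<theta>. of_int (m v) + 1 - a1 \<theta> v)" for v
      unfolding a1_def by (intro continuous_intros) simp_all
    ultimately show ?thesis using f unfolding F_def by blast
  qed
  have f0: "0 \<le> f 0" if f: "f \<in> F" for f
  proof -
    have "0 \<le> slack A 0" if "A \<in> K" for A
      using D(6)[of A] that by (force simp: slack_def K_def z0)
    moreover have "0 \<le> of_int (m v) + 1 - a1 0 v" if "v \<in> V" for v using m[OF that] by (simp add: z0)
    ultimately show ?thesis using f unfolding F_def by blast
  qed
  have "\<exists>\<theta>. 0 \<le> \<theta> \<and> \<theta> \<le> T \<and> (\<forall>f\<in>F. 0 \<le> f \<theta>) \<and> (\<theta> = T \<or> \<theta> < T \<and> (\<exists>f\<in>F. f \<theta> = 0))"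
    by (rule first_zero[of F T]) (use finF T(1) cf f0 in \<open>blast intro: less_imp_le\<close>)+
  then obtain \<theta> where \<theta>: "0 \<le> \<theta>" "\<theta> \<le> T" "\<And>f. f \<in> F \<Longrightarrow> 0 \<le> f \<theta>"
    "\<theta> = T \<or> \<theta> < T \<and> (\<exists>f\<in>F. f \<theta> = 0)" by blast
  have gth: "0 \<le> \<theta> * g v" if "v \<in> V" for v using \<theta>(1) g[OF that] by simp
  have a1m: "of_int (m v) + 1/2 \<le> a1 \<theta> v \<and> a1 \<theta> v \<le> of_int (m v) + 1" if "v \<in> V" for v
  proof -
    have "0 \<le> of_int (m v) + 1 - a1 \<theta> v"
      using \<theta>(3)[of "\<lambda>\<theta>. of_int (m v) + 1 - a1 \<theta> v"] that by (auto simp: F_def)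
    then show ?thesis using mh[OF that] gth[OF that] by (simp add: a1_def)
  qed
  have ea: "e1 \<theta> v - a1 \<theta> v = e v - a v" for v by (simp add: e1_def a1_def)
  have pre1: "prefixed V w (z1 \<theta>) (e1 \<theta>)"
    unfolding prefixed_def
  proof (intro conjI ballI D(3,4))
    fix v assume v: "v \<in> V"
    have "\<theta> * g v \<le> g v" using \<theta>(1,2) T(2) g[OF v] by (intro mult_left_le_one_le) auto
    moreover have "e1 \<theta> v = e v + \<theta> * g v / 2" "z1 \<theta> v = z v - \<theta> * g v"
      by (simp_all add: e1_def z1_def)
    moreover have "2 * g v = z v - 2 * e v" by (simp add: g_def)
    ultimately show "2 * \<bar>e1 \<theta> v\<bar> \<le> z1 \<theta> v" using gth[OF v] D(5)[OF v] by linarith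
  qed
  have dem1: "demand (a1 \<theta>) A \<le> boundary V w (z1 \<theta>) A" if A: "A \<noteq> {}" "A \<subset> V" for A
  proof (cases "2 \<le> card A")
    case True
    then have "slack A \<in> F" using A by (auto simp: F_def K_def)
    from \<theta>(3)[OF this] show ?thesis by (simp add: slack_def)
  next
    case False
    have "finite A" using A D(3) by (auto intro: finite_subset)
    then have "card A = 1" using False A(1) card_gt_0_iff[of A] by linarith
    then obtain v where Av: "A = {v}" by (auto simp: card_1_singleton_iff)
    then have v: "v \<in> V" using A by auto
    have "int_dist (a v) = of_int (m v + 1) - a v" "int_dist (a1 \<theta> v) = of_int (m v + 1) - a1 \<theta> v"
      using m[OF v] mh[OF v] a1m[OF v] int_dist_below[of "m v + 1" "a v"] int_dist_below[of "m v + 1" "a1 \<theta> v"]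
      by simp_all
    then show ?thesis using D(6)[OF A] unfolding Av by (simp add: demand_def boundary_def z1_def a1_def)
  qed
  have int1: "sum (e1 \<theta>) V - sum (a1 \<theta>) V \<in> \<int>"
    using D(8) by (simp add: sa se E_def G_def)
  have ZE: "sum (z1 \<theta>) V + 2 * sum (e1 \<theta>) V = sum z V + 2 * sum e V"
    by (simp add: sz se E_def G_def)
  have Eth: "E \<theta> = h \<theta> + \<alpha> \<theta>" by (simp add: h_def)
  have \<alpha>1: "1/2 \<le> \<alpha> \<theta>" "\<alpha> \<theta> \<le> 1" using a1m[OF x] by (simp_all add: \<alpha>_def)
  have m1: "of_int (m v) \<le> a1 \<theta> v \<and> a1 \<theta> v \<le> of_int (m v) + 1" if "v \<in> V" for v using a1m[OF that] by simp
  have Emono: "sum e V \<le> E \<theta>"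
  proof -
    have "0 \<le> G" unfolding G_def using g by (rule sum_nonneg)
    then show ?thesis using \<theta>(1) by (simp add: E_def)
  qed
  show ?thesis
  proof (cases "reducible V w (z1 \<theta>) (a1 \<theta>) \<and> E \<theta> < 1")
    case True
    \<comment> \<open>The total terminal weight falls by \<theta>G while the inflow changes by
      \<theta>G/2, so the upper bound on the terminal weight is preserved.\<close>
    have "int_dist (sum e V) \<le> int_dist (E \<theta>) + \<bar>sum e V - E \<theta>\<bar>" by (rule int_dist_Lipschitz)
    then have "2 * int_dist (sum e V) \<le> 2 * int_dist (E \<theta>) + \<theta> * G"
      using Emono by (simp add: E_def)
    then have "sum (z1 \<theta>) V \<le> 5 + 2 * int_dist (E \<theta>)" using D(9) sz[of \<theta> V] G_def by simp
    then have "balanced V (z1 \<theta>) (e1 \<theta>) (a1 \<theta>)"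
      using True int1 Emono D(7) by (auto simp: balanced_def se)
    then have nor1: "normal V w (z1 \<theta>) (e1 \<theta>) (a1 \<theta>)" using pre1 dem1 by (simp add: normal_def)
    have "solvable V w (e1 \<theta>) (a1 \<theta>)"
      by (rule solvable_reducible[OF _ nor1 card2]) (use True IH in blast)+
    then show ?thesis by (rule solvable_reparam[where m = m]) (use ea m m1 in blast)+
  next
    case False
    show ?thesis
    proof (cases "\<theta> < T")
      case True
      then obtain f where f: "f \<in> F" "f \<theta> = 0" using \<theta>(4) by blast
      have red: "reducible V w (z1 \<theta>) (a1 \<theta>)"
      proof -
        consider A where "f = slack A" "A \<in> K" | v where "v \<in> V" "f = (\<lambda>\<theta>. of_int (m v) + 1 - a1 \<theta> v)"
          using f(1) unfolding F_def by blast
        then show ?thesis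
        proof cases
          case 1
          then show ?thesis using f(2) unfolding reducible_def K_def slack_def by fastforce
        next
          case 2
          then have "a1 \<theta> v = of_int (m v + 1)" using f(2) by simp
          then show ?thesis unfolding reducible_def using 2(1) Ints_of_int by metis
        qed
      qed
      obtain u where u: "u \<in> V" "reducible V w (\<lambda>v. z1 \<theta> v + 2 * (1/2) * of_bool (v = u)) (\<lambda>v. a1 \<theta> v - 1/2 * of_bool (v = u))"
        using reducible_lower[OF red D(3) card2] by blast
      \<comment> \<open>Reducibility with inflow below 1 has been dealt with; the upper bound
        combines \<open>h < 1/2\<close> with \<open>\<alpha> \<le> 1\<close>. After lowering by 1/2
        the inflow lies in [1/2, 1), and the terminal bound follows from 7 without slack.\<close>
      have E1: "1 \<le> E \<theta>" "E \<theta> < 3/2" using False red hT[OF \<theta>(1) True] Eth \<alpha>1 by auto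
      then have "int_dist (E \<theta> - 1/2) = 3/2 - E \<theta>" using int_dist_below[of 1 "E \<theta> - 1/2"] by simp
      then have nor1: "normal V w (\<lambda>v. z1 \<theta> v + 2 * (1/2) * of_bool (v = u)) (\<lambda>v. e1 \<theta> v - 1/2 * of_bool (v = u))
          (\<lambda>v. a1 \<theta> v - 1/2 * of_bool (v = u))"
        using E1 ZE Zle by (intro normal_lower pre1 dem1 int1 u(1)) (simp_all add: se)
      have "solvable V w (\<lambda>v. e1 \<theta> v - 1/2 * of_bool (v = u)) (\<lambda>v. a1 \<theta> v - 1/2 * of_bool (v = u))"
        by (rule solvable_reducible[OF _ nor1 card2 u(2)]) (rule IH)
      then show ?thesis
        by (rule solvable_lower[where m = m]) (use m m1 a1m[OF u(1)] ea in auto)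
    next
      case nT: False
      then have \<theta>T: "\<theta> = T" using \<theta>(2) by simp
      have Elow: "- 1 < E \<theta> - \<alpha> \<theta>" and Zup: "sum (z1 \<theta>) V + 2 * \<alpha> \<theta> \<le> 5 + 2 * int_dist (E \<theta> - \<alpha> \<theta>)"
      proof -
        have "- 1 < E \<theta> - \<alpha> \<theta> \<and> sum (z1 \<theta>) V + 2 * \<alpha> \<theta> \<le> 5 + 2 * int_dist (E \<theta> - \<alpha> \<theta>)"
          using T(4)
        proof
          assume "h T = 1/2"
          then have hh: "E \<theta> - \<alpha> \<theta> = 1/2" using \<theta>T by (simp add: h_def)
          have "int_dist (E \<theta> - \<alpha> \<theta>) = 1/2" unfolding hh using int_dist_above[of 0 "1/2"] by simp
          then show ?thesis using hh ZE Zle unfolding se by linarith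
        next
          assume "T = 1"
          then have "\<theta> = 1" using \<theta>T by simp
          then have E4: "E \<theta> = (sum z V + 2 * sum e V) / 4" by (simp add: E_def GZ field_simps)
          then have Z2: "sum (z1 \<theta>) V = 2 * E \<theta>" using ZE by (simp add: se)
          \<comment> \<open>Since the inflow is nonnegative at \<theta> = 1 and \<alpha> is at most
            1, failure would mean zero inflow and an integral value at \<open>x\<close>, which is
            the case treated first.\<close>
          have "- 1 < E \<theta> - \<alpha> \<theta>"
          proof (rule ccontr)
            assume "\<not> - 1 < E \<theta> - \<alpha> \<theta>"
            moreover have "0 \<le> E \<theta>" using E4 Zge by simp
            ultimately have "\<alpha> \<theta> = 1" "E \<theta> < 1" using \<alpha>1 by simp_all
            then have "a1 \<theta> x = of_int (m x + 1)" by (simp add: \<alpha>_def)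
            then have "reducible V w (z1 \<theta>) (a1 \<theta>)" unfolding reducible_def using x Ints_of_int by metis
            then show False using False \<open>E \<theta> < 1\<close> by blast
          qed
          \<comment> \<open>If E is at least \<alpha>, this reduces to 4\<alpha> \<le> 5; otherwise
            the left side is already below 4\<alpha>.\<close>
          moreover have "2 * E \<theta> + 2 * \<alpha> \<theta> \<le> 5 + 2 * int_dist (E \<theta> - \<alpha> \<theta>)"
          proof (cases "0 \<le> E \<theta> - \<alpha> \<theta>")
            case True
            then have "int_dist (E \<theta> - \<alpha> \<theta>) = E \<theta> - \<alpha> \<theta>"
              using int_dist_above[of 0 "E \<theta> - \<alpha> \<theta>"] T(3) \<theta>T by (simp add: h_def)
            then show ?thesis using \<alpha>1 by simp
          next
            case False
            then show ?thesis using \<alpha>1 int_dist_nonneg[of "E \<theta> - \<alpha> \<theta>"] by linarith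
          qed
          ultimately show ?thesis using Z2 by simp
        qed
        then show "- 1 < E \<theta> - \<alpha> \<theta>" "sum (z1 \<theta>) V + 2 * \<alpha> \<theta> \<le> 5 + 2 * int_dist (E \<theta> - \<alpha> \<theta>)" by blast+
      qed
      have "E \<theta> - \<alpha> \<theta> \<le> 1/2" using T(3) \<theta>T by (simp add: h_def)
      then have nor1: "normal V w (\<lambda>v. z1 \<theta> v + 2 * \<alpha> \<theta> * of_bool (v = x)) (\<lambda>v. e1 \<theta> v - \<alpha> \<theta> * of_bool (v = x))
          (\<lambda>v. a1 \<theta> v - \<alpha> \<theta> * of_bool (v = x))"
        using Elow Zup \<alpha>1 by (intro normal_lower pre1 dem1 int1 x) (simp_all add: se)
      have "a1 \<theta> x - \<alpha> \<theta> * of_bool (x = x) = of_int (m x)" by (simp add: \<alpha>_def)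
      then have "a1 \<theta> x - \<alpha> \<theta> * of_bool (x = x) \<in> \<int>" by simp
      then have "solvable V w (\<lambda>v. e1 \<theta> v - \<alpha> \<theta> * of_bool (v = x)) (\<lambda>v. a1 \<theta> v - \<alpha> \<theta> * of_bool (v = x))"
        by (intro solvable_integral[OF _ nor1 card2 x]) (rule IH)
      then show ?thesis
        by (rule solvable_lower[where m = m]) (use m m1 \<alpha>1 ea in \<open>auto simp: \<alpha>_def\<close>)
    qed
  qed
qed

section \<open>Induction proving the rounding theorem\<close>

lemma solvable_normal_aux:
  fixes V :: "'v set"
  assumes IH: "\<And>(V' :: 'v set) w z e a. card V' < card V \<Longrightarrow> normal V' w z e a \<Longrightarrow> solvable V' w e a"
    and card2: "2 \<le> card V"
  shows "normal V w z e a \<Longrightarrow> solvable V w e a"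
proof (induction "card {(u, v). u \<in> V \<and> v \<in> V \<and> 0 < w u v}" arbitrary: w z e a rule: less_induct)
  case less
  note D = normalD[OF less.prems]
  define P where "P = {v \<in> V. 1/2 \<le> a v - of_int \<lfloor>a v\<rfloor>}"
  consider x where "x \<in> V" "a x \<in> \<int>" | "\<And>v. v \<in> V \<Longrightarrow> a v \<notin> \<int>" "P = V"
    | "\<And>v. v \<in> V \<Longrightarrow> a v \<notin> \<int>" "P = {}" | "\<And>v. v \<in> V \<Longrightarrow> a v \<notin> \<int>" "P \<noteq> {}" "P \<subset> V"
    unfolding P_def by blast
  then show ?case
  proof cases
    case 1
    show ?thesis by (rule solvable_integral[OF _ less.prems card2 1]) (rule IH)
  next
    case 2
    then have "1/2 \<le> a v - of_int \<lfloor>a v\<rfloor>" if "v \<in> V" for v using that by (auto simp: P_def)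
    then show ?thesis by (intro solvable_upper_half[OF _ less.prems card2 2(1)]) (rule IH)
  next
    case 3
    \<comment> \<open>Negating \<open>a\<close> and \<open>e\<close> turns fractional parts below
      1/2 into fractional parts above 1/2.\<close>
    have nint: "- a v \<notin> \<int>" if "v \<in> V" for v
      using 3(1)[OF that] Ints_minus[of "- a v"] by auto
    have half: "1/2 \<le> - a v - of_int \<lfloor>- a v\<rfloor>" if "v \<in> V" for v
    proof -
      have "a v - of_int \<lfloor>a v\<rfloor> < 1/2" using 3(2) that by (auto simp: P_def)
      moreover have "of_int \<lfloor>- a v\<rfloor> \<le> - of_int \<lfloor>a v\<rfloor> - (1::real)"
      proof -
        have "a v \<noteq> of_int \<lfloor>a v\<rfloor>" using 3(1)[OF that] by (metis Ints_of_int)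
        then have "\<lfloor>a v\<rfloor> + 1 \<le> \<lceil>a v\<rceil>" by (simp add: ceiling_altdef)
        then have "\<lfloor>- a v\<rfloor> \<le> - \<lfloor>a v\<rfloor> - 1" by (simp add: floor_minus)
        then have "(of_int \<lfloor>- a v\<rfloor> :: real) \<le> of_int (- \<lfloor>a v\<rfloor> - 1)" by (simp only: of_int_le_iff)
        then show ?thesis by simp
      qed
      ultimately show ?thesis by linarith
    qed
    have "solvable V w (\<lambda>v. - e v) (\<lambda>v. - a v)"
      by (intro solvable_upper_half[OF _ normal_uminus[OF less.prems] card2 nint half]) (rule IH)
    then show ?thesis by (rule solvable_uminus)
  next
    case 4
    have VP: "V - P \<noteq> {}" "V - P \<subset> V" "V - (V - P) = P" using 4(2,3) by auto
    \<comment> \<open>Without an edge between the two sides, each would need terminal weight at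
      least 5, while the terminal offers at most 6 in total.\<close>
    have "\<exists>x\<in>P. \<exists>y\<in>V - P. 0 < w x y"
    proof (rule ccontr)
      assume "\<not> ?thesis"
      then have "w x y \<le> 0" if "x \<in> P" "y \<in> V - P" for x y using that by (meson not_le)
      then have "cut_weight w P (V - P) \<le> 0" unfolding cut_weight_def by (intro sum_nonpos) blast
      moreover have "cut_weight w (V - P) P = cut_weight w P (V - P)" by (rule cut_commute[OF D(4)])
      moreover have "sum z P + sum z (V - P) = sum z V"
        using sum.subset_diff[of P V z] 4(3) D(3) by auto
      moreover have "demand a P \<le> cut_weight w P (V - P) + sum z P"
        using D(6)[OF 4(2,3)] by (simp add: boundary_def)
      moreover have "demand a (V - P) \<le> cut_weight w (V - P) P + sum z (V - P)"
        using D(6)[OF VP(1,2)] unfolding boundary_def VP(3) .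
      ultimately show False
        using D(9) int_dist_le_half[of "sum e V"] int_dist_nonneg[of "sum a P"] int_dist_nonneg[of "sum a (V - P)"]
        unfolding demand_def by linarith
    qed
    then obtain x y where xy: "x \<in> P" "y \<in> V" "y \<notin> P" "0 < w x y" by blast
    have x: "x \<in> V" "x \<noteq> y" "1/2 \<le> a x - of_int \<lfloor>a x\<rfloor>" "a y - of_int \<lfloor>a y\<rfloor> \<le> 1/2"
      using xy by (auto simp: P_def)
    show ?thesis
      by (rule solvable_opposite[OF _ _ less.prems 4(1) x(1) xy(2) x(2) xy(4) x(3,4)])
        (rule IH less.hyps; assumption)+
  qed
qed

lemma solvable_normal:
  assumes "normal V w z e a"
  shows "solvable V w e a"
  using assms
proof (induction "card V" arbitrary: V w z e a rule: less_induct)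
  case less
  note D = normalD[OF less.prems]
  consider "2 \<le> card V" | "V = {}" | x where "V = {x}"
  proof (cases "2 \<le> card V")
    case False
    then have "card V = 0 \<or> card V = 1" by linarith
    then show ?thesis using that(2,3) D(3) by (auto simp: card_1_singleton_iff)
  qed (rule that(1))
  then show ?case
  proof cases
    case 1
    show ?thesis by (rule solvable_normal_aux[OF _ 1 less.prems]) (rule less.hyps)
  next
    case 2
    then show ?thesis by (auto simp: solvable_def routable_def)
  next
    case 3
    obtain i where i: "a x - e x = of_int i"
      using Ints_minus[OF D(8)] 3 by (auto elim: Ints_cases)
    have "routable V w (\<lambda>v. of_int i - a v + e v)"
      unfolding routable_def 3 using i weightingD(2)[OF D(4)] by (intro exI[of _ "\<lambda>u v. 0"]) auto
    moreover have "\<bar>of_int i - a v\<bar> < 1" if "v \<in> V" for v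
      using that D(7) i[symmetric] 3 by simp
    ultimately show ?thesis unfolding solvable_def by (intro exI[of _ "\<lambda>v. i"]) blast
  qed
qed

text \<open>With no terminal weight, cuts of size 6 = 5 + 2 (1/2) meet every possible demand; the
  flow obtained then bounds the deviation on each set by half its cut.\<close>

lemma cut_rounding:
  assumes "finite V" "weighting w" "\<And>A. A \<noteq> {} \<Longrightarrow> A \<subset> V \<Longrightarrow> 6 \<le> cut_weight w A (V - A)" "sum a V \<in> \<int>"
  shows "\<exists>y :: 'v \<Rightarrow> int. (\<forall>v\<in>V. \<bar>of_int (y v) - a v\<bar> < 1) \<and>
    (\<forall>S\<subseteq>V. 2 * \<bar>\<Sum>v\<in>S. of_int (y v) - a v\<bar> \<le> cut_weight w S (V - S))"
proof -
  have "demand a A \<le> boundary V w (\<lambda>v. 0) A" if "A \<noteq> {}" "A \<subset> V" for A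
    using assms(3)[OF that] int_dist_le_half[of "sum a A"] by (simp add: demand_def boundary_def)
  moreover have "balanced V (\<lambda>v. 0) (\<lambda>v. 0) a" using Ints_minus[OF assms(4)] by (simp add: balanced_def)
  ultimately have "normal V w (\<lambda>v. 0) (\<lambda>v. 0) a"
    using assms(1,2) by (simp add: normal_def prefixed_def)
  from solvable_normal[OF this] obtain y where y: "\<forall>v\<in>V. \<bar>of_int (y v) - a v\<bar> < 1"
    "routable V w (\<lambda>v. of_int (y v) - a v)" by (auto simp: solvable_def)
  have "2 * \<bar>\<Sum>v\<in>S. of_int (y v) - a v\<bar> \<le> cut_weight w S (V - S)" if "S \<subseteq> V" for S
    using routable_cut_bound[OF y(2) assms(1) that] .
  then show ?thesis using y(1) by blast
qed

section \<open>Equal subset sums\<close>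

text \<open>
  For each partial sum \<open>A\<close> of \<open>a\<close> take the largest partial sum \<open>B \<le> A\<close> of \<open>b\<close>; the \<open>k + 1\<close> differences
  \<open>A - B\<close> lie in \<open>{0..<k}\<close>, so two of them agree.
\<close>

lemma equal_partial_sums:
  fixes a b :: "nat \<Rightarrow> nat"
  assumes a: "\<And>i. i < k \<Longrightarrow> 0 < a i" and b: "\<And>i. i < k \<Longrightarrow> 0 < b i \<and> b i \<le> k"
    and "0 < k" and le: "sum a {..<k} \<le> sum b {..<k}"
  shows "\<exists>i i' j j'. i < i' \<and> i' \<le> k \<and> j < j' \<and> j' \<le> k \<and> sum a {i..<i'} = sum b {j..<j'}"
proof -
  define A where "A i = sum a {..<i}" for i
  define B where "B i = sum b {..<i}" for i
  have A_mono: "A i + sum a {i..<j} = A j" and B_mono: "B i + sum b {i..<j} = B j" if "i \<le> j" for i j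
    using sum.atLeastLessThan_concat[of 0 i j a] sum.atLeastLessThan_concat[of 0 i j b] that
    by (simp_all add: A_def B_def atLeast0LessThan)
  have "\<exists>j\<le>k. B j \<le> A i \<and> A i < B j + k" if i: "i \<le> k" for i
  proof -
    let ?J = "{j. j \<le> k \<and> B j \<le> A i}"
    have fin: "finite ?J" by simp
    have "0 \<in> ?J" by (simp add: B_def)
    then have j: "Max ?J \<in> ?J" using Max_in[OF fin] by blast
    have "A i < B (Max ?J) + k"
    proof (cases "Max ?J = k")
      case True
      have "A i \<le> A k" "A k \<le> B k" using A_mono[OF i] le by (simp_all add: A_def B_def)
      then show ?thesis using True assms(3) by simp
    next
      case False
      then have lt: "Max ?J < k" using j by simp
      have "Suc (Max ?J) \<notin> ?J"
      proof
        assume "Suc (Max ?J) \<in> ?J"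
        from Max_ge[OF fin this] show False by simp
      qed
      then have "A i < B (Suc (Max ?J))" using lt by simp
      then show ?thesis using b[OF lt] by (simp add: B_def)
    qed
    then show ?thesis using j by blast
  qed
  then obtain f where f: "\<And>i. i \<le> k \<Longrightarrow> f i \<le> k \<and> B (f i) \<le> A i \<and> A i < B (f i) + k" by metis
  have "(\<lambda>i. A i - B (f i)) ` {..k} \<subseteq> {..<k}" using f by fastforce
  then have "card ((\<lambda>i. A i - B (f i)) ` {..k}) \<le> card {..<k}" by (rule card_mono[OF finite_lessThan])
  then have "\<not> inj_on (\<lambda>i. A i - B (f i)) {..k}" by (intro pigeonhole) simp
  then obtain i i' where i: "i < i'" "i' \<le> k" "A i - B (f i) = A i' - B (f i')"
    unfolding inj_on_def by (metis atMost_iff linorder_neqE_nat)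
  have "0 < sum a {i..<i'}" using i a by (intro sum_pos) auto
  moreover have sums: "sum a {i..<i'} + B (f i) = B (f i')"
    using A_mono[of i i'] i f[of i] f[of i'] by linarith
  ultimately have "B (f i) < B (f i')" by linarith
  then have fi: "f i < f i'" using B_mono[of "f i'" "f i"] by (metis le_add1 not_le)
  then have "sum a {i..<i'} = sum b {f i..<f i'}" using B_mono[of "f i" "f i'"] sums by simp
  then show ?thesis using i fi f[of i'] by blast
qed

lemma equal_subset_sums_aux:
  fixes c :: "'v \<Rightarrow> nat"
  assumes "finite P" "finite Q" "k = card P" "k = card Q" "0 < k"
    and c: "\<And>v. v \<in> P \<union> Q \<Longrightarrow> 0 < c v \<and> c v \<le> k" and le: "sum c P \<le> sum c Q"
  shows "\<exists>P'\<subseteq>P. \<exists>Q'\<subseteq>Q. P' \<noteq> {} \<and> Q' \<noteq> {} \<and> sum c P' = sum c Q'"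
proof -
  obtain f where f: "bij_betw f {..<k} P" using ex_bij_betw_nat_finite[OF assms(1)] assms(3) by (auto simp: atLeast0LessThan)
  obtain g where g: "bij_betw g {..<k} Q" using ex_bij_betw_nat_finite[OF assms(2)] assms(4) by (auto simp: atLeast0LessThan)
  have fg: "f i \<in> P" "g i \<in> Q" if "i < k" for i using that f g by (auto simp: bij_betw_def)
  have "sum (c \<circ> f) {..<k} = sum c P" "sum (c \<circ> g) {..<k} = sum c Q"
    using sum.reindex_bij_betw[OF f, of c] sum.reindex_bij_betw[OF g, of c] by (simp_all add: comp_def)
  then have "\<exists>i i' j j'. i < i' \<and> i' \<le> k \<and> j < j' \<and> j' \<le> k \<and> sum (c \<circ> f) {i..<i'} = sum (c \<circ> g) {j..<j'}"
    using c fg assms(5) le by (intro equal_partial_sums) auto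
  then obtain i i' j j' where ij: "i < i'" "i' \<le> k" "j < j'" "j' \<le> k" "sum (c \<circ> f) {i..<i'} = sum (c \<circ> g) {j..<j'}"
    by blast
  have "inj_on f {i..<i'}" "inj_on g {j..<j'}"
    using f g ij by (auto simp: bij_betw_def elim!: inj_on_subset)
  then have "sum c (f ` {i..<i'}) = sum c (g ` {j..<j'})" using ij(5) by (simp add: sum.reindex)
  moreover have "f ` {i..<i'} \<subseteq> P" "g ` {j..<j'} \<subseteq> Q" using fg ij by auto
  moreover have "f ` {i..<i'} \<noteq> {}" "g ` {j..<j'} \<noteq> {}" using ij by auto
  ultimately show ?thesis by blast
qed

lemma equal_subset_sums:
  fixes c :: "'v \<Rightarrow> nat"
  assumes "finite P" "finite Q" "k \<le> card P" "k \<le> card Q" "0 < k"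
    and c: "\<And>v. v \<in> P \<union> Q \<Longrightarrow> 0 < c v \<and> c v \<le> k"
  shows "\<exists>P'\<subseteq>P. \<exists>Q'\<subseteq>Q. P' \<noteq> {} \<and> Q' \<noteq> {} \<and> sum c P' = sum c Q'"
proof -
  obtain P1 where P1: "P1 \<subseteq> P" "card P1 = k" "finite P1"
    using obtain_subset_with_card_n[OF assms(3)] by blast
  obtain Q1 where Q1: "Q1 \<subseteq> Q" "card Q1 = k" "finite Q1"
    using obtain_subset_with_card_n[OF assms(4)] by blast
  have c1: "0 < c v \<and> c v \<le> k" if "v \<in> P1 \<union> Q1" for v using that c P1(1) Q1(1) by blast
  have "\<exists>P'\<subseteq>P1. \<exists>Q'\<subseteq>Q1. P' \<noteq> {} \<and> Q' \<noteq> {} \<and> sum c P' = sum c Q'"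
  proof (cases "sum c P1 \<le> sum c Q1")
    case True
    then show ?thesis using c1 P1 Q1 assms(5) by (intro equal_subset_sums_aux) auto
  next
    case False
    then have "\<exists>Q'\<subseteq>Q1. \<exists>P'\<subseteq>P1. Q' \<noteq> {} \<and> P' \<noteq> {} \<and> sum c Q' = sum c P'"
      using c1 P1 Q1 assms(5) by (intro equal_subset_sums_aux) auto
    then show ?thesis by metis
  qed
  then show ?thesis using P1(1) Q1(1) by (meson subset_trans)
qed

text \<open>Deleting nonempty subsets of equal sum preserves the difference of the two sums, and can
  be repeated as long as both sets have at least \<open>k\<close> elements.\<close>

lemma cancel_equal_sums:
  fixes c :: "'v \<Rightarrow> nat"
  assumes "finite P" "finite Q" "0 < k" and "\<And>v. v \<in> P \<union> Q \<Longrightarrow> 0 < c v \<and> c v \<le> k"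
  shows "\<exists>P'\<subseteq>P. \<exists>Q'\<subseteq>Q. sum c P' + sum c Q = sum c P + sum c Q' \<and> (card P' < k \<or> card Q' < k)"
  using assms
proof (induction "card P" arbitrary: P Q rule: less_induct)
  case less
  show ?case
  proof (cases "card P < k \<or> card Q < k")
    case True
    then show ?thesis by blast
  next
    case False
    then have "\<exists>P'\<subseteq>P. \<exists>Q'\<subseteq>Q. P' \<noteq> {} \<and> Q' \<noteq> {} \<and> sum c P' = sum c Q'"
      using less.prems by (intro equal_subset_sums) auto
    then obtain P1 Q1 where PQ: "P1 \<subseteq> P" "Q1 \<subseteq> Q" "P1 \<noteq> {}" "sum c P1 = sum c Q1" by blast
    have sP: "sum c P = sum c (P - P1) + sum c P1" and sQ: "sum c Q = sum c (Q - Q1) + sum c Q1"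
      using PQ(1,2) less.prems(1,2) by (auto intro: sum.subset_diff)
    have "P - P1 \<subset> P" using PQ by blast
    then have "card (P - P1) < card P" using less.prems(1) by (intro psubset_card_mono)
    then have "\<exists>P'\<subseteq>P - P1. \<exists>Q'\<subseteq>Q - Q1. sum c P' + sum c (Q - Q1) = sum c (P - P1) + sum c Q' \<and> (card P' < k \<or> card Q' < k)"
      using less.prems by (intro less.hyps) auto
    then obtain P' Q' where "P' \<subseteq> P - P1" "Q' \<subseteq> Q - Q1"
      "sum c P' + sum c (Q - Q1) = sum c (P - P1) + sum c Q'" "card P' < k \<or> card Q' < k" by blast
    then have "P' \<subseteq> P" "Q' \<subseteq> Q" "sum c P' + sum c Q = sum c P + sum c Q' \<and> (card P' < k \<or> card Q' < k)"
      using sP sQ PQ(4) by auto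
    then show ?thesis by blast
  qed
qed

section \<open>Orientations with prescribed out-degrees\<close>

lemma sum_shift_int: "finite S \<Longrightarrow> (\<Sum>v\<in>S. t v - of_bool (v = z) :: int) = sum t S - of_bool (z \<in> S)"
  by (cases "z \<in> S") (simp_all add: sum_subtractf of_bool_def)

text \<open>
  Hakimi's theorem. The first edge may be assigned to one of its ends because two tight sets, each
  containing just one of the ends, would violate supermodularity of the number of induced edges.
\<close>

lemma orientation_exists:
  assumes "finite E" "finite V" and "\<And>e. e \<in> E \<Longrightarrow> ends e \<subseteq> V \<and> card (ends e) = 2"
    and "sum t V = int (card E)" and "\<And>S. S \<subseteq> V \<Longrightarrow> int (card {e \<in> E. ends e \<subseteq> S}) \<le> sum t S"
  shows "\<exists>f. (\<forall>e\<in>E. f e \<in> ends e) \<and> (\<forall>v\<in>V. int (card {e \<in> E. f e = v}) = t v)"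
  using assms(1,3-5)
proof (induction E arbitrary: t rule: finite_induct)
  case empty
  have nn: "0 \<le> t v" if "v \<in> V" for v using empty(3)[of "{v}"] that by simp
  then have "t v = 0" if "v \<in> V" for v using empty(2) sum_nonneg_eq_0_iff[OF assms(2), of t] that by simp
  then show ?case by simp
next
  case (insert e E)
  define i where "i S = int (card {e \<in> E. ends e \<subseteq> S})" for S
  obtain x y where xy: "ends e = {x, y}" "x \<noteq> y" "x \<in> V" "y \<in> V"
    using insert.prems(1)[of e] by (auto simp: card_2_iff)
  have i_insert: "int (card {e' \<in> insert e E. ends e' \<subseteq> S}) = i S + of_bool (x \<in> S \<and> y \<in> S)" for S
  proof -
    have "{e' \<in> insert e E. ends e' \<subseteq> S} = (if x \<in> S \<and> y \<in> S then insert e {e' \<in> E. ends e' \<subseteq> S} else {e' \<in> E. ends e' \<subseteq> S})"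
      using xy(1) by auto
    then show ?thesis using insert.hyps by (simp add: i_def)
  qed
  have bound: "i S + of_bool (x \<in> S \<and> y \<in> S) \<le> sum t S" if "S \<subseteq> V" for S
    using insert.prems(3)[OF that] unfolding i_insert .
  have assign: ?case if z: "z \<in> ends e" and le: "\<And>S. S \<subseteq> V \<Longrightarrow> i S \<le> sum t S - of_bool (z \<in> S)" for z
  proof -
    have zV: "z \<in> V" using z xy by auto
    have fin: "finite S" if "S \<subseteq> V" for S using that assms(2) by (rule finite_subset)
    have "\<exists>f. (\<forall>e\<in>E. f e \<in> ends e) \<and> (\<forall>v\<in>V. int (card {e \<in> E. f e = v}) = t v - of_bool (v = z))"
    proof (rule insert.IH)
      show "(\<Sum>v\<in>V. t v - of_bool (v = z)) = int (card E)"
        unfolding sum_shift_int[OF assms(2)] using zV insert.prems(2) insert.hyps by simp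
      show "int (card {e \<in> E. ends e \<subseteq> S}) \<le> (\<Sum>v\<in>S. t v - of_bool (v = z))" if "S \<subseteq> V" for S
        unfolding sum_shift_int[OF fin[OF that]] using le[OF that] by (simp add: i_def)
    qed (use insert.prems(1) in auto)
    then obtain f where f: "\<forall>e\<in>E. f e \<in> ends e" "\<forall>v\<in>V. int (card {e \<in> E. f e = v}) = t v - of_bool (v = z)"
      by blast
    have "int (card {e' \<in> insert e E. (f(e := z)) e' = v}) = t v" if v: "v \<in> V" for v
    proof -
      have "{e' \<in> insert e E. (f(e := z)) e' = v} = (if v = z then insert e {e' \<in> E. f e' = v} else {e' \<in> E. f e' = v})"
        using insert.hyps(2) by auto
      then show ?thesis using bspec[OF f(2) v] insert.hyps by (cases "v = z") simp_all
    qed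
    moreover have "\<forall>e'\<in>insert e E. (f(e := z)) e' \<in> ends e'" using f(1) z by simp
    ultimately show ?thesis by blast
  qed
  show ?case
  proof (rule ccontr)
    assume no: "\<not> ?case"
    have "\<exists>S\<subseteq>V. sum t S - of_bool (z \<in> S) < i S" if "z \<in> ends e" for z
      using assign[OF that] no by (meson not_le)
    then obtain S R where S: "S \<subseteq> V" "sum t S - of_bool (x \<in> S) < i S"
      and R: "R \<subseteq> V" "sum t R - of_bool (y \<in> R) < i R"
      using xy(1) by (metis insertI1 insertI2)
    have S': "x \<in> S" "y \<notin> S" "sum t S = i S" using S(2) bound[OF S(1)] by (auto simp: of_bool_def split: if_splits)
    have R': "y \<in> R" "x \<notin> R" "sum t R = i R" using R(2) bound[OF R(1)] by (auto simp: of_bool_def split: if_splits)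
    have fin: "finite S" "finite R" using S(1) R(1) assms(2) by (auto intro: finite_subset)
    have finE: "finite {e \<in> E. P e}" for P using insert.hyps(1) by simp
    have "card {e \<in> E. ends e \<subseteq> S} + card {e \<in> E. ends e \<subseteq> R} =
        card ({e \<in> E. ends e \<subseteq> S} \<union> {e \<in> E. ends e \<subseteq> R}) + card ({e \<in> E. ends e \<subseteq> S} \<inter> {e \<in> E. ends e \<subseteq> R})"
      using finE by (intro card_Un_Int) auto
    also have "\<dots> \<le> card {e \<in> E. ends e \<subseteq> S \<union> R} + card {e \<in> E. ends e \<subseteq> S \<inter> R}"
      using finE by (intro add_mono card_mono) auto
    finally have "i S + i R \<le> i (S \<union> R) + i (S \<inter> R)" by (simp add: i_def)
    \<comment> \<open>The contradiction comes from the new edge: both its ends lie in the union,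
      although neither tight set contains both.\<close>
    moreover have "i (S \<union> R) + 1 \<le> sum t (S \<union> R)" using bound[of "S \<union> R"] S(1) R(1) S'(1) R'(1) by simp
    moreover have "i (S \<inter> R) \<le> sum t (S \<inter> R)"
    proof -
      have "S \<inter> R \<subseteq> V" using S(1) by auto
      from bound[OF this] show ?thesis using S'(2) by simp
    qed
    moreover have "sum t (S \<union> R) + sum t (S \<inter> R) = sum t S + sum t R" using fin by (rule sum.union_inter)
    ultimately show False using S'(3) R'(3) by linarith
  qed
qed

section \<open>Rounding to the ends of intervals\<close>

text \<open>
  The error term \<open>\<eta>\<close> comes from changing \<open>b\<close> at one vertex so that its sum becomes an integer.
\<close>

lemma round_to_bits:
  assumes "finite V" "weighting w" and cuts: "\<And>A. A \<noteq> {} \<Longrightarrow> A \<subset> V \<Longrightarrow> 6 \<le> cut_weight w A (V - A)"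
    and b: "\<And>v. v \<in> V \<Longrightarrow> 0 \<le> b v \<and> b v \<le> 1"
  shows "\<exists>y :: 'v \<Rightarrow> int. \<exists>\<eta>. (\<forall>v\<in>V. y v \<in> {0, 1} \<and> (b v = 0 \<longrightarrow> y v = 0)) \<and>
    (\<forall>S\<subseteq>V. 2 * \<bar>\<Sum>v\<in>S. of_int (y v) - b v - \<eta> v\<bar> \<le> cut_weight w S (V - S) \<and> \<bar>sum \<eta> S\<bar> \<le> 1)"
proof (cases "\<exists>r\<in>V. b r \<noteq> 0")
  case True
  \<comment> \<open>The corrected vertex must have nonzero \<open>b\<close>, because vertices with
    \<open>b v = 0\<close> are required to be rounded to 0.\<close>
  then obtain r where r: "r \<in> V" "b r \<noteq> 0" by blast
  define s where "s = sum b (V - {r})"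
  define b' where "b' = b(r := of_int \<lceil>s\<rceil> - s)"
  define \<eta> where "\<eta> v = (b' r - b r) * of_bool (v = r)" for v
  have b': "0 \<le> b' v \<and> b' v \<le> 1" if "v \<in> V" for v
    using b[OF that] ceiling_correct[of s] by (auto simp: b'_def)
  have "sum b' V = b' r + sum b' (V - {r})" using assms(1) r(1) by (rule sum.remove)
  also have "sum b' (V - {r}) = s" unfolding s_def b'_def by (intro sum.cong) auto
  finally have "sum b' V = of_int \<lceil>s\<rceil>" by (simp add: b'_def)
  then have "sum b' V \<in> \<int>" by simp
  then have "\<exists>y :: 'v \<Rightarrow> int. (\<forall>v\<in>V. \<bar>of_int (y v) - b' v\<bar> < 1) \<and>
    (\<forall>S\<subseteq>V. 2 * \<bar>\<Sum>v\<in>S. of_int (y v) - b' v\<bar> \<le> cut_weight w S (V - S))"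
    using assms(1,2) cuts by (intro cut_rounding) auto
  then obtain y :: "'v \<Rightarrow> int" where y: "\<And>v. v \<in> V \<Longrightarrow> \<bar>of_int (y v) - b' v\<bar> < 1"
    "\<And>S. S \<subseteq> V \<Longrightarrow> 2 * \<bar>\<Sum>v\<in>S. of_int (y v) - b' v\<bar> \<le> cut_weight w S (V - S)" by blast
  have "y v \<in> {0, 1} \<and> (b v = 0 \<longrightarrow> y v = 0)" if v: "v \<in> V" for v
  proof
    have "- 1 < (of_int (y v) :: real)" "(of_int (y v) :: real) < 2" using y(1)[OF v] b'[OF v] by auto
    then have "- 1 < y v" "y v < 2" by simp_all
    then show "y v \<in> {0, 1}" by auto
    show "b v = 0 \<longrightarrow> y v = 0" using y(1)[OF v] r(2) by (auto simp: b'_def split: if_splits)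
  qed
  moreover have "\<bar>sum \<eta> S\<bar> \<le> 1" if "S \<subseteq> V" for S
  proof -
    have "sum \<eta> S = (b' r - b r) * of_bool (r \<in> S)"
      unfolding \<eta>_def using finite_subset[OF that assms(1)] by (rule sum_point)
    then show ?thesis using b[OF r(1)] b'[OF r(1)] by auto
  qed
  moreover have "of_int (y v) - b' v = of_int (y v) - b v - \<eta> v" for v
    by (simp add: \<eta>_def b'_def)
  then have "2 * \<bar>\<Sum>v\<in>S. of_int (y v) - b v - \<eta> v\<bar> \<le> cut_weight w S (V - S)" if "S \<subseteq> V" for S
    using y(2)[OF that] by (simp only:)
  ultimately show ?thesis by blast
next
  case False
  then have "sum b S = 0" if "S \<subseteq> V" for S using that by (intro sum.neutral) blast
  then show ?thesis using False cut_nonneg[OF assms(2)]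
    by (intro exI[of _ "\<lambda>v. 0"]) (auto simp: sum_negf)
qed

lemma sum_real_upto: "(\<Sum>c=1..k. real c) = real k * (real k + 1) / 2"
  by (induction k) (simp_all add: field_simps)

text \<open>The vertices with \<open>q v - p v = i\<close> are rounded by 0/1 values scaled by i.
  Each of the k roundings has the same cut bound, so the total picks up the factor 1 + ... +
  k.\<close>

lemma round_to_ends:
  fixes p q :: "'v \<Rightarrow> int" and h :: "'v \<Rightarrow> real"
  assumes "finite V" "weighting w" and cuts: "\<And>A. A \<noteq> {} \<Longrightarrow> A \<subset> V \<Longrightarrow> 6 \<le> cut_weight w A (V - A)"
    and pq: "\<And>v. v \<in> V \<Longrightarrow> of_int (p v) \<le> h v \<and> h v \<le> of_int (q v) \<and> q v - p v \<le> int k"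
  shows "\<exists>t :: 'v \<Rightarrow> int. \<exists>\<eta>. (\<forall>v\<in>V. t v \<in> {p v, q v}) \<and>
    (\<forall>S\<subseteq>V. 2 * \<bar>\<Sum>v\<in>S. of_int (t v) - h v - \<eta> v\<bar> \<le> real k * (real k + 1) / 2 * cut_weight w S (V - S) \<and>
      \<bar>sum \<eta> S\<bar> \<le> real k * (real k + 1) / 2)"
proof -
  define c where "c v = nat (q v - p v)" for v
  \<comment> \<open>Relative position of \<open>h v\<close> in its interval. It is 0 for vertices
    outside class i, so the rounding for class i leaves them alone.\<close>
  define b where "b i v = (if c v = i then (h v - of_int (p v)) / real i else 0)" for i v
  have c: "of_int (q v) = of_int (p v) + real (c v)" "c v \<le> k" if "v \<in> V" for v
  proof -
    have "(of_int (p v) :: real) \<le> of_int (q v)" using pq[OF that] by linarith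
    then show "of_int (q v) = of_int (p v) + real (c v)" by (simp add: c_def)
    show "c v \<le> k" using pq[OF that] by (simp add: c_def nat_le_iff)
  qed
  have b01: "0 \<le> b i v \<and> b i v \<le> 1" if v: "v \<in> V" for i v
    using pq[OF v] c(1)[OF v] by (auto simp: b_def divide_le_eq)
  define good where "good i y \<eta> \<longleftrightarrow> (\<forall>v\<in>V. y v \<in> {0, 1} \<and> (b i v = 0 \<longrightarrow> y v = 0)) \<and>
    (\<forall>S\<subseteq>V. 2 * \<bar>\<Sum>v\<in>S. of_int (y v) - b i v - \<eta> v\<bar> \<le> cut_weight w S (V - S) \<and> \<bar>sum \<eta> S\<bar> \<le> 1)"
    for i and y :: "'v \<Rightarrow> int" and \<eta>
  have "\<exists>y \<eta>. good i y \<eta>" for i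
    unfolding good_def by (rule round_to_bits[OF assms(1,2) cuts b01])
  then obtain Y where "\<forall>i. \<exists>\<eta>. good i (Y i) \<eta>" using choice[of "\<lambda>i y. \<exists>\<eta>. good i y \<eta>"] by blast
  then obtain H where good: "\<And>i. good i (Y i) (H i)" using choice[of "\<lambda>i \<eta>. good i (Y i) \<eta>"] by blast
  have Y: "Y i v \<in> {0, 1} \<and> (b i v = 0 \<longrightarrow> Y i v = 0)" if "v \<in> V" for i v
    using good[of i] that unfolding good_def by blast
  have H: "2 * \<bar>\<Sum>v\<in>S. of_int (Y i v) - b i v - H i v\<bar> \<le> cut_weight w S (V - S)" "\<bar>sum (H i) S\<bar> \<le> 1"
    if "S \<subseteq> V" for i S
    using good[of i] that unfolding good_def by blast+
  define t where "t v = (if Y (c v) v = 0 then p v else q v)" for v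
  define \<eta> where "\<eta> v = (\<Sum>i=1..k. real i * H i v)" for v
  have th: "of_int (t v) - h v = (\<Sum>i=1..k. real i * (of_int (Y i v) - b i v))" if v: "v \<in> V" for v
  proof (cases "c v = 0")
    case True
    then have b0: "b i v = 0" for i by (simp add: b_def)
    then have Y0: "Y i v = 0" for i using Y[OF v, of i] by blast
    have "h v = of_int (p v)" using pq[OF v] c(1)[OF v] True by auto
    then show ?thesis by (simp add: t_def b0 Y0)
  next
    case False
    have "(\<Sum>i=1..k. real i * (of_int (Y i v) - b i v)) =
        (\<Sum>i=1..k. if i = c v then real (c v) * (of_int (Y (c v) v) - b (c v) v) else 0)"
    proof (rule sum.cong[OF refl])
      fix i
      show "real i * (of_int (Y i v) - b i v) =
          (if i = c v then real (c v) * (of_int (Y (c v) v) - b (c v) v) else 0)"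
        using Y[OF v, of i] by (cases "i = c v") (simp_all add: b_def)
    qed
    also have "\<dots> = real (c v) * (of_int (Y (c v) v) - b (c v) v)"
      using False c(2)[OF v] by simp
    also have "\<dots> = of_int (t v) - h v"
    proof -
      have "real (c v) * b (c v) v = h v - of_int (p v)" using False by (simp add: b_def)
      moreover have "Y (c v) v = 0 \<or> Y (c v) v = 1" using Y[OF v, of "c v"] by simp
      ultimately show ?thesis using c(1)[OF v] by (elim disjE) (simp_all add: t_def right_diff_distrib)
    qed
    finally show ?thesis by simp
  qed
  have "2 * \<bar>\<Sum>v\<in>S. of_int (t v) - h v - \<eta> v\<bar> \<le> real k * (real k + 1) / 2 * cut_weight w S (V - S)"
    if S: "S \<subseteq> V" for S
  proof -
    have "(\<Sum>v\<in>S. of_int (t v) - h v - \<eta> v) = (\<Sum>v\<in>S. \<Sum>i=1..k. real i * (of_int (Y i v) - b i v - H i v))"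
    proof (rule sum.cong[OF refl])
      fix v assume "v \<in> S"
      then have "v \<in> V" using S by blast
      show "of_int (t v) - h v - \<eta> v = (\<Sum>i=1..k. real i * (of_int (Y i v) - b i v - H i v))"
        unfolding th[OF \<open>v \<in> V\<close>] \<eta>_def sum_subtractf[symmetric] by (simp only: right_diff_distrib)
    qed
    also have "\<dots> = (\<Sum>i=1..k. real i * (\<Sum>v\<in>S. of_int (Y i v) - b i v - H i v))"
      by (subst sum.swap) (simp only: sum_distrib_left)
    finally have "\<bar>\<Sum>v\<in>S. of_int (t v) - h v - \<eta> v\<bar> \<le> (\<Sum>i=1..k. \<bar>real i * (\<Sum>v\<in>S. of_int (Y i v) - b i v - H i v)\<bar>)"
      by (simp only: sum_abs)
    also have "\<dots> \<le> (\<Sum>i=1..k. real i * (cut_weight w S (V - S) / 2))"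
    proof (rule sum_mono)
      fix i
      have "\<bar>\<Sum>v\<in>S. of_int (Y i v) - b i v - H i v\<bar> \<le> cut_weight w S (V - S) / 2" using H(1)[OF S, of i] by linarith
      then show "\<bar>real i * (\<Sum>v\<in>S. of_int (Y i v) - b i v - H i v)\<bar> \<le> real i * (cut_weight w S (V - S) / 2)"
        unfolding abs_mult abs_of_nat by (intro mult_left_mono) simp_all
    qed
    also have "\<dots> = real k * (real k + 1) / 2 * (cut_weight w S (V - S) / 2)"
      by (simp only: sum_distrib_right[symmetric] sum_real_upto)
    finally show ?thesis by simp
  qed
  moreover have "\<bar>sum \<eta> S\<bar> \<le> real k * (real k + 1) / 2" if S: "S \<subseteq> V" for S
  proof -
    have "sum \<eta> S = (\<Sum>i=1..k. real i * sum (H i) S)"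
      unfolding \<eta>_def by (subst sum.swap) (simp only: sum_distrib_left)
    then have "\<bar>sum \<eta> S\<bar> \<le> (\<Sum>i=1..k. \<bar>real i * sum (H i) S\<bar>)" by (simp only: sum_abs)
    also have "\<dots> \<le> (\<Sum>i=1..k. real i * 1)"
    proof (rule sum_mono)
      fix i
      show "\<bar>real i * sum (H i) S\<bar> \<le> real i * 1"
        unfolding abs_mult abs_of_nat using H(2)[OF S, of i] by (intro mult_left_mono) simp_all
    qed
    finally show ?thesis using sum_real_upto[of k] by simp
  qed
  moreover have "t v \<in> {p v, q v}" for v by (simp add: t_def)
  ultimately show ?thesis by blast
qed

lemma sum_of_bool_mem:
  fixes f :: "'v \<Rightarrow> 'a :: semiring_1"
  assumes "finite S" shows "(\<Sum>v\<in>S. f v * of_bool (v \<in> A)) = sum f (S \<inter> A)"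
  using assms by (simp add: sum.inter_restrict of_bool_def if_distrib cong: if_cong)

text \<open>The given choice \<open>s\<close> is used only for its total. Switching
  \<open>t0\<close> on all vertices where it differs from \<open>s\<close> would correct the total
  but may be far too costly; after cancelling equal sums, the switches in one of the two directions
  involve fewer than \<open>k\<close> vertices. An upper bound on deviations suffices: as they sum
  to zero, the complement gives the lower one.\<close>

lemma round_to_ends_balanced:
  fixes p q s :: "'v \<Rightarrow> int" and h :: "'v \<Rightarrow> real"
  assumes "finite V" "weighting w" and cuts: "\<And>A. A \<noteq> {} \<Longrightarrow> A \<subset> V \<Longrightarrow> 6 \<le> cut_weight w A (V - A)"
    and pq: "\<And>v. v \<in> V \<Longrightarrow> of_int (p v) \<le> h v \<and> h v \<le> of_int (q v) \<and> q v - p v \<le> int k"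
    and s: "\<And>v. v \<in> V \<Longrightarrow> s v \<in> {p v, q v}" "of_int (sum s V) = sum h V" and k: "0 < k"
  shows "\<exists>t :: 'v \<Rightarrow> int. (\<forall>v\<in>V. t v \<in> {p v, q v}) \<and> sum t V = sum s V \<and>
    (\<forall>S\<subseteq>V. (\<Sum>v\<in>S. of_int (t v) - h v) \<le> real k * (real k + 1) / 4 * cut_weight w S (V - S) +
      real k * (real k + 1) / 2 + real k * (real k - 1))"
proof -
  have "\<exists>t :: 'v \<Rightarrow> int. \<exists>\<eta>. (\<forall>v\<in>V. t v \<in> {p v, q v}) \<and>
    (\<forall>S\<subseteq>V. 2 * \<bar>\<Sum>v\<in>S. of_int (t v) - h v - \<eta> v\<bar> \<le> real k * (real k + 1) / 2 * cut_weight w S (V - S) \<and>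
      \<bar>sum \<eta> S\<bar> \<le> real k * (real k + 1) / 2)"
    by (rule round_to_ends[OF assms(1,2) cuts pq])
  then obtain t0 :: "'v \<Rightarrow> int" and \<eta> where t: "\<forall>v\<in>V. t0 v \<in> {p v, q v}"
    and bounds: "\<forall>S\<subseteq>V. 2 * \<bar>\<Sum>v\<in>S. of_int (t0 v) - h v - \<eta> v\<bar> \<le> real k * (real k + 1) / 2 * cut_weight w S (V - S) \<and>
      \<bar>sum \<eta> S\<bar> \<le> real k * (real k + 1) / 2"
    by (elim exE conjE)
  note t0 = bspec[OF t]
  have dev: "2 * \<bar>\<Sum>v\<in>S. of_int (t0 v) - h v - \<eta> v\<bar> \<le> real k * (real k + 1) / 2 * cut_weight w S (V - S)"
    and \<eta>: "\<bar>sum \<eta> S\<bar> \<le> real k * (real k + 1) / 2" if "S \<subseteq> V" for S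
    using bounds that by blast+
  define c where "c v = nat (q v - p v)" for v
  have c: "int (c v) = q v - p v" "c v \<le> k" if "v \<in> V" for v
  proof -
    have "(of_int (p v) :: real) \<le> of_int (q v)" using pq[OF that] by linarith
    then show "int (c v) = q v - p v" by (simp add: c_def)
    show "c v \<le> k" using pq[OF that] by (simp add: c_def nat_le_iff)
  qed
  \<comment> \<open>\<open>P\<close> would have to move down and \<open>Q\<close> up to turn
    \<open>t0\<close> into \<open>s\<close>.\<close>
  define P where "P = {v \<in> V. t0 v = q v \<and> s v = p v \<and> p v < q v}"
  define Q where "Q = {v \<in> V. t0 v = p v \<and> s v = q v \<and> p v < q v}"
  have PQ: "P \<subseteq> V" "Q \<subseteq> V" "finite P" "finite Q" "P \<inter> Q = {}"
    using assms(1) by (auto simp: P_def Q_def)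
  have "0 < c v \<and> c v \<le> k" if "v \<in> P \<union> Q" for v
    using that c[of v] by (auto simp: P_def Q_def c_def)
  then obtain P' Q' where P': "P' \<subseteq> P" and Q': "Q' \<subseteq> Q"
    and eq: "sum c P' + sum c Q = sum c P + sum c Q'" and small: "card P' < k \<or> card Q' < k"
    using cancel_equal_sums[OF PQ(3,4) k, of c] by metis
  have sub: "P' \<subseteq> V" "Q' \<subseteq> V" using P' Q' PQ by auto
  define f where "f v = int (c v)" for v
  define t where "t v = t0 v - f v * of_bool (v \<in> P') + f v * of_bool (v \<in> Q')" for v
  have t_in: "t v \<in> {p v, q v}" if v: "v \<in> V" for v
  proof -
    consider "v \<in> P'" "v \<notin> Q'" | "v \<in> Q'" "v \<notin> P'" | "v \<notin> P'" "v \<notin> Q'" using P' Q' PQ(5) by blast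
    then show ?thesis
    proof cases
      case 1
      then have "t0 v = q v" using P' by (auto simp: P_def)
      then show ?thesis using 1 c(1)[OF v] by (simp add: t_def f_def)
    next
      case 2
      then have "t0 v = p v" using Q' by (auto simp: Q_def)
      then show ?thesis using 2 c(1)[OF v] by (simp add: t_def f_def)
    next
      case 3
      then show ?thesis using t0[OF v] by (simp add: t_def)
    qed
  qed
  have sum_t: "sum t S = sum t0 S - sum f (S \<inter> P') + sum f (S \<inter> Q')" if "S \<subseteq> V" for S
    unfolding t_def using sum_of_bool_mem[OF finite_subset[OF that assms(1)], of f]
    by (simp add: sum.distrib sum_subtractf)
  have "s v = t0 v - f v * of_bool (v \<in> P) + f v * of_bool (v \<in> Q)" if v: "v \<in> V" for v
    using s(1)[OF v] t0[OF v] c(1)[OF v] v by (auto simp: P_def Q_def f_def)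
  then have "sum s V = (\<Sum>v\<in>V. t0 v - f v * of_bool (v \<in> P) + f v * of_bool (v \<in> Q))"
    by (rule sum.cong[OF refl])
  also have "\<dots> = sum t0 V - sum f (V \<inter> P) + sum f (V \<inter> Q)"
    using sum_of_bool_mem[OF assms(1), of f] by (simp add: sum.distrib sum_subtractf)
  finally have sum_s: "sum s V = sum t0 V - sum f P + sum f Q"
    using PQ(1,2) by (simp add: Int_absorb1)
  have sum_f: "sum f A = int (sum c A)" for A by (simp add: f_def)
  have tot: "sum t V = sum s V"
    using sum_t[OF order_refl] sum_s eq unfolding sum_f Int_absorb1[OF sub(1)] Int_absorb1[OF sub(2)] by linarith
  have "(\<Sum>v\<in>S. of_int (t v) - h v) \<le> real k * (real k + 1) / 4 * cut_weight w S (V - S) +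
      real k * (real k + 1) / 2 + real k * (real k - 1)" if S: "S \<subseteq> V" for S
  proof -
    have small_sum: "real (sum c A) \<le> real k * (real k - 1)" if "A \<subseteq> V" "card A < k" for A
    proof -
      have "sum c A \<le> card A * k" using sum_bounded_above[of A c k] c(2) that(1) by auto
      also have "\<dots> \<le> (k - 1) * k" using that(2) by (intro mult_right_mono) auto
      finally have "real (sum c A) \<le> real ((k - 1) * k)" by (simp only: of_nat_le_iff)
      then show ?thesis using k by (simp add: of_nat_diff mult.commute)
    qed
    have split: "(\<Sum>v\<in>A. of_int (t0 v) - h v) = (\<Sum>v\<in>A. of_int (t0 v) - h v - \<eta> v) + sum \<eta> A" for A
      by (simp add: sum_subtractf)
    have "sum t S \<le> sum t0 S + int (sum c Q')"
    proof -
      have "sum c (S \<inter> Q') \<le> sum c Q'" using Q' PQ(4) by (intro sum_mono2) (auto intro: finite_subset)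
      then show ?thesis using sum_t[OF S] unfolding sum_f by linarith
    qed
    then have "real_of_int (sum t S) \<le> real_of_int (sum t0 S + int (sum c Q'))" by (simp only: of_int_le_iff)
    then have "(\<Sum>v\<in>S. of_int (t v) - h v) \<le> (\<Sum>v\<in>S. of_int (t0 v) - h v) + real (sum c Q')"
      by (simp add: sum_subtractf)
    then have 1: "(\<Sum>v\<in>S. of_int (t v) - h v) \<le> real k * (real k + 1) / 4 * cut_weight w S (V - S) + sum \<eta> S + real (sum c Q')"
      using split[of S] dev[OF S] by linarith
    show ?thesis
      using small
    proof
      assume "card Q' < k"
      then show ?thesis using 1 \<eta>[OF S] small_sum[OF sub(2)] by linarith
    next
      assume "card P' < k"
      \<comment> \<open>If only the downward switches are few, the upward ones exceed them by
        \<open>- sum \<eta> V\<close>. Added to \<open>sum \<eta> S\<close> this leaves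
        \<open>- sum \<eta> (V - S)\<close>, so the error term is still paid for only once.\<close>
      moreover have "real (sum c Q') = real (sum c P') - sum \<eta> V"
      proof -
        have "(\<Sum>v\<in>V. of_int (t0 v) - h v - \<eta> v) = 0" using dev[OF order_refl] by (simp add: cut_weight_def)
        then have "of_int (sum t0 V) - sum h V = sum \<eta> V" using split[of V] by (simp add: sum_subtractf)
        moreover have "sum t0 V = sum s V + int (sum c P') - int (sum c Q')"
          using sum_s eq unfolding sum_f by linarith
        then have "real_of_int (sum t0 V) = of_int (sum s V) + real (sum c P') - real (sum c Q')"
          by (simp only: of_int_add of_int_diff of_int_of_nat_eq)
        ultimately show ?thesis using s(2) by linarith
      qed
      moreover have "sum \<eta> V = sum \<eta> (V - S) + sum \<eta> S" using S assms(1) by (rule sum.subset_diff)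
      moreover have "V - S \<subseteq> V" by blast
      ultimately show ?thesis using 1 \<eta>[of "V - S"] small_sum[OF sub(1)] by linarith
    qed
  qed
  then show ?thesis using t_in tot by blast
qed

section \<open>Multigraphs\<close>

lemma card_filter_of_bool: "finite E \<Longrightarrow> real (card {e \<in> E. P e}) = (\<Sum>e\<in>E. of_bool (P e))"
  using sum.inter_filter[of E "\<lambda>_. 1 :: real" P] by (simp add: of_bool_def)

definition parallel_count :: "('v, 'e) mgraph \<Rightarrow> 'v \<Rightarrow> 'v \<Rightarrow> real" where
  "parallel_count G u v = (\<Sum>e\<in>mg_edges G. of_bool (mg_ends G e = {u, v}))"

lemma weighting_parallel_count: "weighting (parallel_count G)"
  unfolding weighting_def parallel_count_def by (auto simp: insert_commute intro: sum_nonneg)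

context
  fixes G :: "('v, 'e) mgraph"
  assumes G: "multigraph G"
begin

lemma edge_ends:
  assumes "e \<in> mg_edges G"
  shows "\<exists>x y. mg_ends G e = {x, y} \<and> x \<noteq> y \<and> x \<in> mg_verts G \<and> y \<in> mg_verts G"
proof -
  obtain x y where "mg_ends G e = {x, y}" "x \<noteq> y"
    using multigraph.two_ends[OF G assms] by (auto simp: card_2_iff)
  then show ?thesis using multigraph.ends_in_verts[OF G assms] by auto
qed

lemma card_ends_Int:
  assumes "e \<in> mg_edges G"
  shows "card (mg_ends G e \<inter> S) = 2 * of_bool (mg_ends G e \<subseteq> S) + of_bool (card (mg_ends G e \<inter> S) = 1)"
proof -
  obtain x y where "mg_ends G e = {x, y}" "x \<noteq> y" using edge_ends[OF assms] by blast
  then show ?thesis by (cases "x \<in> S"; cases "y \<in> S") simp_all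
qed

lemma cut_parallel_count:
  assumes S: "S \<subseteq> mg_verts G"
  shows "cut_weight (parallel_count G) S (mg_verts G - S) = card (edge_boundary G S)"
proof -
  have finV: "finite (mg_verts G)" and finE: "finite (mg_edges G)"
    using G by (rule multigraph.finite_verts, rule multigraph.finite_edges)
  have fin: "finite S" "finite (mg_verts G - S)" using S finV by (auto intro: finite_subset)
  have one: "cut_weight (\<lambda>u v. of_bool (mg_ends G e = {u, v})) S (mg_verts G - S) = of_bool (card (mg_ends G e \<inter> S) = 1)"
    if e: "e \<in> mg_edges G" for e
  proof -
    obtain x y where xy: "mg_ends G e = {x, y}" "x \<noteq> y" "x \<in> mg_verts G" "y \<in> mg_verts G"
      using edge_ends[OF e] by blast
    have "cut_weight (\<lambda>u v. of_bool (mg_ends G e = {u, v})) S (mg_verts G - S) = cut_weight (link x y) S (mg_verts G - S)"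
      unfolding cut_weight_def
    proof (intro sum.cong refl)
      fix u v assume "u \<in> S" "v \<in> mg_verts G - S"
      then have "({x, y} = {u, v}) = (u = x \<and> v = y \<or> u = y \<and> v = x)" by (auto simp: doubleton_eq_iff)
      then show "of_bool (mg_ends G e = {u, v}) = link x y u v"
        using xy(2) unfolding xy(1) by (cases "u = x \<and> v = y"; cases "u = y \<and> v = x") (simp_all add: link_arrow_values link_eq_0)
    qed
    also have "\<dots> = of_bool (x \<in> S \<and> y \<notin> S) + of_bool (y \<in> S \<and> x \<notin> S)"
      using cut_link[OF fin, of x y] xy(3,4) by simp
    also have "\<dots> = of_bool (card (mg_ends G e \<inter> S) = 1)"
      using xy(2) unfolding xy(1) by (cases "x \<in> S"; cases "y \<in> S") simp_all
    finally show ?thesis .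
  qed
  have "cut_weight (parallel_count G) S (mg_verts G - S) =
      (\<Sum>e\<in>mg_edges G. cut_weight (\<lambda>u v. of_bool (mg_ends G e = {u, v})) S (mg_verts G - S))"
    unfolding cut_weight_def parallel_count_def
    by (subst (2) sum.swap, subst sum.swap) (intro sum.cong refl sum.swap)
  also have "\<dots> = (\<Sum>e\<in>mg_edges G. of_bool (card (mg_ends G e \<inter> S) = 1))"
    by (rule sum.cong[OF refl one])
  also have "\<dots> = card (edge_boundary G S)"
    unfolding edge_boundary_def using card_filter_of_bool[OF finE] by simp
  finally show ?thesis .
qed

lemma sum_degree:
  assumes S: "S \<subseteq> mg_verts G"
  shows "(\<Sum>v\<in>S. real (mg_degree G v)) =
    2 * card {e \<in> mg_edges G. mg_ends G e \<subseteq> S} + card (edge_boundary G S)"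
proof -
  have finV: "finite (mg_verts G)" and finE: "finite (mg_edges G)"
    using G by (rule multigraph.finite_verts, rule multigraph.finite_edges)
  have fin: "finite S" using S finV by (rule finite_subset)
  have "(\<Sum>v\<in>S. real (mg_degree G v)) = (\<Sum>e\<in>mg_edges G. \<Sum>v\<in>S. of_bool (v \<in> mg_ends G e))"
    unfolding mg_degree_def card_filter_of_bool[OF finE] by (rule sum.swap)
  also have "\<dots> = (\<Sum>e\<in>mg_edges G. 2 * of_bool (mg_ends G e \<subseteq> S) + of_bool (card (mg_ends G e \<inter> S) = 1))"
  proof (rule sum.cong[OF refl])
    fix e assume e: "e \<in> mg_edges G"
    have "{v \<in> S. v \<in> mg_ends G e} = mg_ends G e \<inter> S" by blast
    then have "(\<Sum>v\<in>S. of_bool (v \<in> mg_ends G e)) = real (card (mg_ends G e \<inter> S))"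
      using card_filter_of_bool[OF fin, of "\<lambda>v. v \<in> mg_ends G e"] by simp
    also have "\<dots> = 2 * of_bool (mg_ends G e \<subseteq> S) + of_bool (card (mg_ends G e \<inter> S) = 1)"
      by (subst card_ends_Int[OF e]) simp
    finally show "(\<Sum>v\<in>S. of_bool (v \<in> mg_ends G e)) =
      2 * of_bool (mg_ends G e \<subseteq> S) + (of_bool (card (mg_ends G e \<inter> S) = 1) :: real)" .
  qed
  also have "\<dots> = 2 * card {e \<in> mg_edges G. mg_ends G e \<subseteq> S} + card (edge_boundary G S)"
    unfolding edge_boundary_def
    by (simp only: of_nat_add of_nat_mult of_nat_numeral card_filter_of_bool[OF finE] sum.distrib sum_distrib_left)
  finally show ?thesis .
qed

lemma sum_degree_verts: "(\<Sum>v\<in>mg_verts G. real (mg_degree G v)) = 2 * card (mg_edges G)"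
proof -
  have "cut_weight (parallel_count G) (mg_verts G) (mg_verts G - mg_verts G) = 0" by (simp add: cut_weight_def)
  then have "card (edge_boundary G (mg_verts G)) = 0" using cut_parallel_count[OF order_refl] by simp
  moreover have "{e \<in> mg_edges G. mg_ends G e \<subseteq> mg_verts G} = mg_edges G"
    using multigraph.ends_in_verts[OF G] by auto
  ultimately show ?thesis using sum_degree[OF order_refl] by simp
qed

lemma sum_out_degree:
  assumes D: "is_orientation G D"
  shows "(\<Sum>v\<in>mg_verts G. out_degree D v) = card (mg_edges G)"
proof -
  have finV: "finite (mg_verts G)" and finE: "finite (mg_edges G)"
    using G by (rule multigraph.finite_verts, rule multigraph.finite_edges)
  have "tail D e \<in> mg_verts G" if e: "e \<in> mg_edges G" for e
    using D multigraph.ends_in_verts[OF G e] e unfolding is_orientation_def by blast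
  then have "tail D ` mg_edges G \<subseteq> mg_verts G" by blast
  from sum.group[OF finE finV this, of "\<lambda>_. 1 :: nat"] show ?thesis
    using D by (simp add: out_degree_def out_arcs_def is_orientation_def)
qed

lemma orientation_of_tails:
  assumes f: "\<forall>e\<in>mg_edges G. f e \<in> mg_ends G e"
  shows "\<exists>D. is_orientation G D \<and> (\<forall>v. out_degree D v = card {e \<in> mg_edges G. f e = v})"
proof -
  define g where "g e = the_elem (mg_ends G e - {f e})" for e
  let ?D = "\<lparr>verts = mg_verts G, arcs = mg_edges G, tail = f, head = g\<rparr>"
  have "{f e, g e} = mg_ends G e" if e: "e \<in> mg_edges G" for e
  proof -
    obtain x y where xy: "mg_ends G e = {x, y}" "x \<noteq> y" using edge_ends[OF e] by blast
    then consider "f e = x" | "f e = y" using f e by auto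
    then show ?thesis
    proof cases
      case 1
      then have "mg_ends G e - {f e} = {y}" using xy by auto
      then show ?thesis using xy 1 by (simp add: g_def)
    next
      case 2
      then have "mg_ends G e - {f e} = {x}" using xy by auto
      then show ?thesis using xy 2 by (auto simp: g_def)
    qed
  qed
  then have "is_orientation G ?D" by (simp add: is_orientation_def)
  moreover have "out_degree ?D v = card {e \<in> mg_edges G. f e = v}" for v
    by (simp add: out_degree_def out_arcs_def)
  ultimately show ?thesis by blast
qed

text \<open>Deviations sum to zero, so the upper bound for the complement is a lower bound for
  \<open>S\<close>. As the degrees in \<open>S\<close> count induced edges twice and boundary edges
  once, this lower bound is Hakimi's condition.\<close>

lemma orientation_of_deviation:
  assumes tot: "sum t (mg_verts G) = int (card (mg_edges G))"
    and dev: "\<And>S. S \<noteq> {} \<Longrightarrow> S \<subset> mg_verts G \<Longrightarrow>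
      (\<Sum>v\<in>S. of_int (t v) - real (mg_degree G v) / 2) \<le> card (edge_boundary G S) / 2"
  shows "\<exists>D. is_orientation G D \<and> (\<forall>v\<in>mg_verts G. int (out_degree D v) = t v)"
proof -
  let ?V = "mg_verts G"
  have finV: "finite ?V" and finE: "finite (mg_edges G)"
    using G by (rule multigraph.finite_verts, rule multigraph.finite_edges)
  define x where "x v = of_int (t v) - real (mg_degree G v) / 2" for v
  have xV: "sum x ?V = 0"
    using sum_degree_verts tot by (simp add: x_def sum_subtractf sum_divide_distrib[symmetric] flip: of_int_sum)
  have "int (card {e \<in> mg_edges G. mg_ends G e \<subseteq> S}) \<le> sum t S" if S: "S \<subseteq> ?V" for S
  proof -
    have "- (card (edge_boundary G S) / 2) \<le> sum x S"
    proof (cases "S = {} \<or> S = ?V")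
      case True
      then show ?thesis using xV by auto
    next
      case False
      then have S': "?V - S \<noteq> {}" "?V - S \<subset> ?V" "?V - (?V - S) = S" using S by auto
      have "real (card (edge_boundary G (?V - S))) = card (edge_boundary G S)"
        using cut_parallel_count[of "?V - S"] cut_parallel_count[OF S]
          cut_commute[OF weighting_parallel_count, of G S "?V - S"] S'(3) by simp
      moreover have "sum x ?V = sum x (?V - S) + sum x S" using S finV by (rule sum.subset_diff)
      ultimately show ?thesis using dev[OF S'(1,2)] xV by (simp add: x_def)
    qed
    moreover have "sum x S = of_int (sum t S) - (\<Sum>v\<in>S. real (mg_degree G v)) / 2"
      by (simp add: x_def sum_subtractf sum_divide_distrib)
    ultimately have "real (card {e \<in> mg_edges G. mg_ends G e \<subseteq> S}) \<le> of_int (sum t S)"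
      using sum_degree[OF S] by linarith
    then show ?thesis by (metis of_int_le_iff of_int_of_nat_eq)
  qed
  then have "\<exists>f. (\<forall>e\<in>mg_edges G. f e \<in> mg_ends G e) \<and>
      (\<forall>v\<in>?V. int (card {e \<in> mg_edges G. f e = v}) = t v)"
    using multigraph.ends_in_verts[OF G] multigraph.two_ends[OF G] tot
    by (intro orientation_exists[OF finE finV]) auto
  then obtain f where f: "\<forall>e\<in>mg_edges G. f e \<in> mg_ends G e"
    "\<forall>v\<in>?V. int (card {e \<in> mg_edges G. f e = v}) = t v" by blast
  obtain D where "is_orientation G D" "\<forall>v. out_degree D v = card {e \<in> mg_edges G. f e = v}"
    using orientation_of_tails[OF f(1)] by blast
  then show ?thesis using f(2) by auto
qed

end

lemma deviation_le_half:
  fixes k d :: real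
  assumes "1 \<le> k" "8 * k\<^sup>2 \<le> d"
  shows "k * (k + 1) / 4 * (3 / (4 * k\<^sup>2) * d) + k * (k + 1) / 2 + k * (k - 1) \<le> d / 2"
proof -
  \<comment> \<open>\<open>d * r\<close> is the part of d/2 left over by the first summand. For d at
    least \<open>8 * k^2\<close> it is at least \<open>k * (5 * k - 3) / 2\<close>, which covers the
    other two summands, with equality for k = 1 and d = 8.\<close>
  define r where "r = 1 / 2 - 3 * (k + 1) / (16 * k)"
  have r: "r = (5 * k - 3) / (16 * k)" using assms(1) by (simp add: r_def field_simps)
  have "8 * k\<^sup>2 * r \<le> d * r" using assms by (intro mult_right_mono) (simp_all add: r)
  moreover have "8 * k\<^sup>2 * r = k * (5 * k - 3) / 2" using assms(1) by (simp add: r power2_eq_square)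
  moreover have "k * (k + 1) / 4 * (3 / (4 * k\<^sup>2) * d) = d / 2 - d * r"
    using assms(1) by (simp add: r_def power2_eq_square field_simps)
  moreover have "k \<le> k * k" using assms(1) mult_right_mono[of 1 k k] by simp
  then have "k * (k + 1) / 2 + k * (k - 1) \<le> k * (5 * k - 3) / 2" by (simp add: field_simps)
  ultimately show ?thesis by linarith
qed

theorem theorem1p4:
  fixes G :: "('v, 'e) mgraph"
    and k :: nat
    and p q :: "'v \<Rightarrow> int"
  assumes "0 < k"
    and "multigraph G"
    and "edge_connected (8 * k ^ 2) G"
    and "\<And>v. v \<in> mg_verts G \<Longrightarrow>
           real_of_int (p v) \<le> real (mg_degree G v) / 2 \<and>
           real (mg_degree G v) / 2 \<le> real_of_int (q v)"
    and "\<And>v. v \<in> mg_verts G \<Longrightarrow> \<bar>q v - p v\<bar> \<le> int k"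
  shows "(\<exists>D :: ('v, 'e) pre_digraph. is_orientation G D \<and>
            (\<forall>v \<in> mg_verts G. int (out_degree D v) \<in> {p v, q v}))
     \<longleftrightarrow> (\<exists>t :: 'v \<Rightarrow> int. (\<forall>v \<in> mg_verts G. t v \<in> {p v, q v}) \<and>
            int (card (mg_edges G)) = (\<Sum>v \<in> mg_verts G. t v))"
proof
  assume "\<exists>D :: ('v, 'e) pre_digraph. is_orientation G D \<and> (\<forall>v \<in> mg_verts G. int (out_degree D v) \<in> {p v, q v})"
  then obtain D :: "('v, 'e) pre_digraph" where D: "is_orientation G D"
    "\<forall>v \<in> mg_verts G. int (out_degree D v) \<in> {p v, q v}" by blast
  have "int (card (mg_edges G)) = (\<Sum>v\<in>mg_verts G. int (out_degree D v))"
    using sum_out_degree[OF assms(2) D(1)] by (simp flip: of_nat_sum)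
  then show "\<exists>t :: 'v \<Rightarrow> int. (\<forall>v \<in> mg_verts G. t v \<in> {p v, q v}) \<and>
      int (card (mg_edges G)) = (\<Sum>v \<in> mg_verts G. t v)"
    using D(2) by (intro exI[of _ "\<lambda>v. int (out_degree D v)"] conjI)
next
  assume "\<exists>t :: 'v \<Rightarrow> int. (\<forall>v \<in> mg_verts G. t v \<in> {p v, q v}) \<and>
      int (card (mg_edges G)) = (\<Sum>v \<in> mg_verts G. t v)"
  then obtain s :: "'v \<Rightarrow> int" where s: "\<forall>v \<in> mg_verts G. s v \<in> {p v, q v}"
    "int (card (mg_edges G)) = (\<Sum>v \<in> mg_verts G. s v)" by blast
  let ?V = "mg_verts G"
  define h where "h v = real (mg_degree G v) / 2" for v
  \<comment> \<open>The factor is \<open>6 / (8 * k^2)\<close>, which turns cuts of at least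
    \<open>8 * k^2\<close> edges into cuts of weight at least 6.\<close>
  define w where "w u v = 3 / (4 * (real k)\<^sup>2) * parallel_count G u v" for u v
  have W: "weighting w"
    using weighting_parallel_count[of G] by (auto simp: weighting_def w_def)
  have cut_w: "cut_weight w S (?V - S) = 3 / (4 * (real k)\<^sup>2) * card (edge_boundary G S)" if "S \<subseteq> ?V" for S
    unfolding cut_parallel_count[OF assms(2) that, symmetric] w_def[abs_def] by (rule cut_scale)
  have conn: "8 * (real k)\<^sup>2 \<le> card (edge_boundary G S)" if "S \<noteq> {}" "S \<subset> ?V" for S
  proof -
    have "8 * k ^ 2 \<le> card (edge_boundary G S)" using assms(3) that by (simp add: edge_connected_def)
    then have "real (8 * k ^ 2) \<le> card (edge_boundary G S)" by (simp only: of_nat_le_iff)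
    then show ?thesis by simp
  qed
  have cuts: "6 \<le> cut_weight w S (?V - S)" if S: "S \<noteq> {}" "S \<subset> ?V" for S
  proof -
    have "3 / (4 * (real k)\<^sup>2) * (8 * (real k)\<^sup>2) \<le> 3 / (4 * (real k)\<^sup>2) * card (edge_boundary G S)"
      using conn[OF S] by (intro mult_left_mono) simp_all
    then show ?thesis using cut_w[of S] S(2) assms(1) by auto
  qed
  have pq: "of_int (p v) \<le> h v \<and> h v \<le> of_int (q v) \<and> q v - p v \<le> int k" if "v \<in> ?V" for v
    using assms(4,5)[OF that] by (simp add: h_def)
  have sV: "of_int (sum s ?V) = sum h ?V"
    unfolding s(2)[symmetric] using sum_degree_verts[OF assms(2)] by (simp add: h_def sum_divide_distrib[symmetric])
  have "\<exists>t :: 'v \<Rightarrow> int. (\<forall>v\<in>?V. t v \<in> {p v, q v}) \<and> sum t ?V = sum s ?V \<and>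
    (\<forall>S\<subseteq>?V. (\<Sum>v\<in>S. of_int (t v) - h v) \<le> real k * (real k + 1) / 4 * cut_weight w S (?V - S) +
      real k * (real k + 1) / 2 + real k * (real k - 1))"
    by (rule round_to_ends_balanced[OF multigraph.finite_verts[OF assms(2)] W cuts pq bspec[OF s(1)] sV assms(1)])
  then obtain t :: "'v \<Rightarrow> int" where t: "\<forall>v\<in>?V. t v \<in> {p v, q v}" "sum t ?V = sum s ?V"
    and dev: "\<forall>S\<subseteq>?V. (\<Sum>v\<in>S. of_int (t v) - h v) \<le> real k * (real k + 1) / 4 * cut_weight w S (?V - S) +
      real k * (real k + 1) / 2 + real k * (real k - 1)"
    by (elim exE conjE)
  have "\<exists>D :: ('v, 'e) pre_digraph. is_orientation G D \<and> (\<forall>v\<in>?V. int (out_degree D v) = t v)"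
  proof (rule orientation_of_deviation[OF assms(2)])
    show "sum t ?V = int (card (mg_edges G))" using t(2) s(2) by simp
    fix S assume S: "S \<noteq> {}" "S \<subset> ?V"
    then have SV: "S \<subseteq> ?V" by blast
    have k1: "1 \<le> real k" using assms(1) by simp
    have "(\<Sum>v\<in>S. of_int (t v) - h v) \<le> card (edge_boundary G S) / 2"
      using dev[rule_format, OF SV] deviation_le_half[OF k1 conn[OF S]] unfolding cut_w[OF SV] by (rule order_trans)
    then show "(\<Sum>v\<in>S. of_int (t v) - real (mg_degree G v) / 2) \<le> card (edge_boundary G S) / 2"
      by (simp only: h_def)
  qed
  then obtain D :: "('v, 'e) pre_digraph" where "is_orientation G D" "\<forall>v\<in>?V. int (out_degree D v) = t v" by blast
  then show "\<exists>D :: ('v, 'e) pre_digraph. is_orientation G D \<and> (\<forall>v \<in> mg_verts G. int (out_degree D v) \<in> {p v, q v})"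
    using t(1) by (intro exI[of _ D]) simp
qed

end
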